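(* Let $M\subset\mathbb R^2\times\mathbb R^2$ be a real-analytic embedded para-CR manifold and let $p\in M$. Then $M$ is of finite type $k$ at $p$ if and only if there exist coordinates $(x,y,a,b)$ centred at $p$ in the ambient space (with $(x,y)$ coordinates on the first factor and $(a,b)$ coordinates on the second factor) such that $M$ is locally given by $$y=a+\sum_{i=1}^{k-1}\gamma_i b^i x^{k-i}+o\bigl(|a|+(|x|+|b|)^k\bigr),$$ where at least one of the constants $\gamma_i\in\mathbb R$ is different from zero.
   Context: An embedded para-CR manifold is a hypersurface $M$ in the direct product $\mathbb R^2_{xy}\times\mathbb R^2_{ab}$ that, near each of its points and in suitable coordinates $(x,y)$ on the first and $(a,b)$ on the second factor centred at that point, is given by $y=a+\phi(a,b,x)$ with $\frac{\partial\phi}{\partial a}(0)=0$; it carries the direction fields $TM\cap T\mathbb R^2_{xy}$ and $TM\cap T\mathbb R^2_{ab}$. Coordinates of the ambient space are real-analytic and respect the product structure. A para-holomorphic curve in $\mathbb R^2_{xy}\times\mathbb R^2_{ab}$ is a mapping $(s,t)\mapsto(x(t),y(t),a(s),b(s))$, i.e. a direct product of two curves. It is regular at $(s_0,t_0)$ if at least one of $x'(t_0),y'(t_0)$ and at least one of $a'(s_0),b'(s_0)$ is non-zero. The order of contact at $(s_0,t_0)$ of a para-holomorphic curve $F$ with $F(s_0,t_0)=p$ with $M$ is the order of vanishing at $(s_0,t_0)$ of $\rho\circ F$ as a function of $(s,t)$, where $\rho$ is a local defining function of $M$ near $p$ with $d\rho(p)\ne0$. $M$ is of finite type $k$ at $p$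 if $k$ is the (finite) maximum of the orders of contact with $M$ of para-holomorphic curves that are regular at $(s_0,t_0)$ and map $(s_0,t_0)$ to $p$. *)

theory Defs
  imports
    "HOL-Analysis.Analysis"
    "HOL-Library.FuncSet"
    "HOL-Library.Extended_Nat"
    "HOL-Library.Landau_Symbols"
begin

(* Multi-indices are the functions alpha from the orthonormal basis of the domain to nat,
   taken extensional so that each multi-index occurs exactly once. Over a
   finite-dimensional target, has_sum is absolute convergence of the Taylor series. *)
definition real_analytic_at ::
  "('a::euclidean_space \<Rightarrow> 'b::euclidean_space) \<Rightarrow> 'a \<Rightarrow> bool" where
  "real_analytic_at f p \<longleftrightarrow>
     (\<exists>c :: ('a \<Rightarrow> nat) \<Rightarrow> 'b. \<exists>r>0. \<forall>h. norm h < r \<longrightarrow>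
        ((\<lambda>\<alpha>. (\<Prod>e\<in>Basis. (h \<bullet> e) ^ \<alpha> e) *\<^sub>R c \<alpha>) has_sum f (p + h))
          (Basis \<rightarrow>\<^sub>E UNIV))"

definition real_analytic_on ::
  "('a::euclidean_space \<Rightarrow> 'b::euclidean_space) \<Rightarrow> 'a set \<Rightarrow> bool" where
  "real_analytic_on f S \<longleftrightarrow> (\<forall>z\<in>S. real_analytic_at f z)"

type_synonym plane = "real \<times> real"

(* Points of the ambient space are written ((x, y), (a, b)). *)
type_synonym ambient = "plane \<times> plane"

(* Only the germ of Z at q matters; values of Z away from q are irrelevant. *)
definition coordinates_centred_at :: "plane \<Rightarrow> (plane \<Rightarrow> plane) \<Rightarrow> bool" where
  "coordinates_centred_at q Z \<longleftrightarrow>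
     Z q = 0 \<and>
     (\<exists>U V Z'. open U \<and> q \<in> U \<and> open V \<and> homeomorphism U V Z Z' \<and>
        real_analytic_on Z U \<and> real_analytic_on Z' V)"

definition product_coordinates_centred_at ::
  "ambient \<Rightarrow> (plane \<Rightarrow> plane) \<Rightarrow> (plane \<Rightarrow> plane) \<Rightarrow> bool" where
  "product_coordinates_centred_at p XY AB \<longleftrightarrow>
     coordinates_centred_at (fst p) XY \<and> coordinates_centred_at (snd p) AB"

(* Near p, M is y = a + \<phi>(a,b,x) in the coordinates (x,y) = XY, (a,b) = AB. *)
definition locally_given_by ::
  "ambient set \<Rightarrow> ambient \<Rightarrow> (plane \<Rightarrow> plane) \<Rightarrow> (plane \<Rightarrow> plane) \<Rightarrow>
    (real \<times> real \<times> real \<Rightarrow> real) \<Rightarrow> bool" where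
  "locally_given_by M p XY AB \<phi> \<longleftrightarrow>
     real_analytic_at \<phi> 0 \<and>
     (\<exists>W. open W \<and> p \<in> W \<and>
        (\<forall>(u, v)\<in>W. (u, v) \<in> M \<longleftrightarrow>
           (let (x, y) = XY u; (a, b) = AB v in y = a + \<phi> (a, b, x))))"

definition real_analytic_para_CR_manifold :: "ambient set \<Rightarrow> bool" where
  "real_analytic_para_CR_manifold M \<longleftrightarrow>
     (\<forall>p\<in>M. \<exists>XY AB \<phi>.
        product_coordinates_centred_at p XY AB \<and>
        locally_given_by M p XY AB \<phi> \<and>
        deriv (\<lambda>a. \<phi> (a, 0, 0)) 0 = 0)"

definition local_defining_function ::
  "ambient set \<Rightarrow> ambient \<Rightarrow> (ambient \<Rightarrow> real) \<Rightarrow> bool" where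
  "local_defining_function M p \<rho> \<longleftrightarrow>
     real_analytic_at \<rho> p \<and>
     (\<exists>W. open W \<and> p \<in> W \<and> (\<forall>z\<in>W. z \<in> M \<longleftrightarrow> \<rho> z = 0)) \<and>
     (\<exists>D. (\<rho> has_derivative D) (at p) \<and> D \<noteq> (\<lambda>h. 0))"

definition para_holomorphic_curve_at ::
  "(real \<times> real \<Rightarrow> ambient) \<Rightarrow> real \<times> real \<Rightarrow> bool" where
  "para_holomorphic_curve_at F = (\<lambda>(s0, t0).
     \<exists>xy ab. F = (\<lambda>(s, t). (xy t, ab s)) \<and>
       real_analytic_at xy t0 \<and> real_analytic_at ab s0)"

(* F (s, t) = ((x t, y t), (a s, b s)): the first component does not depend on s
   and the second one does not depend on t. *)
definition regular_curve_at ::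
  "(real \<times> real \<Rightarrow> ambient) \<Rightarrow> real \<times> real \<Rightarrow> bool" where
  "regular_curve_at F = (\<lambda>(s0, t0).
     (deriv (\<lambda>t. fst (fst (F (s0, t)))) t0 \<noteq> 0 \<or>
      deriv (\<lambda>t. snd (fst (F (s0, t)))) t0 \<noteq> 0) \<and>
     (deriv (\<lambda>s. fst (snd (F (s, t0)))) s0 \<noteq> 0 \<or>
      deriv (\<lambda>s. snd (snd (F (s, t0)))) s0 \<noteq> 0))"

definition mixed_partial ::
  "nat \<Rightarrow> nat \<Rightarrow> (real \<times> real \<Rightarrow> real) \<Rightarrow> real \<times> real \<Rightarrow> real" where
  "mixed_partial i j g = (\<lambda>(s0, t0).
     (deriv ^^ i) (\<lambda>s. (deriv ^^ j) (\<lambda>t. g (s, t)) t0) s0)"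

(* The infimum of the empty set is \<infinity>, the order of a function whose
   Taylor series vanishes. *)
definition vanishing_order :: "(real \<times> real \<Rightarrow> real) \<Rightarrow> real \<times> real \<Rightarrow> enat" where
  "vanishing_order g q = Inf {enat (i + j) | i j. mixed_partial i j g q \<noteq> 0}"

(* Stated as a relation because it refers to a defining function; the order does not
   depend on which one is used. *)
definition has_contact_order ::
  "(real \<times> real \<Rightarrow> ambient) \<Rightarrow> real \<times> real \<Rightarrow> ambient set \<Rightarrow> enat \<Rightarrow> bool" where
  "has_contact_order F q M n \<longleftrightarrow>
     (\<exists>\<rho>. local_defining_function M (F q) \<rho> \<and> vanishing_order (\<rho> \<circ> F) q = n)"

definition regular_contact_orders :: "ambient set \<Rightarrow> ambient \<Rightarrow> enat set" where
  "regular_contact_orders M p =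
     {n. \<exists>F q. para_holomorphic_curve_at F q \<and> regular_curve_at F q \<and> F q = p \<and>
        has_contact_order F q M n}"

definition finite_type :: "ambient set \<Rightarrow> ambient \<Rightarrow> nat \<Rightarrow> bool" where
  "finite_type M p k \<longleftrightarrow>
     enat k \<in> regular_contact_orders M p \<and>
     (\<forall>n\<in>regular_contact_orders M p. n \<le> enat k)"

end

theory Submission
  imports Defs
begin

text \<open>
  Let \<open>M\<close> be \<open>y = a + \<phi>(a,b,x)\<close>. Monomial shears \<open>y - d x\<^sup>N\<close> and \<open>a + c b\<^sup>N\<close> successively
  remove the pure terms of \<open>\<phi>(0,b,x)\<close> up to any given order, and \<open>\<phi>\<^sub>a(0) = 0\<close> makes
  \<open>\<phi>(a,b,x) - \<phi>(0,b,x)\<close> small compared with \<open>a\<close>. The lowest-order form of \<open>\<phi>(0,b,x)\<close> is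
  then the leading form of the normal form, and its degree is the order of contact of the curve
  along the \<open>x\<close>- and \<open>b\<close>-axes. No regular curve has higher contact with \<open>M\<close> in normal form: otherwise
  \<open>y(t) = o(t\<^sup>k)\<close> and \<open>a(s) = o(s\<^sup>k)\<close>, so by regularity \<open>x(t)\<close> and \<open>b(s)\<close> have non-zero linear terms,
  and rescaling \<open>s\<close> and \<open>t\<close> simultaneously shows that the leading form vanishes.
\<close>

section \<open>Majorised power series\<close>

text \<open>Contact order is quantified over all curves and all defining functions, and the two
  bounds use this differently. The upper bound needs only
  \<open>\<bar>defect\<bar> \<le> C * \<bar>\<rho>\<bar>\<close> for an arbitrary defining function
  \<rho>; the lower bound needs one curve and the one defining function \<open>defect\<close>. A
  contact condition mixes y(t) with a(s), but a para-holomorphic curve is a product, so freezing one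
  parameter at its base value separates them. The weight |a| in the remainder is the obstacle: a(s)
  is not known in advance to be O(s^k), so the remainder is measured against |a| + r^k and its |a|
  part is absorbed. Pure terms can be pushed to higher order without end; finite type k supplies the
  stopping point. That the lowest form has degree exactly k, and not merely at most k, follows from
  the converse implication applied to its actual degree. Composition of analytic maps and strict
  differentiability both come from one weighted l1 norm on power series.\<close>

definition multi_indices :: "('a::euclidean_space \<Rightarrow> nat) set" where
  "multi_indices = Basis \<rightarrow>\<^sub>E UNIV"

definition mpow :: "'a::euclidean_space \<Rightarrow> ('a \<Rightarrow> nat) \<Rightarrow> real" where
  "mpow h \<alpha> = (\<Prod>e\<in>Basis. (h \<bullet> e) ^ \<alpha> e)"

definition mdeg :: "('a::euclidean_space \<Rightarrow> nat) \<Rightarrow> nat" where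
  "mdeg \<alpha> = (\<Sum>e\<in>Basis. \<alpha> e)"

text \<open>Cubes rather than balls: on the cube of radius \<open>r\<close> a monomial of degree n
  is bounded by r^n, with equality at the corner, so one numerical series controls the power series
  on the whole cube.\<close>

definition cube :: "real \<Rightarrow> 'a::euclidean_space set" where
  "cube r = {h. \<forall>e\<in>Basis. \<bar>h \<bullet> e\<bar> \<le> r}"

definition expansion ::
  "(('a::euclidean_space \<Rightarrow> nat) \<Rightarrow> real) \<Rightarrow> real \<Rightarrow> real \<Rightarrow> ('a \<Rightarrow> real) \<Rightarrow> bool" where
  "expansion c r S f \<longleftrightarrow>
     ((\<lambda>\<alpha>. \<bar>c \<alpha>\<bar> * r ^ mdeg \<alpha>) has_sum S) multi_indices \<and>
     (\<forall>h\<in>cube r. ((\<lambda>\<alpha>. mpow h \<alpha> * c \<alpha>) has_sum f h) multi_indices)"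

text \<open>\<open>K\<close> bounds the weighted l1 norm of a power series of \<open>f\<close>.
  Power series form a Banach algebra for this norm, which is the source of the rules for products,
  infinite sums and substitution.\<close>

definition majorized :: "real \<Rightarrow> real \<Rightarrow> ('a::euclidean_space \<Rightarrow> real) \<Rightarrow> bool" where
  "majorized r K f \<longleftrightarrow> (\<exists>c S. expansion c r S f \<and> S \<le> K)"

lemma abs_mpow_le:
  assumes "h \<in> cube r"
  shows "\<bar>mpow h \<alpha>\<bar> \<le> r ^ mdeg \<alpha>"
proof -
  have "\<bar>mpow h \<alpha>\<bar> = (\<Prod>e\<in>Basis. \<bar>h \<bullet> e\<bar> ^ \<alpha> e)"
    by (simp add: mpow_def abs_prod power_abs)
  also have "\<dots> \<le> (\<Prod>e\<in>Basis. r ^ \<alpha> e)"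
    using assms by (intro prod_mono) (auto simp: cube_def intro!: power_mono)
  also have "\<dots> = r ^ mdeg \<alpha>"
    by (simp add: mdeg_def power_sum)
  finally show ?thesis .
qed

lemma has_sum_abs_imp_summable:
  fixes f g :: "'i \<Rightarrow> real"
  assumes "(g has_sum S) I" "\<And>i. i \<in> I \<Longrightarrow> \<bar>f i\<bar> \<le> g i"
  shows "f summable_on I" "\<bar>infsum f I\<bar> \<le> S"
proof -
  have ab: "(\<lambda>i. norm (f i)) summable_on I"
    by (rule summable_on_comparison_test[of g])
       (use assms in \<open>auto simp: has_sum_imp_summable\<close>)
  then show s: "f summable_on I"
    by (rule abs_summable_summable)
  have "\<bar>infsum f I\<bar> \<le> infsum (\<lambda>i. \<bar>f i\<bar>) I"
    using norm_infsum_bound[OF ab] by simp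
  also have "\<dots> \<le> S"
    using ab assms by (intro has_sum_mono[OF has_sum_infsum assms(1)]) auto
  finally show "\<bar>infsum f I\<bar> \<le> S" .
qed

text \<open>The terms of an expansion over an arbitrary index set are collected by multi-index; products and
  infinite sums of power series are both of this kind.\<close>
lemma majorizedI:
  fixes \<mu> :: "'i \<Rightarrow> ('a::euclidean_space \<Rightarrow> nat)" and a :: "'i \<Rightarrow> real"
  assumes r: "r > 0" and \<mu>: "\<And>i. i \<in> I \<Longrightarrow> \<mu> i \<in> multi_indices"
    and s: "((\<lambda>i. \<bar>a i\<bar> * r ^ mdeg (\<mu> i)) has_sum K) I"
    and f: "\<And>h. h \<in> cube r \<Longrightarrow> ((\<lambda>i. mpow h (\<mu> i) * a i) has_sum f h) I"
  shows "majorized r K f"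
proof -
  define B where "B \<alpha> = {i\<in>I. \<mu> i = \<alpha>}" for \<alpha>
  define c where "c \<alpha> = infsum a (B \<alpha>)" for \<alpha>
  have bij: "bij_betw (\<lambda>i. (\<mu> i, i)) I (Sigma multi_indices B)"
    by (rule bij_betw_byWitness[of _ snd]) (use \<mu> in \<open>auto simp: B_def\<close>)
  have s1: "((\<lambda>(\<alpha>, i). \<bar>a i\<bar> * r ^ mdeg \<alpha>) has_sum K) (Sigma multi_indices B)"
    using s by (subst has_sum_reindex_bij_betw[OF bij, symmetric]) simp
  have f1: "((\<lambda>(\<alpha>, i). mpow h \<alpha> * a i) has_sum f h) (Sigma multi_indices B)" if "h \<in> cube r" for h
    using f[OF that] by (subst has_sum_reindex_bij_betw[OF bij, symmetric]) simp
  \<comment> \<open>On a fibre of \<open>\<mu>\<close> the weight \<open>r ^ mdeg \<alpha>\<close>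
    is a constant, non-zero because r > 0, and cancels from the convergence.\<close>
  have ab: "(\<lambda>i. \<bar>a i\<bar>) summable_on B \<alpha>" for \<alpha>
  proof -
    have "(\<lambda>i. \<bar>a i\<bar> * r ^ mdeg (\<mu> i)) summable_on B \<alpha>"
      using has_sum_imp_summable[OF s] by (rule summable_on_subset) (auto simp: B_def)
    then have "(\<lambda>i. \<bar>a i\<bar> * r ^ mdeg \<alpha>) summable_on B \<alpha>"
      by (rule summable_on_cong[THEN iffD1, rotated]) (auto simp: B_def)
    then show ?thesis
      using r by (simp add: summable_on_cmult_left')
  qed
  have a: "(a has_sum c \<alpha>) (B \<alpha>)" "\<bar>c \<alpha>\<bar> \<le> infsum (\<lambda>i. \<bar>a i\<bar>) (B \<alpha>)" for \<alpha>
    using has_sum_abs_imp_summable[OF has_sum_infsum[OF ab], of \<alpha> a] by (auto simp: c_def)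
  have t: "((\<lambda>\<alpha>. infsum (\<lambda>i. \<bar>a i\<bar>) (B \<alpha>) * r ^ mdeg \<alpha>) has_sum K) multi_indices"
    by (rule has_sum_SigmaD[OF s1]) (auto intro!: has_sum_cmult_left has_sum_infsum ab)
  have le: "\<bar>\<bar>c \<alpha>\<bar> * r ^ mdeg \<alpha>\<bar> \<le> infsum (\<lambda>i. \<bar>a i\<bar>) (B \<alpha>) * r ^ mdeg \<alpha>" for \<alpha>
    using a(2) r by (simp add: abs_mult mult_right_mono)
  have cf: "((\<lambda>\<alpha>. mpow h \<alpha> * c \<alpha>) has_sum f h) multi_indices" if "h \<in> cube r" for h
    by (rule has_sum_SigmaD[OF f1[OF that]]) (auto intro!: has_sum_cmult_right a)
  note sm = has_sum_abs_imp_summable[OF t le]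
  show ?thesis
    unfolding majorized_def expansion_def
    using has_sum_infsum[OF sm(1)] sm(2) cf by (meson abs_le_D1)
qed

lemma expansion_bound:
  assumes "expansion c r S f" "h \<in> cube r"
  shows "\<bar>f h\<bar> \<le> S"
proof -
  have "((\<lambda>\<alpha>. mpow h \<alpha> * c \<alpha>) has_sum f h) multi_indices"
    using assms by (auto simp: expansion_def)
  moreover have "\<bar>infsum (\<lambda>\<alpha>. mpow h \<alpha> * c \<alpha>) multi_indices\<bar> \<le> S"
    by (rule has_sum_abs_imp_summable[of "\<lambda>\<alpha>. \<bar>c \<alpha>\<bar> * r ^ mdeg \<alpha>"])
       (use assms in \<open>auto simp: expansion_def abs_mult mult.commute intro!: mult_left_mono abs_mpow_le\<close>)
  ultimately show ?thesis
    by (simp add: infsumI)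
qed

lemma majorized_bound: "majorized r K f \<Longrightarrow> h \<in> cube r \<Longrightarrow> \<bar>f h\<bar> \<le> K"
  unfolding majorized_def using expansion_bound by force

lemma majorized_mono: "majorized r K f \<Longrightarrow> K \<le> L \<Longrightarrow> majorized r L f"
  unfolding majorized_def by force

lemma expansion_nonneg: "expansion c r S f \<Longrightarrow> r \<ge> 0 \<Longrightarrow> S \<ge> 0"
  unfolding expansion_def by (auto intro: has_sum_nonneg)

section \<open>Arithmetic of majorised series\<close>

lemma majorized_monomial:
  assumes "r > 0" "\<alpha> \<in> multi_indices"
  shows "majorized r (\<bar>c\<bar> * r ^ mdeg \<alpha>) (\<lambda>h. c * mpow h \<alpha>)"
  by (rule majorizedI[of r "{()}" "\<lambda>_. \<alpha>" "\<lambda>_. c"]) (use assms in \<open>auto simp: mult.commute intro!: has_sum_finiteI\<close>)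

lemma mdeg_zero: "mdeg (restrict (\<lambda>_. 0) Basis) = 0"
  by (simp add: mdeg_def)

lemma mpow_zero: "mpow h (restrict (\<lambda>_. 0) Basis) = 1"
  by (simp add: mpow_def)

lemma majorized_const: "r > 0 \<Longrightarrow> majorized r \<bar>c\<bar> (\<lambda>h. c)"
  using majorized_monomial[of r "restrict (\<lambda>_. 0) Basis" c]
  by (simp add: multi_indices_def mdeg_zero mpow_zero)

lemma majorized_coord:
  assumes "r > 0" "e \<in> Basis"
  shows "majorized r r (\<lambda>h. h \<bullet> e)"
proof -
  define \<alpha> where "\<alpha> = restrict (\<lambda>e'. if e' = e then 1 else 0 :: nat) Basis"
  have "mdeg \<alpha> = 1"
    unfolding mdeg_def using assms by (simp add: \<alpha>_def)
  moreover have "mpow h \<alpha> = h \<bullet> e" for h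
  proof -
    have "mpow h \<alpha> = (\<Prod>e'\<in>Basis. if e' = e then h \<bullet> e else 1)"
      unfolding mpow_def by (rule prod.cong) (auto simp: \<alpha>_def)
    then show ?thesis using assms by simp
  qed
  moreover have "\<alpha> \<in> multi_indices"
    by (simp add: \<alpha>_def multi_indices_def)
  ultimately show ?thesis
    using majorized_monomial[of r \<alpha> 1] assms by simp
qed

text \<open>Cauchy product: the double series over pairs of multi-indices is majorised by the
  product of the two numerical series, so the norm is submultiplicative.\<close>

lemma majorized_mult:
  fixes f g :: "'a::euclidean_space \<Rightarrow> real"
  assumes r: "r > 0" and "majorized r K f" "majorized r L g"
  shows "majorized r (K * L) (\<lambda>h. f h * g h)"
proof -
  obtain c S d T where c: "expansion c r S f" "S \<le> K" and d: "expansion d r T g" "T \<le> L"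
    using assms by (auto simp: majorized_def)
  define \<mu> :: "('a \<Rightarrow> nat) \<times> ('a \<Rightarrow> nat) \<Rightarrow> ('a \<Rightarrow> nat)"
    where "\<mu> = (\<lambda>(\<beta>, \<gamma>). restrict (\<lambda>e. \<beta> e + \<gamma> e) Basis)"
  have \<mu>: "\<mu> i \<in> multi_indices" for i
    by (auto simp: \<mu>_def multi_indices_def split: prod.split)
  have md: "mdeg (\<mu> (\<beta>, \<gamma>)) = mdeg \<beta> + mdeg \<gamma>" for \<beta> \<gamma>
    by (simp add: \<mu>_def mdeg_def sum.distrib)
  have mp: "mpow h (\<mu> (\<beta>, \<gamma>)) = mpow h \<beta> * mpow h \<gamma>" for \<beta> \<gamma> h
    by (simp add: \<mu>_def mpow_def prod.distrib power_add)
  note cS = c(1)[unfolded expansion_def, THEN conjunct1]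
  note dT = d(1)[unfolded expansion_def, THEN conjunct1]
  let ?I = "multi_indices \<times> multi_indices :: (('a \<Rightarrow> nat) \<times> ('a \<Rightarrow> nat)) set"
  let ?F = "\<lambda>(\<beta>, \<gamma>). (\<bar>c \<beta>\<bar> * r ^ mdeg \<beta>) * (\<bar>d \<gamma>\<bar> * r ^ mdeg \<gamma>)"
  have inner: "((\<lambda>\<gamma>. ?F (\<beta>, \<gamma>)) has_sum \<bar>c \<beta>\<bar> * r ^ mdeg \<beta> * T) multi_indices" for \<beta>
    using has_sum_cmult_right[OF dT] by simp
  have outer: "((\<lambda>\<beta>. \<bar>c \<beta>\<bar> * r ^ mdeg \<beta> * T) has_sum S * T) multi_indices"
    by (rule has_sum_cmult_left[OF cS])
  have summ: "?F summable_on ?I"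
    by (rule summable_on_SigmaI[OF inner has_sum_imp_summable[OF outer]]) (use r in auto)
  have sF: "(?F has_sum S * T) ?I"
    by (rule has_sum_SigmaI[OF inner outer summ])
  have "majorized r (S * T) (\<lambda>h. f h * g h)"
  proof (rule majorizedI[where I = ?I and \<mu> = \<mu> and a = "\<lambda>(\<beta>, \<gamma>). c \<beta> * d \<gamma>"])
    show "((\<lambda>i. \<bar>case i of (\<beta>, \<gamma>) \<Rightarrow> c \<beta> * d \<gamma>\<bar> * r ^ mdeg (\<mu> i)) has_sum S * T) ?I"
      by (rule has_sum_cong[THEN iffD1, OF _ sF])
         (auto simp: md power_add abs_mult mult_ac)
    fix h :: 'a assume h: "h \<in> cube r"
    let ?G = "\<lambda>(\<beta>, \<gamma>). (mpow h \<beta> * c \<beta>) * (mpow h \<gamma> * d \<gamma>)"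
    have 1: "((\<lambda>\<gamma>. ?G (\<beta>, \<gamma>)) has_sum (mpow h \<beta> * c \<beta>) * g h) multi_indices" for \<beta>
      using has_sum_cmult_right[of "\<lambda>\<alpha>. mpow h \<alpha> * d \<alpha>" multi_indices "g h"] d(1) h
      by (simp add: expansion_def)
    have 2: "((\<lambda>\<beta>. (mpow h \<beta> * c \<beta>) * g h) has_sum f h * g h) multi_indices"
      by (rule has_sum_cmult_left) (use c(1) h in \<open>auto simp: expansion_def\<close>)
    have 3: "?G summable_on ?I"
    proof (rule has_sum_abs_imp_summable(1)[OF sF])
      fix i :: "('a \<Rightarrow> nat) \<times> ('a \<Rightarrow> nat)"
      show "\<bar>?G i\<bar> \<le> ?F i"
        using abs_mpow_le[OF h] r
        by (auto simp: abs_mult mult_ac split: prod.split intro!: mult_mono)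
    qed
    show "((\<lambda>i. mpow h (\<mu> i) * (case i of (\<beta>, \<gamma>) \<Rightarrow> c \<beta> * d \<gamma>)) has_sum f h * g h) ?I"
      by (rule has_sum_cong[THEN iffD1, OF _ has_sum_SigmaI[OF 1 2 3]]) (auto simp: mp)
  qed (use r \<mu> in auto)
  moreover have "S * T \<le> K * L"
    using c d expansion_nonneg[OF c(1)] expansion_nonneg[OF d(1)] r by (intro mult_mono) auto
  ultimately show ?thesis by (rule majorized_mono)
qed

lemma majorized_power:
  assumes "r > 0" "majorized r K f"
  shows "majorized r (K ^ n) (\<lambda>h. f h ^ n)"
  using assms majorized_const[of r 1] by (induction n) (auto intro: majorized_mult)

lemma majorized_prod:
  assumes "r > 0" "\<And>i. i \<in> A \<Longrightarrow> majorized r (K i) (f i)"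
  shows "majorized r (\<Prod>i\<in>A. K i) (\<lambda>h. \<Prod>i\<in>A. f i h)"
  using assms(2)
proof (induction A rule: infinite_finite_induct)
  case (insert i A)
  then show ?case
    using majorized_mult[OF assms(1), of "K i" "f i" "prod K A" "\<lambda>h. \<Prod>i\<in>A. f i h"] by simp
qed (use assms majorized_const[of r 1] in auto)

text \<open>Completeness of the weighted norm. The sums over \<open>I\<close> and over multi-indices
  may be interchanged because the joint family converges absolutely, its total being the sum of the
  norms.\<close>

lemma majorized_infsum:
  fixes f :: "'i \<Rightarrow> 'a::euclidean_space \<Rightarrow> real"
  assumes r: "r > 0" and f: "\<And>i. i \<in> I \<Longrightarrow> majorized r (K i) (f i)"
    and K: "(K has_sum L) I" and F: "\<And>h. h \<in> cube r \<Longrightarrow> ((\<lambda>i. f i h) has_sum F h) I"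
  shows "majorized r L F"
proof -
  have "\<forall>i\<in>I. \<exists>c S. expansion c r S (f i) \<and> S \<le> K i"
    using f by (auto simp: majorized_def)
  then obtain c S where c: "\<And>i. i \<in> I \<Longrightarrow> expansion (c i) r (S i) (f i)"
    and S: "\<And>i. i \<in> I \<Longrightarrow> S i \<le> K i"
    by metis
  have S0: "i \<in> I \<Longrightarrow> 0 \<le> S i" for i
    using expansion_nonneg[OF c] r by force
  have sS: "S summable_on I" "\<bar>infsum S I\<bar> \<le> L"
    by (rule has_sum_abs_imp_summable[OF K]; use S S0 in force)+
  let ?J = "I \<times> (multi_indices :: ('a \<Rightarrow> nat) set)"
  let ?F = "\<lambda>(i, \<alpha>). \<bar>c i \<alpha>\<bar> * r ^ mdeg \<alpha>"
  have inner: "((\<lambda>\<alpha>. ?F (i, \<alpha>)) has_sum S i) multi_indices" if "i \<in> I" for i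
    using c[OF that] by (simp add: expansion_def)
  have summ: "?F summable_on ?J"
    by (rule summable_on_SigmaI[OF inner sS(1)]) (use r in auto)
  have sF: "(?F has_sum infsum S I) ?J"
    by (rule has_sum_SigmaI[OF inner has_sum_infsum[OF sS(1)] summ])
  have "majorized r (infsum S I) F"
  proof (rule majorizedI[where I = ?J and \<mu> = snd and a = "\<lambda>(i, \<alpha>). c i \<alpha>"])
    show "((\<lambda>j. \<bar>case j of (i, \<alpha>) \<Rightarrow> c i \<alpha>\<bar> * r ^ mdeg (snd j)) has_sum infsum S I) ?J"
      using sF by (simp add: case_prod_beta')
    fix h :: 'a assume h: "h \<in> cube r"
    let ?G = "\<lambda>(i, \<alpha>). mpow h \<alpha> * c i \<alpha>"
    have 1: "((\<lambda>\<alpha>. ?G (i, \<alpha>)) has_sum f i h) multi_indices" if "i \<in> I" for i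
      using c[OF that] h by (simp add: expansion_def)
    have 3: "?G summable_on ?J"
    proof (rule has_sum_abs_imp_summable(1)[OF sF])
      fix j
      show "\<bar>?G j\<bar> \<le> ?F j"
        using abs_mpow_le[OF h] by (auto simp: abs_mult mult.commute[of "\<bar>c _ _\<bar>"] split: prod.split intro!: mult_right_mono)
    qed
    show "((\<lambda>j. mpow h (snd j) * (case j of (i, \<alpha>) \<Rightarrow> c i \<alpha>)) has_sum F h) ?J"
      using has_sum_SigmaI[OF 1 F[OF h] 3] by (simp add: case_prod_beta')
  qed (use r in auto)
  then show ?thesis
    using sS(2) by (auto intro: majorized_mono)
qed

lemma majorized_sum:
  assumes "r > 0" "finite A" "\<And>i. i \<in> A \<Longrightarrow> majorized r (K i) (f i)"
  shows "majorized r (\<Sum>i\<in>A. K i) (\<lambda>h. \<Sum>i\<in>A. f i h)"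
  by (rule majorized_infsum[of r A K f]) (use assms in auto)

text \<open>Substitution needs only that each component of \<open>g\<close> has norm at most the
  radius \<open>s\<close> of \<open>f\<close>: then the monomial with multi-index \<alpha> in
  \<open>g\<close> has norm at most \<open>s ^ mdeg \<alpha>\<close>, and the outer series converges
  in norm.\<close>

lemma majorized_compose:
  fixes f :: "'b::euclidean_space \<Rightarrow> real" and g :: "'a::euclidean_space \<Rightarrow> 'b"
  assumes r: "r > 0" and f: "majorized s K f"
    and g: "\<And>e. e \<in> Basis \<Longrightarrow> majorized r s (\<lambda>h. g h \<bullet> e)"
  shows "majorized r K (\<lambda>h. f (g h))"
proof -
  obtain c S where c: "expansion c s S f" and S: "S \<le> K"
    using f by (auto simp: majorized_def)
  have gc: "g h \<in> cube s" if "h \<in> cube r" for h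
    using majorized_bound[OF g that] by (auto simp: cube_def)
  have s: "((\<lambda>\<alpha>. \<bar>c \<alpha>\<bar> * s ^ mdeg \<alpha>) has_sum S) multi_indices"
    using c by (simp add: expansion_def)
  have "majorized r (\<bar>c \<alpha>\<bar> * s ^ mdeg \<alpha>) (\<lambda>h. c \<alpha> * mpow (g h) \<alpha>)" for \<alpha>
    unfolding mpow_def mdeg_def power_sum
    by (intro majorized_mult majorized_const majorized_prod majorized_power r g)
  moreover have "((\<lambda>\<alpha>. c \<alpha> * mpow (g h) \<alpha>) has_sum f (g h)) multi_indices" if "h \<in> cube r" for h
    using c gc[OF that] by (simp add: expansion_def mult.commute)
  ultimately have "majorized r S (\<lambda>h. f (g h))"
    by (intro majorized_infsum[OF r _ s]) auto
  then show ?thesis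
    using S by (rule majorized_mono)
qed

lemma cube_mono: "r \<le> s \<Longrightarrow> cube r \<subseteq> cube s"
  by (force simp: cube_def)

lemma multi_indices_deg_0:
  assumes "\<alpha> \<in> multi_indices" "mdeg \<alpha> = 0"
  shows "\<alpha> = restrict (\<lambda>_. 0) (Basis :: 'a::euclidean_space set)"
  using assms by (auto simp: multi_indices_def mdeg_def fun_eq_iff PiE_iff extensional_def)

text \<open>Shrinking the cube gains a factor in every monomial of positive degree.\<close>
lemma majorized_shrink:
  fixes f :: "'a::euclidean_space \<Rightarrow> real"
  assumes f: "majorized r K f" and f0: "f 0 = 0" and s: "0 < s" "s \<le> r"
  shows "majorized s (s / r * K) f"
proof -
  obtain c S where c: "expansion c r S f" and S: "S \<le> K"
    using f by (auto simp: majorized_def)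
  let ?z = "restrict (\<lambda>_. 0) (Basis :: 'a set)"
  have z: "?z \<in> multi_indices"
    by (simp add: multi_indices_def)
  have "0 \<in> cube r" using s by (auto simp: cube_def)
  then have "((\<lambda>\<alpha>. mpow 0 \<alpha> * c \<alpha>) has_sum 0) multi_indices"
    using c f0 by (auto simp: expansion_def)
  \<comment> \<open>At the origin only the constant monomial survives (0^0 = 1), so
    \<open>f 0 = 0\<close> says precisely that the constant coefficient is zero.\<close>
  moreover have "mpow 0 \<alpha> = (if \<alpha> = ?z then 1 else 0)" if "\<alpha> \<in> multi_indices" for \<alpha> :: "'a \<Rightarrow> nat"
  proof -
    have "mpow (0::'a) \<alpha> = 0 ^ mdeg \<alpha>"
      by (simp add: mpow_def mdeg_def power_sum)
    moreover have "mdeg \<alpha> = 0 \<longleftrightarrow> \<alpha> = ?z"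
      using multi_indices_deg_0[OF that] mdeg_zero by blast
    ultimately show ?thesis by (cases "\<alpha> = ?z") (simp_all add: mdeg_zero power_0_left)
  qed
  ultimately have "((\<lambda>\<alpha>. if \<alpha> = ?z then c ?z else 0) has_sum 0) multi_indices"
    by (subst has_sum_cong[where g = "\<lambda>\<alpha>. mpow 0 \<alpha> * c \<alpha>"]) auto
  moreover have "((\<lambda>\<alpha>. if \<alpha> = ?z then c ?z else 0) has_sum c ?z) multi_indices"
    by (rule has_sum_finite_neutralI[of "{?z}"]) (use z in auto)
  ultimately have cz: "c ?z = 0"
    using has_sum_unique by blast
  let ?t = "\<lambda>\<alpha>. s / r * (\<bar>c \<alpha>\<bar> * r ^ mdeg \<alpha>)"
  have t: "(?t has_sum s / r * S) multi_indices"
    using c by (intro has_sum_cmult_right) (auto simp: expansion_def)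
  have le: "\<bar>\<bar>c \<alpha>\<bar> * s ^ mdeg \<alpha>\<bar> \<le> ?t \<alpha>" if "\<alpha> \<in> multi_indices" for \<alpha>
  proof (cases "mdeg \<alpha>")
    case 0
    then show ?thesis using multi_indices_deg_0[OF that] cz by simp
  next
    case (Suc n)
    have "s ^ Suc n \<le> s / r * r ^ Suc n"
      using s by (simp add: power_mono mult_left_mono)
    then have "\<bar>c \<alpha>\<bar> * s ^ mdeg \<alpha> \<le> \<bar>c \<alpha>\<bar> * (s / r * r ^ mdeg \<alpha>)"
      unfolding Suc by (rule mult_left_mono) simp
    then show ?thesis using s by (simp add: mult_ac)
  qed
  note sm = has_sum_abs_imp_summable[OF t le]
  have "expansion c s (infsum (\<lambda>\<alpha>. \<bar>c \<alpha>\<bar> * s ^ mdeg \<alpha>) multi_indices) f"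
    using c has_sum_infsum[OF sm(1)] cube_mono[OF s(2)] unfolding expansion_def by blast
  moreover have "s / r * S \<le> s / r * K"
    using S s by (simp add: mult_left_mono divide_right_mono)
  ultimately show ?thesis
    unfolding majorized_def using sm(2) by force
qed

section \<open>Real-analytic functions\<close>

lemma norm_less_if_cube:
  fixes h :: "'a::euclidean_space"
  assumes "h \<in> cube s" "real DIM('a) * s < r"
  shows "norm h < r"
proof -
  have "norm h \<le> (\<Sum>b\<in>Basis. \<bar>h \<bullet> b\<bar>)"
    by (rule norm_le_l1)
  also have "\<dots> \<le> real DIM('a) * s"
    using assms(1) by (intro sum_bounded_above) (auto simp: cube_def)
  finally show ?thesis using assms(2) by simp
qed

lemma cube_if_norm_le: "norm h \<le> r \<Longrightarrow> h \<in> cube r"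
  by (auto simp: cube_def intro: order_trans[OF Basis_le_norm])

text \<open>The definition asks for unconditional convergence point by point. At the corner of a
  small cube every monomial equals \<open>s ^ mdeg \<alpha>\<close>, and summability of reals is
  absolute, so this one point yields a majorant for the whole cube.\<close>

lemma real_analytic_at_real_iff:
  fixes f :: "'a::euclidean_space \<Rightarrow> real"
  shows "real_analytic_at f p \<longleftrightarrow> (\<exists>r>0. \<exists>K. majorized r K (\<lambda>h. f (p + h)))"
proof
  assume "real_analytic_at f p"
  then obtain c r where r: "r > 0"
    and c: "\<And>h. norm h < r \<Longrightarrow> ((\<lambda>\<alpha>. mpow h \<alpha> * c \<alpha>) has_sum f (p + h)) multi_indices"
    unfolding real_analytic_at_def mpow_def multi_indices_def real_scaleR_def by blast
  \<comment> \<open>The factor 2 makes the inclusion strict: points of the cube have norm at most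
    DIM * s = r / 2.\<close>
  define s where "s = r / (2 * DIM('a))"
  have s: "s > 0" and "real DIM('a) * s < r"
    using r by (auto simp: s_def)
  then have cu: "norm h < r" if "h \<in> cube s" for h :: 'a
    using norm_less_if_cube[OF that] by blast
  define h where "h = (\<Sum>e\<in>Basis. s *\<^sub>R e :: 'a)"
  have he: "h \<bullet> e = s" if "e \<in> Basis" for e
    using that by (simp add: h_def inner_sum_left inner_Basis if_distrib cong: if_cong)
  have "norm h < r"
    using he s by (intro cu) (auto simp: cube_def)
  have mp: "mpow h \<alpha> = s ^ mdeg \<alpha>" for \<alpha>
    by (simp add: mpow_def mdeg_def power_sum he)
  have "(\<lambda>\<alpha>. mpow h \<alpha> * c \<alpha>) summable_on multi_indices"
    using c[OF \<open>norm h < r\<close>] by (rule has_sum_imp_summable)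
  then have "(\<lambda>\<alpha>. norm (mpow h \<alpha> * c \<alpha>)) summable_on multi_indices"
    by (subst (asm) summable_on_iff_abs_summable_on_real)
  then have "(\<lambda>\<alpha>. \<bar>c \<alpha>\<bar> * s ^ mdeg \<alpha>) summable_on multi_indices"
    using s by (simp add: mp abs_mult mult.commute)
  then have "expansion c s (infsum (\<lambda>\<alpha>. \<bar>c \<alpha>\<bar> * s ^ mdeg \<alpha>) multi_indices) (\<lambda>h. f (p + h))"
    using c cu by (auto simp: expansion_def)
  then show "\<exists>r>0. \<exists>K. majorized r K (\<lambda>h. f (p + h))"
    using s by (auto simp: majorized_def)
next
  assume "\<exists>r>0. \<exists>K. majorized r K (\<lambda>h. f (p + h))"
  then obtain r c S where "r > 0" "expansion c r S (\<lambda>h. f (p + h))"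
    by (auto simp: majorized_def)
  then show "real_analytic_at f p"
    unfolding real_analytic_at_def expansion_def mpow_def multi_indices_def real_scaleR_def
    using cube_if_norm_le[OF less_imp_le] by blast
qed

lemma has_sum_sum:
  fixes f :: "'j \<Rightarrow> 'i \<Rightarrow> 'b::topological_comm_monoid_add"
  assumes "\<And>j. j \<in> J \<Longrightarrow> (f j has_sum S j) I"
  shows "((\<lambda>i. \<Sum>j\<in>J. f j i) has_sum (\<Sum>j\<in>J. S j)) I"
  using assms by (induction J rule: infinite_finite_induct) (auto intro: has_sum_add)

text \<open>Reduces vector-valued maps to the real-valued ones to which the majorant calculus
  applies. In the converse direction the component series are reassembled on the smallest of
  finitely many radii.\<close>

lemma real_analytic_at_componentwise:
  fixes f :: "'a::euclidean_space \<Rightarrow> 'b::euclidean_space"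
  shows "real_analytic_at f p \<longleftrightarrow> (\<forall>b\<in>Basis. real_analytic_at (\<lambda>z. f z \<bullet> b) p)"
proof (intro iffI ballI)
  fix b :: 'b
  assume "real_analytic_at f p"
  then obtain c r where r: "r > 0"
    and c: "\<And>h. norm h < r \<Longrightarrow>
       ((\<lambda>\<alpha>. (\<Prod>e\<in>Basis. (h \<bullet> e) ^ \<alpha> e) *\<^sub>R c \<alpha>) has_sum f (p + h)) (Basis \<rightarrow>\<^sub>E UNIV)"
    unfolding real_analytic_at_def by blast
  have "((\<lambda>\<alpha>. (\<Prod>e\<in>Basis. (h \<bullet> e) ^ \<alpha> e) *\<^sub>R (c \<alpha> \<bullet> b)) has_sum f (p + h) \<bullet> b) (Basis \<rightarrow>\<^sub>E UNIV)"
    if "norm h < r" for h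
    using has_sum_bounded_linear[OF bounded_linear_inner_left c[OF that], of b] by simp
  then show "real_analytic_at (\<lambda>z. f z \<bullet> b) p"
    unfolding real_analytic_at_def using r by (intro exI[of _ "\<lambda>\<alpha>. c \<alpha> \<bullet> b"] exI[of _ r] conjI allI impI)
next
  assume "\<forall>b\<in>Basis. real_analytic_at (\<lambda>z. f z \<bullet> b) p"
  then have "\<forall>b\<in>Basis. \<exists>c r. r > 0 \<and> (\<forall>h. norm h < r \<longrightarrow>
       ((\<lambda>\<alpha>. (\<Prod>e\<in>Basis. (h \<bullet> e) ^ \<alpha> e) *\<^sub>R c \<alpha>) has_sum f (p + h) \<bullet> b) (Basis \<rightarrow>\<^sub>E UNIV))"
    unfolding real_analytic_at_def .
  from bchoice[OF this] obtain c where "\<forall>b\<in>Basis. \<exists>r. r > 0 \<and> (\<forall>h. norm h < r \<longrightarrow>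
       ((\<lambda>\<alpha>. (\<Prod>e\<in>Basis. (h \<bullet> e) ^ \<alpha> e) *\<^sub>R c b \<alpha>) has_sum f (p + h) \<bullet> b) (Basis \<rightarrow>\<^sub>E UNIV))"
    by (elim exE)
  from bchoice[OF this] obtain r where cr: "\<forall>b\<in>Basis. r b > 0 \<and> (\<forall>h. norm h < r b \<longrightarrow>
       ((\<lambda>\<alpha>. (\<Prod>e\<in>Basis. (h \<bullet> e) ^ \<alpha> e) *\<^sub>R c b \<alpha>) has_sum f (p + h) \<bullet> b) (Basis \<rightarrow>\<^sub>E UNIV))"
    by (elim exE)
  have r: "r b > 0" if "b \<in> Basis" for b
    using bspec[OF cr that] by (rule conjunct1)
  have c: "((\<lambda>\<alpha>. (\<Prod>e\<in>Basis. (h \<bullet> e) ^ \<alpha> e) *\<^sub>R c b \<alpha>) has_sum f (p + h) \<bullet> b) (Basis \<rightarrow>\<^sub>E UNIV)"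
    if "b \<in> Basis" "norm h < r b" for b h
    using bspec[OF cr that(1)] that(2) by (elim conjE allE impE)
  define r0 where "r0 = Min (r ` Basis)"
  have "r0 > 0"
    using r by (simp add: r0_def)
  moreover have "r0 \<le> r b" if "b \<in> Basis" for b
    using that by (simp add: r0_def)
  ultimately have "((\<lambda>\<alpha>. (\<Prod>e\<in>Basis. (h \<bullet> e) ^ \<alpha> e) *\<^sub>R (\<Sum>b\<in>Basis. c b \<alpha> *\<^sub>R b)) has_sum f (p + h))
      (Basis \<rightarrow>\<^sub>E UNIV)" if "norm h < r0" for h
  proof -
    have "((\<lambda>\<alpha>. \<Sum>b\<in>Basis. ((\<Prod>e\<in>Basis. (h \<bullet> e) ^ \<alpha> e) *\<^sub>R c b \<alpha>) *\<^sub>R b) has_sum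
        (\<Sum>b\<in>Basis. (f (p + h) \<bullet> b) *\<^sub>R b)) (Basis \<rightarrow>\<^sub>E UNIV)"
    proof (rule has_sum_sum)
      fix b :: 'b assume b: "b \<in> Basis"
      have "norm h < r b"
        using that \<open>b \<in> Basis \<Longrightarrow> r0 \<le> r b\<close>[OF b] by simp
      from has_sum_bounded_linear[OF bounded_linear_scaleR_left c[OF b this], of b]
      show "((\<lambda>\<alpha>. ((\<Prod>e\<in>Basis. (h \<bullet> e) ^ \<alpha> e) *\<^sub>R c b \<alpha>) *\<^sub>R b) has_sum (f (p + h) \<bullet> b) *\<^sub>R b)
        (Basis \<rightarrow>\<^sub>E UNIV)" .
    qed
    then show ?thesis
      by (simp add: euclidean_representation scaleR_sum_right)
  qed
  then show "real_analytic_at f p"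
    unfolding real_analytic_at_def using \<open>r0 > 0\<close>
    by (intro exI[of _ "\<lambda>\<alpha>. \<Sum>b\<in>Basis. c b \<alpha> *\<^sub>R b"] exI[of _ r0] conjI allI impI)
qed

lemma majorized_restrict:
  assumes "majorized r K f" "0 < s" "s \<le> r"
  shows "majorized s K f"
proof -
  obtain c S where c: "expansion c r S f" and S: "S \<le> K"
    using assms by (auto simp: majorized_def)
  have le: "\<bar>\<bar>c \<alpha>\<bar> * s ^ mdeg \<alpha>\<bar> \<le> \<bar>c \<alpha>\<bar> * r ^ mdeg \<alpha>" for \<alpha>
    using assms by (simp add: abs_mult mult_left_mono power_mono)
  have "((\<lambda>\<alpha>. \<bar>c \<alpha>\<bar> * r ^ mdeg \<alpha>) has_sum S) multi_indices"
    using c by (simp add: expansion_def)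
  note sm = has_sum_abs_imp_summable[OF this le]
  have "expansion c s (infsum (\<lambda>\<alpha>. \<bar>c \<alpha>\<bar> * s ^ mdeg \<alpha>) multi_indices) f"
    using c has_sum_infsum[OF sm(1)] cube_mono[OF assms(3)] unfolding expansion_def by blast
  then show ?thesis
    unfolding majorized_def using sm(2) S by force
qed

text \<open>The bound \<open>K\<close> survives shrinking of the radius, so the criterion can be put
  as a statement about all small radii; finitely many such statements then hold at a common
  radius.\<close>

lemma real_analytic_at_real_iff_eventually:
  fixes f :: "'a::euclidean_space \<Rightarrow> real"
  shows "real_analytic_at f p \<longleftrightarrow> (\<exists>K. \<forall>\<^sub>F r in at_right 0. r > 0 \<and> majorized r K (\<lambda>h. f (p + h)))"
proof
  assume "real_analytic_at f p"
  then obtain r K where r: "r > 0" "majorized r K (\<lambda>h. f (p + h))"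
    by (auto simp: real_analytic_at_real_iff)
  then have "\<forall>\<^sub>F s in at_right 0. s > 0 \<and> majorized s K (\<lambda>h. f (p + h))"
    unfolding eventually_at_right_field
    by (intro exI[of _ r]) (auto intro: majorized_restrict)
  then show "\<exists>K. \<forall>\<^sub>F r in at_right 0. r > 0 \<and> majorized r K (\<lambda>h. f (p + h))" ..
next
  assume "\<exists>K. \<forall>\<^sub>F r in at_right 0. r > 0 \<and> majorized r K (\<lambda>h. f (p + h))"
  then obtain K where "\<forall>\<^sub>F r in at_right 0. r > 0 \<and> majorized r K (\<lambda>h. f (p + h))" ..
  then obtain r where "r > 0" "majorized r K (\<lambda>h. f (p + h))"
    using eventually_happens'[OF trivial_limit_at_right_real] by blast
  then show "real_analytic_at f p"
    by (auto simp: real_analytic_at_real_iff)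
qed

section \<open>Closure properties of real analyticity\<close>

lemma real_analytic_at_const: "real_analytic_at (\<lambda>z. c) p"
proof -
  have "real_analytic_at (\<lambda>z. c \<bullet> b) p" for b
    unfolding real_analytic_at_real_iff using majorized_const[of 1] zero_less_one by blast
  then show ?thesis
    by (subst real_analytic_at_componentwise) simp
qed

lemma majorized_add:
  assumes "r > 0" "majorized r K f" "majorized r L g"
  shows "majorized r (K + L) (\<lambda>h. f h + g h)"
proof -
  have "majorized r (\<Sum>i\<in>UNIV. if i then K else L) (\<lambda>h. \<Sum>i\<in>UNIV. (if i then f else g) h)"
    by (rule majorized_sum) (use assms in auto)
  then show ?thesis by (simp add: UNIV_bool add.commute)
qed

lemma real_analytic_at_add:
  fixes f g :: "'a::euclidean_space \<Rightarrow> real"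
  assumes "real_analytic_at f p" "real_analytic_at g p"
  shows "real_analytic_at (\<lambda>z. f z + g z) p"
proof -
  obtain K L where "\<forall>\<^sub>F r in at_right 0. r > 0 \<and> majorized r K (\<lambda>h. f (p + h))"
    "\<forall>\<^sub>F r in at_right 0. r > 0 \<and> majorized r L (\<lambda>h. g (p + h))"
    using assms by (auto simp: real_analytic_at_real_iff_eventually)
  then have "\<forall>\<^sub>F r in at_right 0. r > 0 \<and> majorized r (K + L) (\<lambda>h. f (p + h) + g (p + h))"
    by eventually_elim (auto intro: majorized_add)
  then show ?thesis by (auto simp: real_analytic_at_real_iff_eventually)
qed

lemma real_analytic_at_mult:
  fixes f g :: "'a::euclidean_space \<Rightarrow> real"
  assumes "real_analytic_at f p" "real_analytic_at g p"
  shows "real_analytic_at (\<lambda>z. f z * g z) p"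
proof -
  obtain K L where "\<forall>\<^sub>F r in at_right 0. r > 0 \<and> majorized r K (\<lambda>h. f (p + h))"
    "\<forall>\<^sub>F r in at_right 0. r > 0 \<and> majorized r L (\<lambda>h. g (p + h))"
    using assms by (auto simp: real_analytic_at_real_iff_eventually)
  then have "\<forall>\<^sub>F r in at_right 0. r > 0 \<and> majorized r (K * L) (\<lambda>h. f (p + h) * g (p + h))"
    by eventually_elim (auto intro: majorized_mult)
  then show ?thesis by (auto simp: real_analytic_at_real_iff_eventually)
qed

lemma real_analytic_at_diff:
  fixes f g :: "'a::euclidean_space \<Rightarrow> real"
  assumes "real_analytic_at f p" "real_analytic_at g p"
  shows "real_analytic_at (\<lambda>z. f z - g z) p"
  using real_analytic_at_add[OF assms(1) real_analytic_at_mult[OF real_analytic_at_const[of "- 1"] assms(2)]]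
  by simp

lemma real_analytic_at_power:
  fixes f :: "'a::euclidean_space \<Rightarrow> real"
  assumes "real_analytic_at f p"
  shows "real_analytic_at (\<lambda>z. f z ^ n) p"
  by (induction n) (auto intro: real_analytic_at_mult real_analytic_at_const assms)

lemma real_analytic_at_sum:
  fixes f :: "'i \<Rightarrow> 'a::euclidean_space \<Rightarrow> real"
  assumes "\<And>i. i \<in> A \<Longrightarrow> real_analytic_at (f i) p"
  shows "real_analytic_at (\<lambda>z. \<Sum>i\<in>A. f i z) p"
  using assms
  by (induction A rule: infinite_finite_induct)
     (auto intro: real_analytic_at_add real_analytic_at_const)

lemma real_analytic_at_inner_Basis:
  assumes "b \<in> Basis"
  shows "real_analytic_at (\<lambda>z. z \<bullet> b) p"
proof -
  have "majorized 1 (\<bar>p \<bullet> b\<bar> + 1) (\<lambda>h. p \<bullet> b + h \<bullet> b)"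
    using assms by (intro majorized_add majorized_const majorized_coord) auto
  then show ?thesis
    unfolding real_analytic_at_real_iff inner_add_left using zero_less_one by blast
qed

lemma real_analytic_at_linear:
  fixes f :: "'a::euclidean_space \<Rightarrow> 'b::euclidean_space"
  assumes "linear f"
  shows "real_analytic_at f p"
proof (subst real_analytic_at_componentwise, intro ballI)
  fix b :: 'b assume "b \<in> Basis"
  have "f z \<bullet> b = (\<Sum>e\<in>Basis. (z \<bullet> e) * (f e \<bullet> b))" for z
    by (rule Linear_Algebra.linear_componentwise[OF assms])
  then have eq: "(\<lambda>z. f z \<bullet> b) = (\<lambda>z. \<Sum>e\<in>Basis. (z \<bullet> e) * (f e \<bullet> b))"
    by (rule ext)
  show "real_analytic_at (\<lambda>z. f z \<bullet> b) p"
    by (subst eq, intro real_analytic_at_sum real_analytic_at_mult real_analytic_at_const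
        real_analytic_at_inner_Basis)
qed

text \<open>Recentred at \<open>g p\<close>, the inner map vanishes at the origin; by
  \<open>majorized_shrink\<close> the norms of its components tend to 0 with the radius and
  eventually fall below the radius \<open>s\<close> of the outer series.\<close>

lemma real_analytic_at_compose:
  fixes f :: "'b::euclidean_space \<Rightarrow> 'c::euclidean_space" and g :: "'a::euclidean_space \<Rightarrow> 'b"
  assumes g: "real_analytic_at g p" and f: "real_analytic_at f (g p)"
  shows "real_analytic_at (\<lambda>z. f (g z)) p"
proof (subst real_analytic_at_componentwise, intro ballI)
  fix c :: 'c assume c: "c \<in> Basis"
  obtain s K where s: "s > 0" and K: "majorized s K (\<lambda>k. f (g p + k) \<bullet> c)"
    using f c by (subst (asm) real_analytic_at_componentwise) (auto simp: real_analytic_at_real_iff)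
  have "\<forall>\<^sub>F r in at_right 0. majorized r s (\<lambda>h. (g (p + h) - g p) \<bullet> b)" if "b \<in> Basis" for b
  proof -
    have "real_analytic_at (\<lambda>z. g z \<bullet> b - g p \<bullet> b) p"
      using g that by (subst (asm) real_analytic_at_componentwise)
        (auto intro: real_analytic_at_diff real_analytic_at_const)
    then obtain r L where r: "r > 0" and L: "majorized r L (\<lambda>h. (g (p + h) - g p) \<bullet> b)"
      by (auto simp: real_analytic_at_real_iff inner_diff_left)
    have "((\<lambda>t. t / r * L) \<longlongrightarrow> 0 / r * L) (at_right 0)"
      by (intro tendsto_intros) (use r in auto)
    then have "\<forall>\<^sub>F t in at_right 0. t / r * L < s"
      using s by (auto dest!: order_tendstoD(2)[where a = s])
    moreover have "\<forall>\<^sub>F t in at_right 0. 0 < t \<and> t < r"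
      using r by (auto simp: eventually_at_right_field)
    ultimately show ?thesis
    proof eventually_elim
      case (elim t)
      then show ?case
        using majorized_mono[OF majorized_shrink[OF L, of t]] by simp
    qed
  qed
  then have "\<forall>\<^sub>F r in at_right 0. \<forall>b\<in>Basis. majorized r s (\<lambda>h. (g (p + h) - g p) \<bullet> b)"
    by (intro eventually_ball_finite) auto
  moreover have "\<forall>\<^sub>F r in at_right 0. r > (0::real)"
    by (simp add: eventually_at_right_less)
  ultimately have "\<forall>\<^sub>F r in at_right 0. r > 0 \<and> majorized r K (\<lambda>h. f (g (p + h)) \<bullet> c)"
  proof eventually_elim
    case (elim r)
    then show ?case
      using majorized_compose[OF _ K, of r "\<lambda>h. g (p + h) - g p"] by simp
  qed
  then show "real_analytic_at (\<lambda>z. f (g z) \<bullet> c) p"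
    by (auto simp: real_analytic_at_real_iff_eventually)
qed

lemma real_analytic_at_Pair:
  assumes "real_analytic_at f p" "real_analytic_at g p"
  shows "real_analytic_at (\<lambda>z. (f z, g z)) p"
  using assms
  by (subst (asm) real_analytic_at_componentwise, subst (asm) real_analytic_at_componentwise,
      subst real_analytic_at_componentwise) (auto simp: Basis_prod_def)

lemma real_analytic_at_fst:
  assumes "real_analytic_at f p"
  shows "real_analytic_at (\<lambda>z. fst (f z)) p"
  using assms by (rule real_analytic_at_compose) (simp add: real_analytic_at_linear linear_fst)

lemma real_analytic_at_snd:
  assumes "real_analytic_at f p"
  shows "real_analytic_at (\<lambda>z. snd (f z)) p"
  using assms by (rule real_analytic_at_compose) (simp add: real_analytic_at_linear linear_snd)

lemma real_analytic_at_ident: "real_analytic_at (\<lambda>z. z) p"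
  by (intro real_analytic_at_linear linear_ident)

lemma real_analytic_at_comp_fst:
  "real_analytic_at f (fst p) \<Longrightarrow> real_analytic_at (\<lambda>z. f (fst z)) p"
  by (rule real_analytic_at_compose[OF real_analytic_at_fst[OF real_analytic_at_ident]])

lemma real_analytic_at_comp_snd:
  "real_analytic_at f (snd p) \<Longrightarrow> real_analytic_at (\<lambda>z. f (snd z)) p"
  by (rule real_analytic_at_compose[OF real_analytic_at_snd[OF real_analytic_at_ident]])

lemmas real_analytic_intros = real_analytic_at_ident real_analytic_at_const
  real_analytic_at_add real_analytic_at_diff real_analytic_at_mult real_analytic_at_power
  real_analytic_at_Pair real_analytic_at_fst real_analytic_at_snd

section \<open>Strict derivatives and Taylor expansion\<close>

text \<open>The Lipschitz bound n d^(n-1) M, multiplied by \<open>d\<close> to avoid the truncated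
  exponent n - 1.\<close>

lemma abs_power_diff_le:
  fixes x y :: real
  assumes "\<bar>x\<bar> \<le> d" "\<bar>y\<bar> \<le> d" "\<bar>x - y\<bar> \<le> M"
  shows "d * \<bar>x ^ n - y ^ n\<bar> \<le> n * d ^ n * M"
proof (induction n)
  case (Suc n)
  have d: "0 \<le> d" and M: "0 \<le> M" using assms by auto
  have "x ^ Suc n - y ^ Suc n = (x - y) * x ^ n + y * (x ^ n - y ^ n)"
    by (simp add: algebra_simps)
  then have "\<bar>x ^ Suc n - y ^ Suc n\<bar> \<le> \<bar>x - y\<bar> * \<bar>x\<bar> ^ n + \<bar>y\<bar> * \<bar>x ^ n - y ^ n\<bar>"
    by (metis abs_mult abs_triangle_ineq power_abs)
  also have "\<dots> \<le> M * d ^ n + d * \<bar>x ^ n - y ^ n\<bar>"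
    using assms M by (intro add_mono mult_mono power_mono) auto
  also have "\<dots> \<le> M * d ^ n + n * d ^ n * M"
    using Suc by simp
  finally have "d * \<bar>x ^ Suc n - y ^ Suc n\<bar> \<le> d * (M * d ^ n + n * d ^ n * M)"
    using d by (rule mult_left_mono)
  then show ?case by (simp add: algebra_simps)
qed simp

text \<open>Product rule for differences: the factors are replaced one at a time, and the exponents
  add up to the total degree.\<close>

lemma abs_prod_power_diff_le:
  fixes x y :: "'e \<Rightarrow> real"
  assumes "finite A" "\<And>e. e \<in> A \<Longrightarrow> \<bar>x e\<bar> \<le> d" "\<And>e. e \<in> A \<Longrightarrow> \<bar>y e\<bar> \<le> d"
    "\<And>e. e \<in> A \<Longrightarrow> \<bar>x e - y e\<bar> \<le> M" "0 \<le> d" "0 \<le> M"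
  shows "d * \<bar>(\<Prod>e\<in>A. x e ^ n e) - (\<Prod>e\<in>A. y e ^ n e)\<bar> \<le> real (\<Sum>e\<in>A. n e) * d ^ (\<Sum>e\<in>A. n e) * M"
  using assms(1-4)
proof (induction A)
  case (insert a A)
  let ?X = "\<Prod>e\<in>A. x e ^ n e" and ?Y = "\<Prod>e\<in>A. y e ^ n e" and ?N = "\<Sum>e\<in>A. n e"
  have X: "\<bar>?X\<bar> \<le> d ^ ?N"
    unfolding abs_prod power_sum power_abs using insert.prems by (intro prod_mono) (auto intro!: power_mono)
  have "x a ^ n a * ?X - y a ^ n a * ?Y = (x a ^ n a - y a ^ n a) * ?X + y a ^ n a * (?X - ?Y)"
    by (simp add: algebra_simps)
  then have "\<bar>x a ^ n a * ?X - y a ^ n a * ?Y\<bar>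
      \<le> \<bar>x a ^ n a - y a ^ n a\<bar> * \<bar>?X\<bar> + \<bar>y a\<bar> ^ n a * \<bar>?X - ?Y\<bar>"
    using abs_triangle_ineq[of "(x a ^ n a - y a ^ n a) * ?X" "y a ^ n a * (?X - ?Y)"]
    by (simp only: abs_mult power_abs)
  also have "d * \<dots> = (d * \<bar>x a ^ n a - y a ^ n a\<bar>) * \<bar>?X\<bar> + \<bar>y a\<bar> ^ n a * (d * \<bar>?X - ?Y\<bar>)"
    by (simp add: algebra_simps)
  also have "\<dots> \<le> (real (n a) * d ^ n a * M) * d ^ ?N + d ^ n a * (real ?N * d ^ ?N * M)"
    using insert X assms(5,6)
    by (intro add_mono mult_mono abs_power_diff_le power_mono insert.IH) auto
  also have "\<dots> = real (n a + ?N) * d ^ (n a + ?N) * M"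
    by (simp add: algebra_simps power_add)
  finally show ?case
    using insert.hyps assms(5) by (simp add: mult_left_mono)
qed simp

lemma abs_mpow_diff_le:
  fixes d :: real
  assumes "h \<in> cube d" "h' \<in> cube d" "0 \<le> d"
  shows "d * \<bar>mpow h \<alpha> - mpow h' \<alpha>\<bar> \<le> real (mdeg \<alpha>) * d ^ mdeg \<alpha> * norm (h - h')"
  unfolding mpow_def mdeg_def
  by (rule abs_prod_power_diff_le)
     (use assms in \<open>auto simp: cube_def simp flip: inner_diff_left intro: Basis_le_norm\<close>)

text \<open>For x \<le> 1/2 the sequence n x^n does not increase from n = 2 on, so the factor n lost
  in differencing a monomial costs no more than it does in degree 2.\<close>

lemma mult_power_le_of_le_half:
  fixes x :: real
  assumes "0 \<le> x" "x \<le> 1 / 2" "2 \<le> n"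
  shows "n * x ^ n \<le> 2 * x ^ 2"
  using assms(3)
proof (induction n rule: dec_induct)
  case (step n)
  have "real (Suc n) * x \<le> real n"
  proof -
    have "real (Suc n) * x \<le> real (Suc n) * (1 / 2)"
      using assms(2) by (intro mult_left_mono) auto
    also have "\<dots> \<le> real n" using step.hyps by simp
    finally show ?thesis .
  qed
  then have "real (Suc n) * x * x ^ n \<le> real n * x ^ n"
    using assms by (intro mult_right_mono) auto
  then show ?case using step.IH by (simp add: mult_ac)
qed simp

definition unit_index :: "'a::euclidean_space \<Rightarrow> 'a \<Rightarrow> nat" where
  "unit_index b = restrict (\<lambda>e. if e = b then 1 else 0) Basis"

lemma unit_index_props:
  assumes "b \<in> Basis"
  shows "unit_index b \<in> multi_indices" "mdeg (unit_index b) = 1" "mpow h (unit_index b) = h \<bullet> b"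
proof -
  have "mpow h (unit_index b) = (\<Prod>e\<in>Basis. if e = b then h \<bullet> b else 1)"
    unfolding mpow_def by (rule prod.cong) (auto simp: unit_index_def)
  then show "mpow h (unit_index b) = h \<bullet> b" using assms by simp
qed (use assms in \<open>simp_all add: unit_index_def multi_indices_def mdeg_def\<close>)

lemma multi_indices_deg_1:
  assumes "\<alpha> \<in> multi_indices" "mdeg \<alpha> = 1"
  shows "\<exists>b\<in>Basis. \<alpha> = unit_index b"
proof -
  from assms(2) obtain b where b: "b \<in> Basis" "\<alpha> b = 1" "\<forall>e\<in>Basis. b \<noteq> e \<longrightarrow> \<alpha> e = 0"
    unfolding mdeg_def by (subst (asm) sum_eq_1_iff) auto
  then have "\<alpha> = unit_index b"
    using assms(1) by (auto simp: unit_index_def multi_indices_def fun_eq_iff PiE_iff extensional_def)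
  then show ?thesis using b(1) by blast
qed

text \<open>The terms of degree one form \<open>D\<close>; those of degree at least two are jointly
  Lipschitz with constant O(d) on the cube of radius d. Unlike for a plain derivative at
  \<open>p\<close>, both points may move, which later allows comparison with a base point that
  varies along M or along a = 0.\<close>

lemma real_analytic_strict_derivative:
  fixes f :: "'a::euclidean_space \<Rightarrow> real"
  assumes "real_analytic_at f p"
  shows "\<exists>D. bounded_linear D \<and> (\<forall>\<epsilon>>0. \<exists>\<delta>>0. \<forall>z\<in>ball p \<delta>. \<forall>z'\<in>ball p \<delta>.
           \<bar>f z - f z' - D (z - z')\<bar> \<le> \<epsilon> * norm (z - z'))"
proof -
  obtain r c S where r: "r > 0" and c: "expansion c r S (\<lambda>h. f (p + h))"
    using assms by (auto simp: real_analytic_at_real_iff majorized_def)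
  define D where "D h = (\<Sum>b\<in>Basis. (h \<bullet> b) * c (unit_index b))" for h
  let ?z = "restrict (\<lambda>_. 0) (Basis :: 'a set)"
  define L where "L = insert ?z (unit_index ` (Basis :: 'a set))"
  define H where "H = multi_indices - L"
  have z: "?z \<in> multi_indices"
    by (simp add: multi_indices_def)
  have L: "L \<subseteq> multi_indices" "finite L"
    using z unit_index_props(1) by (auto simp: L_def)
  have H: "mdeg \<alpha> \<ge> 2" if "\<alpha> \<in> H" for \<alpha>
    using that multi_indices_deg_0[of \<alpha>] multi_indices_deg_1[of \<alpha>]
    unfolding H_def L_def by (metis DiffD1 DiffD2 image_eqI insertCI less_2_cases not_le One_nat_def)
  have inj: "inj_on unit_index (Basis :: 'a set)"
  proof (rule inj_onI)
    fix b b' :: 'a assume "b \<in> Basis" "b' \<in> Basis" "unit_index b = unit_index b'"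
    then have "unit_index b b = unit_index b' b" by simp
    then show "b = b'" using \<open>b \<in> Basis\<close> by (simp add: unit_index_def split: if_splits)
  qed
  have "?z \<notin> unit_index ` Basis"
    using unit_index_props(2) mdeg_zero by (metis imageE zero_neq_one)
  then have sumL: "(\<Sum>\<alpha>\<in>L. mpow h \<alpha> * c \<alpha>) = c ?z + D h" for h
    unfolding L_def D_def by (simp add: sum.reindex[OF inj] mpow_zero unit_index_props)
  have high: "((\<lambda>\<alpha>. mpow h \<alpha> * c \<alpha>) has_sum f (p + h) - (c ?z + D h)) H" if "h \<in> cube r" for h
    unfolding H_def
    by (rule has_sum_Diff) (use c that L sumL in \<open>auto simp: expansion_def intro: has_sum_finiteI\<close>)
  define T where "T = infsum (\<lambda>\<alpha>. \<bar>c \<alpha>\<bar> * r ^ mdeg \<alpha>) H"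
  have T: "((\<lambda>\<alpha>. \<bar>c \<alpha>\<bar> * r ^ mdeg \<alpha>) has_sum T) H"
  proof -
    have "(\<lambda>\<alpha>. \<bar>c \<alpha>\<bar> * r ^ mdeg \<alpha>) summable_on multi_indices"
      using c has_sum_imp_summable unfolding expansion_def by blast
    then have "(\<lambda>\<alpha>. \<bar>c \<alpha>\<bar> * r ^ mdeg \<alpha>) summable_on H"
      by (rule summable_on_subset) (simp add: H_def)
    then show ?thesis unfolding T_def by (rule has_sum_infsum)
  qed
  have T0: "T \<ge> 0"
    by (rule has_sum_nonneg[OF T]) (use r in auto)
  have Dd: "D (h - h') = D h - D h'" for h h'
    by (simp add: D_def inner_diff_left left_diff_distrib sum_subtractf)
  \<comment> \<open>The factor 2 (d / r)^2 is \<open>mult_power_le_of_le_half\<close> at x = d / r,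
    hence the requirement d \<le> r / 2; one d cancels against the d on the left of
    \<open>abs_mpow_diff_le\<close>.\<close>
  have est: "\<bar>f (p + h) - f (p + h') - D (h - h')\<bar> \<le> (2 * d / r\<^sup>2 * T) * norm (h - h')"
    if h: "h \<in> cube d" "h' \<in> cube d" and d: "0 < d" "d \<le> r / 2" for h h' d
  proof -
    have sub: "cube d \<subseteq> cube r" using d by (intro cube_mono) auto
    have "((\<lambda>\<alpha>. mpow h \<alpha> * c \<alpha> + - (mpow h' \<alpha> * c \<alpha>)) has_sum
        (f (p + h) - (c ?z + D h)) + - (f (p + h') - (c ?z + D h'))) H"
      using h sub by (intro has_sum_add has_sum_uminusI high) auto
    then have s: "((\<lambda>\<alpha>. (mpow h \<alpha> - mpow h' \<alpha>) * c \<alpha>) has_sum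
        f (p + h) - f (p + h') - D (h - h')) H"
      by (simp add: left_diff_distrib Dd algebra_simps)
    let ?k = "2 * d / r\<^sup>2 * norm (h - h')"
    have t: "((\<lambda>\<alpha>. ?k * (\<bar>c \<alpha>\<bar> * r ^ mdeg \<alpha>)) has_sum ?k * T) H"
      by (intro has_sum_cmult_right T)
    have "\<bar>(mpow h \<alpha> - mpow h' \<alpha>) * c \<alpha>\<bar> \<le> ?k * (\<bar>c \<alpha>\<bar> * r ^ mdeg \<alpha>)" if "\<alpha> \<in> H" for \<alpha>
    proof -
      let ?n = "mdeg \<alpha>"
      have "?n * (d / r) ^ ?n \<le> 2 * (d / r) ^ 2"
        using d r H[OF that] by (intro mult_power_le_of_le_half) (auto simp: field_simps)
      then have "?n * (d / r) ^ ?n * r ^ ?n \<le> 2 * (d / r) ^ 2 * r ^ ?n"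
        using r by (intro mult_right_mono) auto
      then have "?n * d ^ ?n \<le> 2 * (d / r) ^ 2 * r ^ ?n"
        using r by (simp add: power_divide)
      then have "?n * d ^ ?n * norm (h - h') \<le> 2 * (d / r) ^ 2 * r ^ ?n * norm (h - h')"
        by (rule mult_right_mono) simp
      then have "d * \<bar>mpow h \<alpha> - mpow h' \<alpha>\<bar> \<le> d * (?k * r ^ ?n)"
        using abs_mpow_diff_le[OF h, of \<alpha>] d by (simp add: power2_eq_square mult_ac)
      then have "\<bar>mpow h \<alpha> - mpow h' \<alpha>\<bar> \<le> ?k * r ^ ?n"
        using d(1) by (rule mult_left_le_imp_le)
      then have "\<bar>mpow h \<alpha> - mpow h' \<alpha>\<bar> * \<bar>c \<alpha>\<bar> \<le> ?k * r ^ ?n * \<bar>c \<alpha>\<bar>"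
        by (rule mult_right_mono) simp
      then show ?thesis by (simp only: abs_mult mult_ac)
    qed
    from has_sum_abs_imp_summable(2)[OF t this] s show ?thesis
      by (simp add: infsumI mult_ac)
  qed
  have "bounded_linear D"
    unfolding D_def by (intro bounded_linear_sum bounded_linear_mult_const bounded_linear_inner_left)
  moreover have "\<exists>\<delta>>0. \<forall>z\<in>ball p \<delta>. \<forall>z'\<in>ball p \<delta>. \<bar>f z - f z' - D (z - z')\<bar> \<le> \<epsilon> * norm (z - z')"
    if "\<epsilon> > 0" for \<epsilon>
  proof -
    \<comment> \<open>The second bound makes 2 d T / r^2 at most \<epsilon>; the 1 added to 2 T
      keeps the denominator positive when T = 0.\<close>
    define d where "d = min (r / 2) (\<epsilon> * r\<^sup>2 / (2 * T + 1))"
    have d: "0 < d" "d \<le> r / 2"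
      using r T0 that unfolding d_def by (simp, intro min.cobounded1)
    have "2 * d / r\<^sup>2 * T \<le> \<epsilon>"
    proof -
      have "d \<le> \<epsilon> * r\<^sup>2 / (2 * T + 1)" by (simp add: d_def)
      then have "d * (2 * T + 1) \<le> \<epsilon> * r\<^sup>2"
        using T0 by (simp add: field_simps)
      then have "2 * d * T \<le> \<epsilon> * r\<^sup>2"
        using d by (simp add: algebra_simps)
      then show ?thesis using r by (simp add: field_simps)
    qed
    then have "\<bar>f z - f z' - D (z - z')\<bar> \<le> \<epsilon> * norm (z - z')"
      if "z \<in> ball p d" "z' \<in> ball p d" for z z'
    proof -
      have "z - p \<in> cube d" "z' - p \<in> cube d"
        using that by (auto intro!: cube_if_norm_le simp: dist_norm norm_minus_commute)
      from est[OF this d] have "\<bar>f z - f z' - D (z - z')\<bar> \<le> (2 * d / r\<^sup>2 * T) * norm (z - z')"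
        by simp
      also have "\<dots> \<le> \<epsilon> * norm (z - z')"
        using \<open>2 * d / r\<^sup>2 * T \<le> \<epsilon>\<close> by (rule mult_right_mono) simp
      finally show ?thesis .
    qed
    then show ?thesis using d by blast
  qed
  ultimately show ?thesis by blast
qed

lemma strict_imp_has_derivative:
  fixes f :: "'a::euclidean_space \<Rightarrow> real"
  assumes "bounded_linear D" and "\<And>\<epsilon>. \<epsilon> > 0 \<Longrightarrow> \<exists>\<delta>>0. \<forall>z\<in>ball p \<delta>. \<forall>z'\<in>ball p \<delta>.
           \<bar>f z - f z' - D (z - z')\<bar> \<le> \<epsilon> * norm (z - z')"
  shows "(f has_derivative D) (at p)"
  unfolding has_derivative_at_alt
proof (intro conjI assms(1) allI impI)
  fix \<epsilon> :: real assume "\<epsilon> > 0"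
  from assms(2)[OF this] obtain \<delta> where "\<delta> > 0"
    "\<And>z z'. z \<in> ball p \<delta> \<Longrightarrow> z' \<in> ball p \<delta> \<Longrightarrow> \<bar>f z - f z' - D (z - z')\<bar> \<le> \<epsilon> * norm (z - z')"
    by blast
  then show "\<exists>\<delta>>0. \<forall>y. norm (y - p) < \<delta> \<longrightarrow> norm (f y - f p - D (y - p)) \<le> \<epsilon> * norm (y - p)"
    by (intro exI[of _ \<delta>]) (auto simp: dist_norm norm_minus_commute)
qed

lemma real_analytic_imp_differentiable:
  fixes f :: "'a::euclidean_space \<Rightarrow> 'b::euclidean_space"
  assumes "real_analytic_at f p"
  shows "f differentiable (at p)"
proof (subst differentiable_componentwise_within, intro ballI)
  fix b :: 'b assume "b \<in> Basis"
  then have "real_analytic_at (\<lambda>z. f z \<bullet> b) p"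
    using assms real_analytic_at_componentwise by blast
  from real_analytic_strict_derivative[OF this] obtain D where "bounded_linear D"
    "\<forall>\<epsilon>>0. \<exists>\<delta>>0. \<forall>z\<in>ball p \<delta>. \<forall>z'\<in>ball p \<delta>.
           \<bar>f z \<bullet> b - f z' \<bullet> b - D (z - z')\<bar> \<le> \<epsilon> * norm (z - z')" by blast
  then have "((\<lambda>z. f z \<bullet> b) has_derivative D) (at p)"
    by (intro strict_imp_has_derivative) auto
  then show "(\<lambda>z. f z \<bullet> b) differentiable (at p)"
    by (auto simp: differentiable_def)
qed

section \<open>Taylor coefficients as iterated derivatives\<close>

lemma higher_deriv_power_series:
  fixes f :: "real \<Rightarrow> real"
  assumes "r > 0" "\<And>v. \<bar>v\<bar> < r \<Longrightarrow> (\<lambda>n. a n * v ^ n) sums f (t + v)"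
  shows "(deriv ^^ n) f t = fact n * a n"
  using assms(2)
proof (induction n arbitrary: f a)
  case 0
  have "(\<lambda>n. a n * 0 ^ n) sums f t"
    using 0[of 0] assms(1) by simp
  then show ?case
    using powser_sums_zero_iff by fastforce
next
  case (Suc n)
  have ds: "(\<lambda>n. diffs a n * v ^ n) sums deriv f (t + v)" if v: "\<bar>v\<bar> < r" for v
  proof (rule termdiffs_sums_strong[where f = "\<lambda>v. f (t + v)" and K = r])
    have "((\<lambda>v. \<Sum>n. a n * v ^ n) has_real_derivative (\<Sum>n. diffs a n * v ^ n)) (at v)"
      by (rule termdiffs_strong'[where K = r]) (use Suc.prems v in \<open>auto dest: sums_summable\<close>)
    \<comment> \<open>The series represents \<open>f\<close> only for |w| < r, so its derivative is
      passed on to \<open>f\<close> through equality near \<open>v\<close>.\<close>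
    moreover have "\<forall>\<^sub>F w in nhds v. (\<Sum>n. a n * w ^ n) = f (t + w)"
    proof (rule eventually_mono)
      show "\<forall>\<^sub>F w in nhds v. w \<in> {-r<..<r}"
        using v by (intro eventually_nhds_in_open) auto
    qed (intro sums_unique[symmetric] Suc.prems, auto)
    ultimately have "((\<lambda>v. f (t + v)) has_real_derivative (\<Sum>n. diffs a n * v ^ n)) (at v)"
      by (subst (asm) DERIV_cong_ev[OF refl _ refl]) auto
    then have *: "(f has_real_derivative (\<Sum>n. diffs a n * v ^ n)) (at (t + v))"
      using DERIV_shift[of f _ v t] by (simp add: add.commute)
    then show "((\<lambda>v. f (t + v)) has_real_derivative deriv f (t + v)) (at v)"
      using DERIV_shift[of f _ v t] by (simp add: add.commute DERIV_imp_deriv)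
  qed (use Suc.prems v in auto)
  \<comment> \<open>Peeling off the innermost derivative fits the induction, which is generalised
    over \<open>f\<close> and \<open>a\<close>: the derivative has the series \<open>diffs a\<close>
    on the same interval.\<close>
  have "(deriv ^^ Suc n) f t = (deriv ^^ n) (deriv f) t"
    by (simp add: funpow_Suc_right del: funpow.simps)
  also have "\<dots> = fact n * diffs a n"
    by (rule Suc.IH) (rule ds)
  finally show ?case
    by (simp add: diffs_def)
qed

lemma real_analytic_real2_expansion:
  fixes g :: "real \<times> real \<Rightarrow> real"
  assumes "real_analytic_at g (s0, t0)"
  obtains a :: "nat \<Rightarrow> nat \<Rightarrow> real" and r S where "r > 0"
    "((\<lambda>(i, j). \<bar>a i j\<bar> * r ^ (i + j)) has_sum S) UNIV"
    "\<And>u v. \<bar>u\<bar> \<le> r \<Longrightarrow> \<bar>v\<bar> \<le> r \<Longrightarrow> ((\<lambda>(i, j). a i j * u ^ i * v ^ j) has_sum g (s0 + u, t0 + v)) UNIV"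
proof -
  obtain r c S where r: "r > 0" and c: "expansion c r S (\<lambda>h. g ((s0, t0) + h))"
    using assms by (auto simp: real_analytic_at_real_iff majorized_def)
  define m :: "nat \<times> nat \<Rightarrow> real \<times> real \<Rightarrow> nat"
    where "m = (\<lambda>(i, j). restrict (\<lambda>e. if e = (1, 0) then i else j) Basis)"
  have B: "(Basis :: (real \<times> real) set) = {(1, 0), (0, 1)}"
    by (auto simp: Basis_prod_def)
  have bij: "bij_betw m UNIV multi_indices"
  proof (rule bij_betw_byWitness[of _ "\<lambda>\<alpha>. (\<alpha> (1, 0), \<alpha> (0, 1))"])
    show "\<forall>\<alpha>\<in>multi_indices. m (\<alpha> (1, 0), \<alpha> (0, 1)) = \<alpha>"
    proof (intro ballI ext)
      fix \<alpha> :: "real \<times> real \<Rightarrow> nat" and e assume "\<alpha> \<in> multi_indices"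
      then have "e \<notin> Basis \<Longrightarrow> \<alpha> e = undefined"
        by (auto simp: multi_indices_def dest: PiE_arb)
      then show "m (\<alpha> (1, 0), \<alpha> (0, 1)) e = \<alpha> e"
        by (cases "e \<in> Basis") (auto simp: m_def B)
    qed
    show "\<forall>x\<in>UNIV. (m x (1, 0), m x (0, 1)) = x"
      by (simp add: m_def B split: prod.split)
    show "m ` UNIV \<subseteq> multi_indices"
      by (rule image_subsetI) (simp add: m_def multi_indices_def split: prod.split)
  qed simp
  have md: "mdeg (m (i, j)) = i + j" for i j
    by (simp add: m_def mdeg_def B)
  have mp: "mpow (u, v) (m (i, j)) = u ^ i * v ^ j" for i j u v
    by (simp add: m_def mpow_def B)
  show ?thesis
  proof (rule that[of r "\<lambda>i j. c (m (i, j))" S])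
    have "((\<lambda>x. \<bar>c (m x)\<bar> * r ^ mdeg (m x)) has_sum S) UNIV"
      using c has_sum_reindex_bij_betw[OF bij, of "\<lambda>\<alpha>. \<bar>c \<alpha>\<bar> * r ^ mdeg \<alpha>"] by (simp add: expansion_def)
    then show "((\<lambda>(i, j). \<bar>c (m (i, j))\<bar> * r ^ (i + j)) has_sum S) UNIV"
      by (rule has_sum_cong[THEN iffD1, rotated]) (auto simp: md)
    fix u v :: real assume "\<bar>u\<bar> \<le> r" "\<bar>v\<bar> \<le> r"
    then have "(u, v) \<in> cube r" by (auto simp: cube_def B)
    then have "((\<lambda>\<alpha>. mpow (u, v) \<alpha> * c \<alpha>) has_sum g ((s0, t0) + (u, v))) multi_indices"
      using c by (simp only: expansion_def)
    then have "((\<lambda>x. mpow (u, v) (m x) * c (m x)) has_sum g ((s0, t0) + (u, v))) UNIV"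
      using has_sum_reindex_bij_betw[OF bij, of "\<lambda>\<alpha>. mpow (u, v) \<alpha> * c \<alpha>"] by simp
    then show "((\<lambda>(i, j). c (m (i, j)) * u ^ i * v ^ j) has_sum g (s0 + u, t0 + v)) UNIV"
      unfolding add_Pair by (rule has_sum_cong[THEN iffD1, rotated]) (auto simp: mp mult_ac)
  qed (rule r)
qed

lemma has_sum_UNIV_prodD:
  fixes F :: "'i \<Rightarrow> 'j \<Rightarrow> real"
  assumes "((\<lambda>(i, j). F i j) has_sum S) UNIV"
  shows "(F i has_sum infsum (F i) UNIV) UNIV" "((\<lambda>i. infsum (F i) UNIV) has_sum S) UNIV"
proof -
  have "(\<lambda>(i, j). F i j) summable_on (UNIV \<times> UNIV)"
    using assms by (simp add: has_sum_imp_summable)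
  then show *: "(F i has_sum infsum (F i) UNIV) UNIV" for i
    using summable_on_SigmaD1[of F UNIV "\<lambda>_. UNIV" i] by (intro has_sum_infsum) auto
  show "((\<lambda>i. infsum (F i) UNIV) has_sum S) UNIV"
    by (rule has_sum_SigmaD[where f = "\<lambda>(i, j). F i j" and A = UNIV and B = "\<lambda>_. UNIV"]) (use assms * in auto)
qed

text \<open>\<open>mixed_partial\<close> differentiates in t first. Accordingly the double series is
  summed over i for fixed j: it becomes a power series in v whose coefficients \<open>A u j\<close>
  are power series in u, and the one-variable result applies twice. The remainder bound comes from
  the tail of the majorant series.\<close>

lemma real_analytic_taylor2:
  fixes g :: "real \<times> real \<Rightarrow> real"
  assumes "real_analytic_at g (s0, t0)"
  obtains a :: "nat \<Rightarrow> nat \<Rightarrow> real" where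
    "\<And>i j. mixed_partial i j g (s0, t0) = fact i * fact j * a i j"
    "\<And>k. \<exists>r>0. \<exists>C. \<forall>u v. \<bar>u\<bar> \<le> r \<longrightarrow> \<bar>v\<bar> \<le> r \<longrightarrow>
       \<bar>g (s0 + u, t0 + v) - (\<Sum>m\<le>k. \<Sum>i\<le>m. a i (m - i) * u ^ i * v ^ (m - i))\<bar> \<le> C * (\<bar>u\<bar> + \<bar>v\<bar>) ^ Suc k"
proof -
  obtain a r S where r: "r > 0" and a: "((\<lambda>(i, j). \<bar>a i j\<bar> * r ^ (i + j)) has_sum S) UNIV"
    and g: "\<And>u v. \<bar>u\<bar> \<le> r \<Longrightarrow> \<bar>v\<bar> \<le> r \<Longrightarrow> ((\<lambda>(i, j). a i j * u ^ i * v ^ j) has_sum g (s0 + u, t0 + v)) UNIV"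
    by (rule real_analytic_real2_expansion[OF assms], rule that)
  show ?thesis
  proof (rule that)
    fix i j
    have swap: "((\<lambda>(j, i). a i j * u ^ i * v ^ j) has_sum g (s0 + u, t0 + v)) UNIV"
      if "\<bar>u\<bar> \<le> r" "\<bar>v\<bar> \<le> r" for u v
      using g[OF that] has_sum_swap[where f = "\<lambda>(i, j). a i j * u ^ i * v ^ j" and S = "g (s0 + u, t0 + v)"
          and A = UNIV and B = UNIV]
      by simp
    \<comment> \<open>Convergence of the inner series is known only for the full terms, so it is
      read off at v = r and the factor \<open>r ^ j\<close> is divided out.\<close>
    define A where "A u j = infsum (\<lambda>i. a i j * u ^ i * r ^ j) UNIV / r ^ j" for u j
    have A: "((\<lambda>i. a i j * u ^ i) has_sum A u j) UNIV" if "\<bar>u\<bar> \<le> r" for u j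
    proof -
      have "((\<lambda>i. a i j * u ^ i * r ^ j) has_sum infsum (\<lambda>i. a i j * u ^ i * r ^ j) UNIV) UNIV"
        using has_sum_UNIV_prodD(1)[OF swap[of u r], of j] that r by simp
      from has_sum_cmult_left[OF this, of "1 / r ^ j"] show ?thesis
        using r by (simp add: A_def)
    qed
    have "(\<lambda>j. A u j * v ^ j) sums g (s0 + u, t0 + v)" if "\<bar>u\<bar> \<le> r" "\<bar>v\<bar> \<le> r" for u v
    proof -
      have "infsum (\<lambda>i. a i j * u ^ i * v ^ j) UNIV = A u j * v ^ j" for j
        by (intro infsumI has_sum_cmult_left A that)
      then show ?thesis
        using has_sum_UNIV_prodD(2)[OF swap[OF that]] by (simp add: has_sum_imp_sums)
    qed
    then have inner: "(deriv ^^ j) (\<lambda>t. g (s0 + u, t)) t0 = fact j * A u j" if "\<bar>u\<bar> \<le> r" for u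
      using that by (intro higher_deriv_power_series[OF r]) auto
    have "(\<lambda>i. (fact j * a i j) * u ^ i) sums (deriv ^^ j) (\<lambda>t. g (s0 + u, t)) t0" if "\<bar>u\<bar> < r" for u
      using sums_mult[OF has_sum_imp_sums[OF A[of u j]], of "fact j"] that inner[of u]
      by (simp add: mult_ac)
    then have "(deriv ^^ i) (\<lambda>s. (deriv ^^ j) (\<lambda>t. g (s, t)) t0) s0 = fact i * (fact j * a i j)"
      by (rule higher_deriv_power_series[OF r])
    then show "mixed_partial i j g (s0, t0) = fact i * fact j * a i j"
      by (simp add: mixed_partial_def)
  next
    fix k
    let ?L = "{(i, j). i + j \<le> k}" and ?H = "{(i, j). i + j > k} :: (nat \<times> nat) set"
    have H: "?H = UNIV - ?L" by auto
    have fin: "finite ?L"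
      by (rule finite_subset[of _ "{..k} \<times> {..k}"]) auto
    define T where "T = infsum (\<lambda>(i, j). \<bar>a i j\<bar> * r ^ (i + j)) ?H"
    have T: "((\<lambda>(i, j). \<bar>a i j\<bar> * r ^ (i + j)) has_sum T) ?H"
      unfolding T_def by (intro has_sum_infsum summable_on_subset[OF has_sum_imp_summable[OF a]]) auto
    have "\<bar>g (s0 + u, t0 + v) - (\<Sum>m\<le>k. \<Sum>i\<le>m. a i (m - i) * u ^ i * v ^ (m - i))\<bar>
        \<le> T / r ^ Suc k * (\<bar>u\<bar> + \<bar>v\<bar>) ^ Suc k" if uv: "\<bar>u\<bar> + \<bar>v\<bar> \<le> r" for u v
    proof -
      let ?N = "\<bar>u\<bar> + \<bar>v\<bar>"
      have "(\<Sum>m\<le>k. \<Sum>i\<le>m. a i (m - i) * u ^ i * v ^ (m - i)) = (\<Sum>(i, j)\<in>?L. a i j * u ^ i * v ^ j)"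
        by (rule sum.triangle_reindex_eq[symmetric])
      moreover have "((\<lambda>(i, j). a i j * u ^ i * v ^ j) has_sum
          g (s0 + u, t0 + v) - (\<Sum>(i, j)\<in>?L. a i j * u ^ i * v ^ j)) ?H"
        unfolding H by (rule has_sum_Diff) (use g[of u v] uv fin in auto)
      \<comment> \<open>Since N / r \<le> 1, a term of degree above k is at most (N / r)^(k+1) times
        its majorant at radius r.\<close>
      moreover have "((\<lambda>(i, j). (?N / r) ^ Suc k * (\<bar>a i j\<bar> * r ^ (i + j))) has_sum (?N / r) ^ Suc k * T) ?H"
        using has_sum_cmult_right[OF T, of "(?N / r) ^ Suc k"] by (simp add: case_prod_unfold)
      moreover have "\<bar>(\<lambda>(i, j). a i j * u ^ i * v ^ j) x\<bar>
          \<le> (\<lambda>(i, j). (?N / r) ^ Suc k * (\<bar>a i j\<bar> * r ^ (i + j))) x" if x: "x \<in> ?H" for x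
      proof -
        obtain i j where ij: "x = (i, j)" "i + j > k" using x by auto
        have "\<bar>u\<bar> ^ i * \<bar>v\<bar> ^ j \<le> ?N ^ i * ?N ^ j"
          by (intro mult_mono power_mono) auto
        also have "\<dots> = (?N / r) ^ (i + j) * r ^ (i + j)"
          using r by (simp add: power_divide power_add)
        also have "\<dots> \<le> (?N / r) ^ Suc k * r ^ (i + j)"
          using r uv ij by (intro mult_right_mono power_decreasing) auto
        finally have "\<bar>a i j\<bar> * (\<bar>u\<bar> ^ i * \<bar>v\<bar> ^ j) \<le> \<bar>a i j\<bar> * ((?N / r) ^ Suc k * r ^ (i + j))"
          by (rule mult_left_mono) simp
        then show ?thesis
          by (simp add: ij abs_mult power_abs mult_ac)
      qed
      ultimately show ?thesis
        using has_sum_abs_imp_summable(2)[where g = "\<lambda>(i, j). (?N / r) ^ Suc k * (\<bar>a i j\<bar> * r ^ (i + j))"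
            and S = "(?N / r) ^ Suc k * T" and I = ?H and f = "\<lambda>(i, j). a i j * u ^ i * v ^ j"]
        by (simp add: infsumI power_divide mult_ac del: power_Suc)
    qed
    then show "\<exists>r>0. \<exists>C. \<forall>u v. \<bar>u\<bar> \<le> r \<longrightarrow> \<bar>v\<bar> \<le> r \<longrightarrow>
       \<bar>g (s0 + u, t0 + v) - (\<Sum>m\<le>k. \<Sum>i\<le>m. a i (m - i) * u ^ i * v ^ (m - i))\<bar> \<le> C * (\<bar>u\<bar> + \<bar>v\<bar>) ^ Suc k"
      \<comment> \<open>The radius r / 2 guarantees |u| + |v| \<le> r.\<close>
      using r by (intro exI[of _ "r / 2"] conjI exI[of _ "T / r ^ Suc k"] allI impI) auto
  qed
qed

section \<open>Leading homogeneous forms\<close>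

text \<open>Multiplying the quotient by r and dropping the top term, then negligible, lowers the
  degree, so the lower coefficients vanish by induction; what remains of the quotient is the top
  coefficient itself.\<close>

lemma poly_tendsto_0_imp_coeffs_0:
  fixes h :: "nat \<Rightarrow> real"
  assumes "((\<lambda>r. (\<Sum>m\<le>k. h m * r ^ m) / r ^ k) \<longlongrightarrow> 0) (at_right 0)" "m \<le> k"
  shows "h m = 0"
  using assms
proof (induction k arbitrary: m)
  case 0
  then show ?case by (simp add: tendsto_const_iff)
next
  case (Suc k)
  have pos: "\<forall>\<^sub>F r in at_right 0. (r::real) > 0"
    by (simp add: eventually_at_right_less)
  have id: "((\<lambda>r::real. r) \<longlongrightarrow> 0) (at_right 0)"
    by (rule tendsto_ident_at)
  have "((\<lambda>r. (\<Sum>m\<le>Suc k. h m * r ^ m) / r ^ Suc k * r - h (Suc k) * r) \<longlongrightarrow> 0 * 0 - h (Suc k) * 0) (at_right 0)"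
    by (intro tendsto_intros Suc.prems id)
  moreover have "\<forall>\<^sub>F r in at_right 0. (\<Sum>m\<le>Suc k. h m * r ^ m) / r ^ Suc k * r - h (Suc k) * r
      = (\<Sum>m\<le>k. h m * r ^ m) / r ^ k"
    using pos by eventually_elim (simp add: field_simps)
  ultimately have "((\<lambda>r. (\<Sum>m\<le>k. h m * r ^ m) / r ^ k) \<longlongrightarrow> 0) (at_right 0)"
    by (simp add: filterlim_cong)
  then have low: "\<And>m. m \<le> k \<Longrightarrow> h m = 0"
    by (rule Suc.IH)
  have "\<forall>\<^sub>F r in at_right 0. (\<Sum>m\<le>Suc k. h m * r ^ m) / r ^ Suc k = h (Suc k)"
    using pos by eventually_elim (simp add: low)
  then have "((\<lambda>r. h (Suc k)) \<longlongrightarrow> 0) (at_right (0::real))"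
    using Suc.prems(1) by (simp add: filterlim_cong)
  then have "h (Suc k) = 0"
    by (simp add: tendsto_const_iff)
  then show ?case
    using low Suc.prems(2) by (cases "m = Suc k") auto
qed

text \<open>Setting \<tau> = 1 turns the form into a polynomial in one variable that vanishes
  identically.\<close>

lemma binary_form_eq_0_imp_coeffs_0:
  fixes a :: "nat \<Rightarrow> real"
  assumes "\<And>\<sigma> \<tau>. (\<Sum>i\<le>m. a i * \<sigma> ^ i * \<tau> ^ (m - i)) = 0" "i \<le> m"
  shows "a i = 0"
proof -
  have "\<forall>x. (\<Sum>i\<le>m. a i * x ^ i) = 0"
    using assms(1)[of _ 1] by simp
  then show ?thesis
    using assms(2) zero_polynom_imp_zero_coeffs by blast
qed

lemma binary_form_scale:
  fixes a :: "nat \<Rightarrow> real"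
  assumes "I \<subseteq> {..m}"
  shows "(\<Sum>i\<in>I. a i * (r * \<sigma>) ^ i * (r * \<tau>) ^ (m - i)) = (\<Sum>i\<in>I. a i * \<sigma> ^ i * \<tau> ^ (m - i)) * r ^ m"
  unfolding sum_distrib_right
proof (rule sum.cong[OF refl])
  fix i assume "i \<in> I"
  then have "r ^ m = r ^ i * r ^ (m - i)"
    using assms by (auto simp flip: power_add)
  then show "a i * (r * \<sigma>) ^ i * (r * \<tau>) ^ (m - i) = a i * \<sigma> ^ i * \<tau> ^ (m - i) * r ^ m"
    by (simp add: power_mult_distrib mult_ac)
qed

section \<open>Limits along rays and weighted remainders\<close>

lemma le_vanishing_orderI:
  assumes "\<And>i j. i + j < k \<Longrightarrow> mixed_partial i j g q = 0"
  shows "enat k \<le> vanishing_order g q"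
  unfolding vanishing_order_def using assms by (intro Inf_greatest) (auto simp: not_less[symmetric])

lemma vanishing_order_le:
  assumes "mixed_partial i j g q \<noteq> 0"
  shows "vanishing_order g q \<le> enat (i + j)"
  unfolding vanishing_order_def using assms by (intro Inf_lower) auto

lemma real_analytic_tendsto:
  assumes "real_analytic_at f p"
  shows "(f \<longlongrightarrow> f p) (nhds p)"
proof -
  have "isCont f p"
    using real_analytic_imp_differentiable[OF assms] by (rule differentiable_imp_continuous_within)
  then show ?thesis
    by (simp add: isCont_def tendsto_at_iff_tendsto_nhds)
qed

lemma tendsto_div_pow_if_le:
  fixes f :: "real \<Rightarrow> real"
  assumes "\<forall>\<^sub>F r in at_right 0. \<bar>f r\<bar> \<le> C * r ^ Suc k"
  shows "((\<lambda>r. f r / r ^ k) \<longlongrightarrow> 0) (at_right 0)"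
proof (rule Lim_null_comparison)
  show "\<forall>\<^sub>F r in at_right 0. norm (f r / r ^ k) \<le> C * r"
    using assms eventually_at_right_less[of "0::real"]
    by eventually_elim (simp add: field_simps)
  have "((\<lambda>r::real. C * r) \<longlongrightarrow> C * 0) (at_right 0)"
    by (intro tendsto_intros)
  then show "((\<lambda>r::real. C * r) \<longlongrightarrow> 0) (at_right 0)" by simp
qed

lemma tendsto_scaled_at_right:
  fixes f :: "real \<Rightarrow> real"
  assumes "(f has_real_derivative D) (at 0)" "f 0 = 0"
  shows "((\<lambda>r. f (r * \<sigma>) / r) \<longlongrightarrow> \<sigma> * D) (at_right 0)"
proof -
  have "((\<lambda>r. f (r * \<sigma>)) has_real_derivative D * \<sigma>) (at 0)"
    by (rule DERIV_chain2[where f = f]) (use assms in \<open>auto intro!: derivative_eq_intros\<close>)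
  then have "((\<lambda>r. f (r * \<sigma>)) has_real_derivative D * \<sigma>) (at_right 0)"
    by (rule has_field_derivative_at_within)
  then show ?thesis
    by (simp add: has_field_derivative_iff assms mult.commute)
qed

text \<open>The quotient is by |a| + r^k because \<open>a\<close> is only assumed to tend to 0,
  whereas \<open>b\<close> and \<open>x\<close> are O(r). The value \<open>R 0 = 0\<close> is a
  separate assumption: the Landau symbol at 0 ignores the point 0, which the curve may meet for r >
  0.\<close>

lemma smallo_weighted_along:
  fixes R :: "real \<times> real \<times> real \<Rightarrow> real"
  assumes R: "R \<in> o[at 0](\<lambda>(a, b, x). \<bar>a\<bar> + (\<bar>x\<bar> + \<bar>b\<bar>) ^ k)" and R0: "R 0 = 0"
    and a: "(a \<longlongrightarrow> 0) (at_right 0)"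
    and b: "((\<lambda>r. b r / r) \<longlongrightarrow> b1) (at_right 0)" and x: "((\<lambda>r. x r / r) \<longlongrightarrow> x1) (at_right 0)"
  shows "((\<lambda>r. R (a r, b r, x r) / (\<bar>a r\<bar> + r ^ k)) \<longlongrightarrow> 0) (at_right 0)"
proof -
  have pos: "\<forall>\<^sub>F r in at_right 0. (r::real) > 0"
    by (simp add: eventually_at_right_less)
  have lin: "(f \<longlongrightarrow> 0) (at_right 0)" if "((\<lambda>r. f r / r) \<longlongrightarrow> f1) (at_right 0)" for f :: "real \<Rightarrow> real" and f1
  proof -
    have "((\<lambda>r. f r / r * r) \<longlongrightarrow> f1 * 0) (at_right 0)"
      by (intro tendsto_intros that)
    moreover have "\<forall>\<^sub>F r in at_right 0. f r / r * r = f r"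
      using pos by eventually_elim simp
    ultimately show ?thesis by (simp add: filterlim_cong)
  qed
  have w: "((\<lambda>r. (a r, b r, x r)) \<longlongrightarrow> 0) (at_right 0)"
    using tendsto_Pair[OF a tendsto_Pair[OF lin[OF b] lin[OF x]]] by (simp add: zero_prod_def)
  \<comment> \<open>The power bounds (|x| + |b|)^k by a multiple of r^k; the maximum with 1 lets the
    same constant dominate |a|.\<close>
  define K where "K = max 1 ((\<bar>x1\<bar> + \<bar>b1\<bar> + 1) ^ k)"
  have K: "K \<ge> 1" by (simp add: K_def)
  have "((\<lambda>r. \<bar>x r / r\<bar> + \<bar>b r / r\<bar>) \<longlongrightarrow> \<bar>x1\<bar> + \<bar>b1\<bar>) (at_right 0)"
    by (intro tendsto_intros x b)
  then have "\<forall>\<^sub>F r in at_right 0. \<bar>x r / r\<bar> + \<bar>b r / r\<bar> < \<bar>x1\<bar> + \<bar>b1\<bar> + 1"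
    by (rule order_tendstoD) simp
  then have xb: "\<forall>\<^sub>F r in at_right 0. (\<bar>x r\<bar> + \<bar>b r\<bar>) ^ k \<le> K * r ^ k"
    using pos
  proof eventually_elim
    case (elim r)
    have "\<bar>x r\<bar> + \<bar>b r\<bar> = (\<bar>x r / r\<bar> + \<bar>b r / r\<bar>) * r"
      using elim by (simp add: field_simps)
    also have "\<dots> \<le> (\<bar>x1\<bar> + \<bar>b1\<bar> + 1) * r"
      using elim by (intro mult_right_mono) auto
    finally have "(\<bar>x r\<bar> + \<bar>b r\<bar>) ^ k \<le> ((\<bar>x1\<bar> + \<bar>b1\<bar> + 1) * r) ^ k"
      by (rule power_mono) simp
    also have "\<dots> \<le> K * r ^ k"
      using elim by (auto simp: K_def power_mult_distrib intro!: mult_right_mono)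
    finally show ?case .
  qed
  show ?thesis
  proof (rule tendstoI)
    fix \<epsilon> :: real assume "\<epsilon> > 0"
    define \<delta> where "\<delta> = \<epsilon> / (2 * K)"
    have \<delta>: "\<delta> > 0" using \<open>\<epsilon> > 0\<close> K by (simp add: \<delta>_def)
    have "\<forall>\<^sub>F w in at 0. norm (R w) \<le> \<delta> * norm ((\<lambda>(a, b, x). \<bar>a\<bar> + (\<bar>x\<bar> + \<bar>b\<bar>) ^ k) w)"
      by (rule landau_o.smallD[OF R \<delta>])
    then have "\<forall>\<^sub>F w in nhds 0. \<bar>R w\<bar> \<le> \<delta> * \<bar>(\<lambda>(a, b, x). \<bar>a\<bar> + (\<bar>x\<bar> + \<bar>b\<bar>) ^ k) w\<bar>"
      unfolding eventually_nhds_conv_at using R0 \<delta> by (simp add: zero_prod_def)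
    from eventually_compose_filterlim[OF this w] xb pos
    show "\<forall>\<^sub>F r in at_right 0. dist (R (a r, b r, x r) / (\<bar>a r\<bar> + r ^ k)) 0 < \<epsilon>"
    proof eventually_elim
      case (elim r)
      have p: "\<bar>a r\<bar> + r ^ k > 0" using elim by (simp add: add_nonneg_pos)
      have "\<bar>a r\<bar> \<le> K * \<bar>a r\<bar>" using K by (simp add: mult_le_cancel_right1)
      then have "\<bar>a r\<bar> + (\<bar>x r\<bar> + \<bar>b r\<bar>) ^ k \<le> K * (\<bar>a r\<bar> + r ^ k)"
        using elim by (simp add: distrib_left)
      then have "\<delta> * (\<bar>a r\<bar> + (\<bar>x r\<bar> + \<bar>b r\<bar>) ^ k) \<le> \<delta> * (K * (\<bar>a r\<bar> + r ^ k))"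
        using \<delta> by (intro mult_left_mono) auto
      also have "\<dots> = \<epsilon> / 2 * (\<bar>a r\<bar> + r ^ k)"
        using K by (simp add: \<delta>_def)
      also have "\<dots> < \<epsilon> * (\<bar>a r\<bar> + r ^ k)"
        using \<open>\<epsilon> > 0\<close> p by (intro mult_strict_right_mono) auto
      finally have "\<bar>R (a r, b r, x r)\<bar> < \<epsilon> * (\<bar>a r\<bar> + r ^ k)"
        using elim by (simp add: abs_of_nonneg)
      then show ?case using p by (simp add: divide_less_eq abs_of_pos)
    qed
  qed
qed

lemma eventually_along_ray:
  fixes P :: "real \<times> real \<Rightarrow> bool"
  assumes "\<forall>\<^sub>F w in nhds (0, 0). P w"
  shows "\<forall>\<^sub>F r in at_right 0. P (r * \<sigma>, r * \<tau>)"
proof (rule eventually_compose_filterlim[OF assms])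
  have "((\<lambda>r. (r * \<sigma>, r * \<tau>)) \<longlongrightarrow> (0 * \<sigma>, 0 * \<tau>)) (at_right 0)"
    by (intro tendsto_intros)
  then show "((\<lambda>r. (r * \<sigma>, r * \<tau>)) \<longlongrightarrow> (0, 0)) (at_right 0)" by simp
qed

text \<open>Rescaling both parameters by \<open>r \<rightarrow> 0\<close> isolates the homogeneous leading form.\<close>
lemma blow_up_leading_form_eq_0:
  fixes X Y A B :: "real \<Rightarrow> real" and \<gamma> :: "nat \<Rightarrow> real" and R :: "real \<times> real \<times> real \<Rightarrow> real"
  assumes R: "R \<in> o[at 0](\<lambda>(a, b, x). \<bar>a\<bar> + (\<bar>x\<bar> + \<bar>b\<bar>) ^ k)" and R0: "R 0 = 0"
    and X: "(X has_real_derivative X1) (at 0)" "X 0 = 0"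
    and Y: "(Y has_real_derivative Y1) (at 0)" "Y 0 = 0"
    and A: "(A has_real_derivative A1) (at 0)" "A 0 = 0"
    and B: "(B has_real_derivative B1) (at 0)" "B 0 = 0"
    and XY1: "X1 \<noteq> 0 \<or> Y1 \<noteq> 0" and AB1: "A1 \<noteq> 0 \<or> B1 \<noteq> 0"
    and E: "\<forall>\<^sub>F w in nhds (0, 0). \<bar>Y (snd w) - A (fst w)
       - ((\<Sum>i=1..k-1. \<gamma> i * B (fst w) ^ i * X (snd w) ^ (k - i)) + R (A (fst w), B (fst w), X (snd w)))\<bar>
       \<le> C * (\<bar>fst w\<bar> + \<bar>snd w\<bar>) ^ Suc k"
    and i: "i \<in> {1..k-1}"
  shows "\<gamma> i = 0"
proof -
  have k: "k \<ge> 2" using i by auto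
  have pos: "\<forall>\<^sub>F r in at_right 0. (r::real) > 0"
    by (simp add: eventually_at_right_less)
  define P where "P b x = (\<Sum>i=1..k-1. \<gamma> i * b ^ i * x ^ (k - i))" for b x
  have P0: "P 0 x = 0" "P b 0 = 0" for b x
    unfolding P_def using k by (auto intro!: sum.neutral simp: power_0_left)
  have Pscale: "P (r * b) (r * x) = P b x * r ^ k" for r b x
    unfolding P_def by (rule binary_form_scale) auto
  have lim0: "((\<lambda>r. f (r * \<sigma>)) \<longlongrightarrow> 0) (at_right 0)"
    if "(f has_real_derivative f1) (at 0)" "f 0 = 0" for f f1 \<sigma>
  proof -
    have "((\<lambda>r. f (r * \<sigma>) / r * r) \<longlongrightarrow> \<sigma> * f1 * 0) (at_right 0)"
      by (intro tendsto_intros tendsto_scaled_at_right that)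
    moreover have "\<forall>\<^sub>F r in at_right 0. f (r * \<sigma>) / r * r = f (r * \<sigma>)"
      using pos by eventually_elim simp
    ultimately show ?thesis by (simp add: filterlim_cong)
  qed
  have E': "\<forall>\<^sub>F r in at_right 0. \<bar>Y (r * \<tau>) - A (r * \<sigma>)
       - (P (B (r * \<sigma>)) (X (r * \<tau>)) + R (A (r * \<sigma>), B (r * \<sigma>), X (r * \<tau>)))\<bar>
       \<le> C * (\<bar>\<sigma>\<bar> + \<bar>\<tau>\<bar>) ^ Suc k * r ^ Suc k" for \<sigma> \<tau>
    using eventually_along_ray[OF E, of \<sigma> \<tau>] pos
  proof eventually_elim
    case (elim r)
    have "\<bar>r * \<sigma>\<bar> + \<bar>r * \<tau>\<bar> = (\<bar>\<sigma>\<bar> + \<bar>\<tau>\<bar>) * r"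
      using elim by (simp add: abs_mult algebra_simps)
    then show ?case
      using elim by (simp only: fst_conv snd_conv P_def power_mult_distrib mult.assoc)
  qed
  have err: "((\<lambda>r. (Y (r * \<tau>) - A (r * \<sigma>)
       - (P (B (r * \<sigma>)) (X (r * \<tau>)) + R (A (r * \<sigma>), B (r * \<sigma>), X (r * \<tau>)))) / r ^ k) \<longlongrightarrow> 0) (at_right 0)"
    for \<sigma> \<tau>
    by (rule tendsto_div_pow_if_le[OF E'])
  have Rlim: "((\<lambda>r. R (A (r * \<sigma>), B (r * \<sigma>), X (r * \<tau>)) / (\<bar>A (r * \<sigma>)\<bar> + r ^ k)) \<longlongrightarrow> 0) (at_right 0)"
    for \<sigma> \<tau>
    by (rule smallo_weighted_along[OF R R0 lim0[OF A] tendsto_scaled_at_right[OF B] tendsto_scaled_at_right[OF X]])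
  \<comment> \<open>Freezing s (\<sigma> = 0) kills A and B, hence the form \<open>P\<close>; with a
    = 0 the weight of the remainder is r^k alone.\<close>
  have Ylim: "((\<lambda>r. Y (r * \<tau>) / r ^ k) \<longlongrightarrow> 0) (at_right 0)" for \<tau>
  proof -
    have "((\<lambda>r. (Y (r * \<tau>) - R (0, 0, X (r * \<tau>))) / r ^ k + R (0, 0, X (r * \<tau>)) / r ^ k) \<longlongrightarrow> 0 + 0) (at_right 0)"
      using err[of \<tau> 0] Rlim[of 0 \<tau>] by (intro tendsto_add) (simp_all add: A(2) B(2) P0)
    then show ?thesis by (simp add: diff_divide_distrib)
  qed
  \<comment> \<open>Freezing t (\<tau> = 0) kills Y and X. The remainder is weighted by |A| + r^k
    with the size of A still unknown; once \<open>q\<close> is below 1/2 its |A| part is absorbed on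
    the left, which produces the factors 2.\<close>
  have Alim: "((\<lambda>r. A (r * \<sigma>) / r ^ k) \<longlongrightarrow> 0) (at_right 0)" for \<sigma>
  proof -
    define e where "e r = (- A (r * \<sigma>) - R (A (r * \<sigma>), B (r * \<sigma>), 0)) / r ^ k" for r
    define q where "q r = R (A (r * \<sigma>), B (r * \<sigma>), 0) / (\<bar>A (r * \<sigma>)\<bar> + r ^ k)" for r
    have e: "(e \<longlongrightarrow> 0) (at_right 0)"
      using err[of 0 \<sigma>] by (simp add: e_def[abs_def] Y(2) X(2) P0)
    have q: "(q \<longlongrightarrow> 0) (at_right 0)"
      using Rlim[of \<sigma> 0] by (simp add: q_def[abs_def] X(2))
    have "\<forall>\<^sub>F r in at_right 0. \<bar>q r\<bar> < 1 / 2"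
      using tendsto_rabs[OF q] by (intro order_tendstoD(2)[of _ "\<bar>0\<bar>"]) auto
    then have "\<forall>\<^sub>F r in at_right 0. norm (A (r * \<sigma>) / r ^ k) \<le> 2 * \<bar>e r\<bar> + 2 * \<bar>q r\<bar>"
      using pos
    proof eventually_elim
      case (elim r)
      have rk: "r ^ k > 0" using elim by simp
      let ?a = "A (r * \<sigma>) / r ^ k"
      have "q r * (\<bar>A (r * \<sigma>)\<bar> + r ^ k) = R (A (r * \<sigma>), B (r * \<sigma>), 0)"
        using rk by (simp add: q_def add_nonneg_pos less_imp_neq[symmetric])
      then have "e r = (- A (r * \<sigma>) - q r * (\<bar>A (r * \<sigma>)\<bar> + r ^ k)) / r ^ k"
        by (simp only: e_def)
      also have "\<dots> = - ?a - q r * (\<bar>?a\<bar> + 1)"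
        using rk elim by (simp add: diff_divide_distrib add_divide_distrib distrib_left)
      finally have "e r = - ?a - q r * (\<bar>?a\<bar> + 1)" .
      moreover have "\<bar>x\<bar> \<le> \<bar>y\<bar> + \<bar>z\<bar>" if "y = - x - z" for x y z :: real
        using that by linarith
      ultimately have "\<bar>?a\<bar> \<le> \<bar>e r\<bar> + \<bar>q r * (\<bar>?a\<bar> + 1)\<bar>"
        by blast
      also have "\<bar>q r * (\<bar>?a\<bar> + 1)\<bar> = \<bar>q r\<bar> * (\<bar>?a\<bar> + 1)"
        unfolding abs_mult by simp
      also have "\<bar>q r\<bar> * (\<bar>?a\<bar> + 1) \<le> 1 / 2 * \<bar>?a\<bar> + \<bar>q r\<bar>"
        using mult_right_mono[of "\<bar>q r\<bar>" "1 / 2" "\<bar>?a\<bar>"] elim by (simp only: distrib_left) simp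
      finally show ?case by simp
    qed
    moreover
    have "((\<lambda>r. 2 * \<bar>e r\<bar> + 2 * \<bar>q r\<bar>) \<longlongrightarrow> 2 * \<bar>0\<bar> + 2 * \<bar>0\<bar>) (at_right 0)"
      by (intro tendsto_intros e q)
    then have "((\<lambda>r. 2 * \<bar>e r\<bar> + 2 * \<bar>q r\<bar>) \<longlongrightarrow> 0) (at_right 0)"
      by simp
    ultimately show ?thesis
      by (rule Lim_null_comparison)
  qed
  \<comment> \<open>Being o(r^k) forces a zero first derivative. Applied to Y and A, this leaves X
    and B to carry the non-zero derivatives that regularity demands.\<close>
  have flat: "f1 = 0" if "(f has_real_derivative f1) (at 0)" "f 0 = 0"
    "((\<lambda>r. f (r * 1) / r ^ k) \<longlongrightarrow> 0) (at_right 0)" for f f1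
  proof -
    have "((\<lambda>r. f (r * 1) / r ^ k * r ^ (k - 1)) \<longlongrightarrow> 0 * 0 ^ (k - 1)) (at_right 0)"
      by (intro tendsto_intros that)
    moreover have "\<forall>\<^sub>F r in at_right 0. f (r * 1) / r ^ k * r ^ (k - 1) = f (r * 1) / r"
      using pos
    proof eventually_elim
      case (elim r)
      have "r ^ k = r * r ^ (k - 1)" using k by (cases k) auto
      then show ?case using elim by simp
    qed
    ultimately have "((\<lambda>r. f (r * 1) / r) \<longlongrightarrow> 0) (at_right 0)"
      by (simp add: filterlim_cong)
    with tendsto_scaled_at_right[OF that(1,2), of 1] show ?thesis
      using tendsto_unique[OF trivial_limit_at_right_real] by fastforce
  qed
  have X1: "X1 \<noteq> 0" and B1: "B1 \<noteq> 0"
    using XY1 AB1 flat[OF Y Ylim] flat[OF A Alim] by auto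
  \<comment> \<open>After division by r^k everything except \<open>P\<close> tends to 0; the factor
    |A / r^k| + 1, which tends to 1, converts the weight |A| + r^k of the remainder to r^k.\<close>
  have Pz: "P (\<sigma> * B1) (\<tau> * X1) = 0" for \<sigma> \<tau>
  proof -
    have "((\<lambda>r. Y (r * \<tau>) / r ^ k - A (r * \<sigma>) / r ^ k
        - R (A (r * \<sigma>), B (r * \<sigma>), X (r * \<tau>)) / (\<bar>A (r * \<sigma>)\<bar> + r ^ k) * (\<bar>A (r * \<sigma>) / r ^ k\<bar> + 1)
        - (Y (r * \<tau>) - A (r * \<sigma>)
       - (P (B (r * \<sigma>)) (X (r * \<tau>)) + R (A (r * \<sigma>), B (r * \<sigma>), X (r * \<tau>)))) / r ^ k)
        \<longlongrightarrow> 0 - 0 - 0 * (\<bar>0\<bar> + 1) - 0) (at_right 0)"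
      by (intro tendsto_intros Ylim Alim Rlim err)
    moreover have "\<forall>\<^sub>F r in at_right 0. Y (r * \<tau>) / r ^ k - A (r * \<sigma>) / r ^ k
        - R (A (r * \<sigma>), B (r * \<sigma>), X (r * \<tau>)) / (\<bar>A (r * \<sigma>)\<bar> + r ^ k) * (\<bar>A (r * \<sigma>) / r ^ k\<bar> + 1)
        - (Y (r * \<tau>) - A (r * \<sigma>)
       - (P (B (r * \<sigma>)) (X (r * \<tau>)) + R (A (r * \<sigma>), B (r * \<sigma>), X (r * \<tau>)))) / r ^ k
       = P (B (r * \<sigma>) / r) (X (r * \<tau>) / r)"
      using pos
    proof eventually_elim
      case (elim r)
      have rk: "r ^ k > 0" using elim by simp
      let ?a = "A (r * \<sigma>)" and ?R = "R (A (r * \<sigma>), B (r * \<sigma>), X (r * \<tau>))"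
      have "\<bar>?a / r ^ k\<bar> + 1 = (\<bar>?a\<bar> + r ^ k) / r ^ k"
        using elim by (simp add: add_divide_distrib)
      moreover have "\<bar>?a\<bar> + r ^ k \<noteq> 0"
        using rk by (simp add: add_nonneg_pos less_imp_neq[symmetric])
      ultimately have "?R / (\<bar>?a\<bar> + r ^ k) * (\<bar>?a / r ^ k\<bar> + 1) = ?R / r ^ k"
        by simp
      moreover have "P (B (r * \<sigma>)) (X (r * \<tau>)) = P (B (r * \<sigma>) / r) (X (r * \<tau>) / r) * r ^ k"
        using Pscale[of r "B (r * \<sigma>) / r" "X (r * \<tau>) / r"] elim by simp
      ultimately show ?case
        using elim by (simp add: diff_divide_distrib add_divide_distrib)
    qed
    ultimately have 1: "((\<lambda>r. P (B (r * \<sigma>) / r) (X (r * \<tau>) / r)) \<longlongrightarrow> 0) (at_right 0)"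
      by (simp add: filterlim_cong)
    have 2: "((\<lambda>r. P (B (r * \<sigma>) / r) (X (r * \<tau>) / r)) \<longlongrightarrow> P (\<sigma> * B1) (\<tau> * X1)) (at_right 0)"
      unfolding P_def by (intro tendsto_intros tendsto_scaled_at_right X B)
    show ?thesis
      using tendsto_unique[OF trivial_limit_at_right_real 2 1] .
  qed
  \<comment> \<open>Padding with zeros at the pure monomials gives a form indexed by 0..k; dividing
    the arguments by \<open>B1\<close> and \<open>X1\<close> shows that it vanishes on the whole
    plane.\<close>
  define \<gamma>' where "\<gamma>' i = (if i \<in> {1..k-1} then \<gamma> i else 0)" for i
  have "(\<Sum>i\<le>k. \<gamma>' i * \<sigma> ^ i * \<tau> ^ (k - i)) = 0" for \<sigma> \<tau>
  proof -
    have "(\<Sum>i\<le>k. \<gamma>' i * \<sigma> ^ i * \<tau> ^ (k - i)) = P \<sigma> \<tau>"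
      unfolding P_def by (rule sum.mono_neutral_cong_right) (auto simp: \<gamma>'_def)
    also have "\<dots> = P (\<sigma> / B1 * B1) (\<tau> / X1 * X1)"
      using X1 B1 by simp
    also have "\<dots> = 0" by (rule Pz)
    finally show ?thesis .
  qed
  then have "\<gamma>' i = 0"
    by (rule binary_form_eq_0_imp_coeffs_0) (use i in auto)
  then show ?thesis using i by (simp add: \<gamma>'_def)
qed

section \<open>Defining functions in product coordinates\<close>

lemma coordinates_centred_at_germ:
  assumes "coordinates_centred_at q Z"
  obtains Z' where "Z q = 0" "Z' 0 = q" "real_analytic_at Z q" "real_analytic_at Z' 0"
    "\<forall>\<^sub>F u in nhds q. Z' (Z u) = u" "\<forall>\<^sub>F v in nhds 0. Z (Z' v) = v"
proof -
  from assms obtain U V Z' where 0: "Z q = 0" and U: "open U" "q \<in> U" and V: "open V"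
    and h: "homeomorphism U V Z Z'" and an: "real_analytic_on Z U" "real_analytic_on Z' V"
    unfolding coordinates_centred_at_def by blast
  have V0: "0 \<in> V"
    using h U(2) 0 by (auto simp: homeomorphism_def)
  have inv: "u \<in> U \<Longrightarrow> Z' (Z u) = u" "v \<in> V \<Longrightarrow> Z (Z' v) = v" for u v
    using h by (auto simp: homeomorphism_def)
  show ?thesis
  proof (rule that[of Z'])
    show "Z' 0 = q" using inv(1)[OF U(2)] 0 by simp
    show "real_analytic_at Z q" "real_analytic_at Z' 0"
      using an U V0 by (auto simp: real_analytic_on_def)
    show "\<forall>\<^sub>F u in nhds q. Z' (Z u) = u"
      using eventually_nhds_in_open[OF U] by (rule eventually_mono) (rule inv)
    show "\<forall>\<^sub>F v in nhds 0. Z (Z' v) = v"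
      using eventually_nhds_in_open[OF V V0] by (rule eventually_mono) (rule inv)
  qed (rule 0)
qed

definition defect ::
  "(plane \<Rightarrow> plane) \<Rightarrow> (plane \<Rightarrow> plane) \<Rightarrow> (real \<times> real \<times> real \<Rightarrow> real) \<Rightarrow> ambient \<Rightarrow> real" where
  "defect XY AB \<phi> z = snd (XY (fst z)) - fst (AB (snd z))
     - \<phi> (fst (AB (snd z)), snd (AB (snd z)), fst (XY (fst z)))"

lemma locally_given_by_iff_defect:
  "locally_given_by M p XY AB \<phi> \<longleftrightarrow>
     real_analytic_at \<phi> 0 \<and> (\<forall>\<^sub>F z in nhds p. z \<in> M \<longleftrightarrow> defect XY AB \<phi> z = 0)"
proof -
  have "(case z of (u, v) \<Rightarrow> (u, v) \<in> M \<longleftrightarrow>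
      (let (x, y) = XY u; (a, b) = AB v in y = a + \<phi> (a, b, x))) \<longleftrightarrow> (z \<in> M \<longleftrightarrow> defect XY AB \<phi> z = 0)" for z
    by (auto simp: defect_def Let_def algebra_simps split: prod.split)
  then show ?thesis
    by (simp add: locally_given_by_def eventually_nhds)
qed

text \<open>Regularity without components, the form in which the chain rule carries it through
  analytic maps with an analytic inverse.\<close>

lemma regular_iff_derivative_nonzero:
  fixes c :: "real \<Rightarrow> plane"
  assumes "c differentiable (at t)"
  shows "deriv (\<lambda>t. fst (c t)) t \<noteq> 0 \<or> deriv (\<lambda>t. snd (c t)) t \<noteq> 0 \<longleftrightarrow> \<not> (c has_derivative (\<lambda>_. 0)) (at t)"
proof -
  obtain D where D: "(c has_derivative D) (at t)"
    using assms by (auto simp: differentiable_def)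
  have lin: "D h = h *\<^sub>R D 1" for h
    using linear_scale[OF has_derivative_linear[OF D], of h 1] by simp
  have has_D: "((\<lambda>t. fst (c t)) has_derivative (\<lambda>h. fst (D h))) (at t)"
    "((\<lambda>t. snd (c t)) has_derivative (\<lambda>h. snd (D h))) (at t)"
    using D by (auto intro: derivative_eq_intros)
  have comp: "fst (D h) = fst (D 1) * h" "snd (D h) = snd (D 1) * h" for h
    using arg_cong[OF lin[of h], of fst] arg_cong[OF lin[of h], of snd] by (simp_all add: mult.commute)
  have "(\<lambda>h. fst (D h)) = (*) (fst (D 1))" "(\<lambda>h. snd (D h)) = (*) (snd (D 1))"
    by (rule ext, rule comp)+
  with has_D have "((\<lambda>t. fst (c t)) has_real_derivative fst (D 1)) (at t)"
    "((\<lambda>t. snd (c t)) has_real_derivative snd (D 1)) (at t)"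
    unfolding has_field_derivative_def by (simp_all only:)
  then have "deriv (\<lambda>t. fst (c t)) t = fst (D 1)" "deriv (\<lambda>t. snd (c t)) t = snd (D 1)"
    by (auto intro: DERIV_imp_deriv)
  moreover have "(c has_derivative (\<lambda>_. 0)) (at t) \<longleftrightarrow> D = (\<lambda>_. 0)"
    using D has_derivative_unique by blast
  moreover have "D = (\<lambda>_. 0) \<longleftrightarrow> D 1 = 0"
    using lin by (metis scaleR_zero_right)
  ultimately show ?thesis by (simp add: prod_eq_iff)
qed

lemma stationary_compose:
  assumes "(c has_derivative (\<lambda>_. 0)) (at t)" "real_analytic_at Z (c t)"
  shows "((\<lambda>t. Z (c t)) has_derivative (\<lambda>_. 0)) (at t)"
proof -
  obtain E where E: "(Z has_derivative E) (at (c t))"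
    using real_analytic_imp_differentiable[OF assms(2)] by (auto simp: differentiable_def)
  from has_derivative_compose[OF assms(1) E] linear_0[OF has_derivative_linear[OF E]]
  show ?thesis by simp
qed

lemma has_derivative_transform_nhds:
  assumes "(f has_derivative D) (at p)" "\<forall>\<^sub>F z in nhds p. f z = g z"
  shows "(g has_derivative D) (at p)"
proof (rule has_derivative_transform_eventually[OF assms(1)])
  show "\<forall>\<^sub>F z in at p. f z = g z" "f p = g p"
    using assms(2) by (auto simp: eventually_nhds_conv_at)
qed simp

text \<open>Moving a point onto \<open>M\<close> along the \<open>y\<close>-axis, which is transversal to \<open>M\<close>, shows that
  any two defining functions are comparable.\<close>
lemma defect_le_defining_function:
  assumes coords: "product_coordinates_centred_at p XY AB" and M: "locally_given_by M p XY AB \<phi>"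
    and p: "p \<in> M" and \<rho>: "local_defining_function M p \<rho>"
  shows "\<exists>C>0. \<forall>\<^sub>F z in nhds p. \<bar>defect XY AB \<phi> z\<bar> \<le> C * \<bar>\<rho> z\<bar>"
proof -
  obtain XY' where XY: "XY (fst p) = 0" "XY' 0 = fst p" "real_analytic_at XY (fst p)" "real_analytic_at XY' 0"
    "\<forall>\<^sub>F u in nhds (fst p). XY' (XY u) = u" "\<forall>\<^sub>F v in nhds 0. XY (XY' v) = v"
    by (rule coordinates_centred_at_germ[of "fst p" XY])
       (use coords in \<open>auto simp: product_coordinates_centred_at_def\<close>)
  obtain AB' where AB: "AB (snd p) = 0" "AB' 0 = snd p" "real_analytic_at AB (snd p)" "real_analytic_at AB' 0"
    "\<forall>\<^sub>F u in nhds (snd p). AB' (AB u) = u" "\<forall>\<^sub>F v in nhds 0. AB (AB' v) = v"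
    by (rule coordinates_centred_at_germ[of "snd p" AB])
       (use coords in \<open>auto simp: product_coordinates_centred_at_def\<close>)
  have \<phi>: "real_analytic_at \<phi> 0" and Md: "\<forall>\<^sub>F z in nhds p. z \<in> M \<longleftrightarrow> defect XY AB \<phi> z = 0"
    using M by (auto simp: locally_given_by_iff_defect)
  have "\<phi> 0 = 0"
    using eventually_nhds_x_imp_x[OF Md] p XY(1) AB(1) by (simp add: defect_def zero_prod_def)
  then have \<phi>0: "\<phi> (0, 0, 0) = 0" by (simp add: zero_prod_def)
  have \<rho>an: "real_analytic_at \<rho> p" and \<rho>M: "\<forall>\<^sub>F z in nhds p. z \<in> M \<longleftrightarrow> \<rho> z = 0"
    using \<rho> by (auto simp: local_defining_function_def eventually_nhds)
  obtain D' where D': "(\<rho> has_derivative D') (at p)" "D' \<noteq> (\<lambda>h. 0)"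
    using \<rho> by (auto simp: local_defining_function_def)
  define \<Psi> where "\<Psi> w = (XY' (fst w), AB' (snd w))" for w
  define \<Phi> where "\<Phi> z = (XY (fst z), AB (snd z))" for z :: ambient
  have \<Phi>p: "\<Phi> p = 0" and \<Psi>0: "\<Psi> 0 = p"
    using XY AB by (auto simp: \<Phi>_def \<Psi>_def zero_prod_def)
  have \<Phi>an: "real_analytic_at \<Phi> p"
    unfolding \<Phi>_def[abs_def]
    by (rule real_analytic_at_Pair[OF real_analytic_at_comp_fst real_analytic_at_comp_snd])
       (simp_all add: XY AB)
  have \<Psi>an: "real_analytic_at \<Psi> 0"
    unfolding \<Psi>_def[abs_def]
    by (rule real_analytic_at_Pair[OF real_analytic_at_comp_fst real_analytic_at_comp_snd])
       (simp_all add: XY AB)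
  have \<Phi>lim: "(\<Phi> \<longlongrightarrow> 0) (nhds p)" and \<Psi>lim: "(\<Psi> \<longlongrightarrow> p) (nhds 0)"
    using real_analytic_tendsto[OF \<Phi>an] real_analytic_tendsto[OF \<Psi>an] by (simp_all add: \<Phi>p \<Psi>0)
  have fst0: "((fst :: ambient \<Rightarrow> plane) \<longlongrightarrow> 0) (nhds 0)" and snd0: "((snd :: ambient \<Rightarrow> plane) \<longlongrightarrow> 0) (nhds 0)"
    and fstp: "((fst :: ambient \<Rightarrow> plane) \<longlongrightarrow> fst p) (nhds p)" and sndp: "((snd :: ambient \<Rightarrow> plane) \<longlongrightarrow> snd p) (nhds p)"
    by (auto intro!: tendsto_eq_intros filterlim_ident)
  have \<Psi>\<Phi>: "\<forall>\<^sub>F z in nhds p. \<Psi> (\<Phi> z) = z"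
    using eventually_compose_filterlim[OF XY(5) fstp] eventually_compose_filterlim[OF AB(5) sndp]
    by eventually_elim (simp add: \<Psi>_def \<Phi>_def)
  have \<Phi>\<Psi>: "\<forall>\<^sub>F w in nhds 0. \<Phi> (\<Psi> w) = w"
    using eventually_compose_filterlim[OF XY(6) fst0] eventually_compose_filterlim[OF AB(6) snd0]
    by eventually_elim (simp add: \<Psi>_def \<Phi>_def)
  \<comment> \<open>\<rho> read in the product coordinates, where the y-direction is the fixed
    vector ((0, 1), (0, 0)).\<close>
  define G where "G w = \<rho> (\<Psi> w)" for w
  have Gan: "real_analytic_at G 0"
    unfolding G_def[abs_def] by (rule real_analytic_at_compose[OF \<Psi>an]) (simp add: \<Psi>0 \<rho>an)
  from real_analytic_strict_derivative[OF Gan] obtain D where D: "bounded_linear D"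
    and strict: "\<And>\<epsilon>. \<epsilon> > 0 \<Longrightarrow> \<exists>\<delta>>0. \<forall>z\<in>ball 0 \<delta>. \<forall>z'\<in>ball 0 \<delta>. \<bar>G z - G z' - D (z - z')\<bar> \<le> \<epsilon> * norm (z - z')"
    by blast
  have GD: "(G has_derivative D) (at 0)"
    by (rule strict_imp_has_derivative[OF D strict])
  \<comment> \<open>Parametrisation of M in coordinates by (a, b, x). Differentiating G = 0 along it
    shows that \<open>D\<close> vanishes on the tangent space of M.\<close>
  define fiber :: "real \<times> real \<times> real \<Rightarrow> ambient"
    where "fiber h = ((snd (snd h), fst h + \<phi> h), (fst h, fst (snd h)))" for h
  have fiber0: "fiber 0 = 0"
    by (simp add: fiber_def \<phi>0 zero_prod_def)
  have Gzero: "\<forall>\<^sub>F w in nhds 0. G w = 0 \<longleftrightarrow> snd (fst w) - fst (snd w) - \<phi> (fst (snd w), snd (snd w), fst (fst w)) = 0"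
    using eventually_compose_filterlim[OF \<rho>M \<Psi>lim] eventually_compose_filterlim[OF Md \<Psi>lim] \<Phi>\<Psi>
    by eventually_elim (auto simp: G_def defect_def \<Phi>_def split: prod.splits simp: prod_eq_iff)
  have fiber_lim: "(fiber \<longlongrightarrow> 0) (nhds 0)"
  proof -
    have "real_analytic_at fiber 0"
      unfolding fiber_def[abs_def] by (intro real_analytic_intros \<phi>)
    then show ?thesis using real_analytic_tendsto fiber0 by force
  qed
  have Gfiber: "\<forall>\<^sub>F h in nhds 0. G (fiber h) = 0"
    using eventually_compose_filterlim[OF Gzero fiber_lim]
    by eventually_elim (simp add: fiber_def)
  obtain L where L: "(\<phi> has_derivative L) (at 0)"
    using real_analytic_imp_differentiable[OF \<phi>] by (auto simp: differentiable_def)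
  define L' where "L' h = ((snd (snd h), fst h + L h), (fst h, fst (snd h)))" for h
  have "(fiber has_derivative L') (at 0)"
    unfolding fiber_def[abs_def] L'_def[abs_def]
    by (intro has_derivative_Pair has_derivative_add has_derivative_fst has_derivative_snd has_derivative_ident L)
  then have "((\<lambda>h. G (fiber h)) has_derivative (\<lambda>h. D (L' h))) (at 0)"
    by (rule has_derivative_compose) (simp add: fiber0 GD)
  from has_derivative_transform_nhds[OF this Gfiber] have DL: "D (L' h) = 0" for h
    using has_derivative_unique[OF _ has_derivative_const] by metis
  \<comment> \<open>Transversality: the tangent space, which is the range of \<open>L'\<close>, and
    the y-direction together span everything, so \<eta> = 0 would force the derivative of \<rho> at
    p to vanish.\<close>
  define \<eta> where "\<eta> = D ((0, 1), (0, 0))"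
  have \<eta>: "\<eta> \<noteq> 0"
  proof
    assume "\<eta> = 0"
    have "D w = 0" for w
    proof -
      define h where "h = (fst (snd w), snd (snd w), fst (fst w))"
      define d where "d = snd (fst w) - fst (snd w) - L h"
      have "w = L' h + d *\<^sub>R ((0, 1), (0, 0))"
        by (simp add: L'_def h_def d_def prod_eq_iff)
      then have "D w = D (L' h) + d *\<^sub>R \<eta>"
        unfolding \<eta>_def using bounded_linear.linear[OF D] by (metis linear_add linear_scale)
      then show ?thesis using DL \<open>\<eta> = 0\<close> by simp
    qed
    obtain E where E: "(\<Phi> has_derivative E) (at p)"
      using real_analytic_imp_differentiable[OF \<Phi>an] by (auto simp: differentiable_def)
    have "((\<lambda>z. G (\<Phi> z)) has_derivative (\<lambda>h. D (E h))) (at p)"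
      by (rule has_derivative_compose[OF E]) (simp add: \<Phi>p GD)
    then have "(\<rho> has_derivative (\<lambda>h. D (E h))) (at p)"
      by (rule has_derivative_transform_nhds)
         (use \<Psi>\<Phi> in \<open>auto simp: G_def elim: eventually_mono\<close>)
    then have "D' = (\<lambda>h. D (E h))"
      using D'(1) has_derivative_unique by blast
    then show False using D'(2) \<open>\<And>w. D w = 0\<close> by auto
  qed
  \<comment> \<open>With error |\<eta>| / 2 at least half of the slope in the y-direction survives,
    whence the constant 2 / |\<eta>|.\<close>
  obtain \<delta> where \<delta>: "\<delta> > 0" "\<And>z z'. z \<in> ball 0 \<delta> \<Longrightarrow> z' \<in> ball 0 \<delta> \<Longrightarrow>
      \<bar>G z - G z' - D (z - z')\<bar> \<le> \<bar>\<eta>\<bar> / 2 * norm (z - z')"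
    using strict[of "\<bar>\<eta>\<bar> / 2"] \<eta> unfolding half_gt_zero_iff zero_less_abs_iff by blast
  define foot :: "ambient \<Rightarrow> real \<times> real \<times> real"
    where "foot w = (fst (snd w), snd (snd w), fst (fst w))" for w
  have foot_lim: "(foot \<longlongrightarrow> 0) (nhds 0)"
  proof -
    have "real_analytic_at foot 0"
      unfolding foot_def[abs_def] by (intro real_analytic_intros)
    then show ?thesis using real_analytic_tendsto[of foot 0] by (simp add: foot_def zero_prod_def)
  qed
  have ball: "\<forall>\<^sub>F w in nhds 0. w \<in> ball (0 :: ambient) \<delta>"
    using \<delta>(1) by (intro eventually_nhds_in_open) auto
  have "\<forall>\<^sub>F w in nhds 0. \<bar>snd (fst w) - fst (snd w) - \<phi> (foot w)\<bar> \<le> 2 / \<bar>\<eta>\<bar> * \<bar>G w\<bar>"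
    using ball eventually_compose_filterlim[OF eventually_compose_filterlim[OF ball fiber_lim] foot_lim]
      eventually_compose_filterlim[OF Gfiber foot_lim]
  proof eventually_elim
    case (elim w)
    define d where "d = snd (fst w) - fst (snd w) - \<phi> (foot w)"
    \<comment> \<open>\<open>w\<close> and the point of M with the same (a, b, x) differ only in y,
      and the difference is the defect.\<close>
    have diff: "w - fiber (foot w) = d *\<^sub>R ((0, 1), (0, 0))"
      by (simp add: fiber_def foot_def d_def prod_eq_iff)
    have "D (w - fiber (foot w)) = d *\<^sub>R \<eta>"
      unfolding diff \<eta>_def using bounded_linear.linear[OF D] by (rule linear_scale)
    moreover have "norm (w - fiber (foot w)) = \<bar>d\<bar>"
      unfolding diff by (simp add: norm_Pair)
    ultimately have "\<bar>G w - d * \<eta>\<bar> \<le> \<bar>\<eta>\<bar> / 2 * \<bar>d\<bar>"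
      using \<delta>(2)[OF elim(1,2)] elim(3) by simp
    moreover have "\<bar>d * \<eta>\<bar> = \<bar>\<eta>\<bar> * \<bar>d\<bar>" by (simp add: abs_mult)
    ultimately have "\<bar>\<eta>\<bar> * \<bar>d\<bar> \<le> 2 * \<bar>G w\<bar>"
      using abs_triangle_ineq2_sym[of "d * \<eta>" "G w"] by simp
    then show ?case
      using \<eta> unfolding d_def[symmetric] by (simp add: field_simps)
  qed
  from eventually_compose_filterlim[OF this \<Phi>lim] \<Psi>\<Phi>
  have "\<forall>\<^sub>F z in nhds p. \<bar>defect XY AB \<phi> z\<bar> \<le> 2 / \<bar>\<eta>\<bar> * \<bar>\<rho> z\<bar>"
    by eventually_elim (simp add: defect_def foot_def \<Phi>_def G_def)
  then show ?thesis using \<eta> by (intro exI[of _ "2 / \<bar>\<eta>\<bar>"]) simp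
qed

text \<open>The curve along the \<open>x\<close>- and \<open>b\<close>-axes, on which the defining function is \<open>-\<phi>(0, s, t)\<close>.\<close>
lemma axis_curve_contact_order:
  assumes coords: "product_coordinates_centred_at p XY AB" and M: "locally_given_by M p XY AB \<phi>"
    and p: "p \<in> M"
  obtains g where "real_analytic_at g (0, 0)" "\<forall>\<^sub>F w in nhds (0, 0). g w = - \<phi> (0, w)"
    "vanishing_order g (0, 0) \<in> regular_contact_orders M p"
proof -
  obtain XY' where XY: "XY (fst p) = 0" "XY' 0 = fst p" "real_analytic_at XY (fst p)" "real_analytic_at XY' 0"
    "\<forall>\<^sub>F u in nhds (fst p). XY' (XY u) = u" "\<forall>\<^sub>F v in nhds 0. XY (XY' v) = v"
    by (rule coordinates_centred_at_germ[of "fst p" XY])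
       (use coords in \<open>auto simp: product_coordinates_centred_at_def\<close>)
  obtain AB' where AB: "AB (snd p) = 0" "AB' 0 = snd p" "real_analytic_at AB (snd p)" "real_analytic_at AB' 0"
    "\<forall>\<^sub>F u in nhds (snd p). AB' (AB u) = u" "\<forall>\<^sub>F v in nhds 0. AB (AB' v) = v"
    by (rule coordinates_centred_at_germ[of "snd p" AB])
       (use coords in \<open>auto simp: product_coordinates_centred_at_def\<close>)
  have \<phi>: "real_analytic_at \<phi> 0" and Md: "\<forall>\<^sub>F z in nhds p. z \<in> M \<longleftrightarrow> defect XY AB \<phi> z = 0"
    using M by (auto simp: locally_given_by_iff_defect)
  have "\<phi> 0 = 0"
    using eventually_nhds_x_imp_x[OF Md] p XY(1) AB(1) by (simp add: defect_def zero_prod_def)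
  then have \<phi>0: "\<phi> (0, 0, 0) = 0" by (simp add: zero_prod_def)
  let ?\<rho> = "defect XY AB \<phi>"
  have \<rho>an: "real_analytic_at ?\<rho> p"
  proof -
    have 1: "real_analytic_at (\<lambda>z. XY (fst z)) p" "real_analytic_at (\<lambda>z. AB (snd z)) p"
      by (rule real_analytic_at_comp_fst real_analytic_at_comp_snd, rule XY AB)+
    have 2: "real_analytic_at (\<lambda>z. \<phi> (fst (AB (snd z)), snd (AB (snd z)), fst (XY (fst z)))) p"
      by (rule real_analytic_at_compose[where f = \<phi>], intro real_analytic_intros 1)
         (simp add: XY(1) AB(1) \<phi> flip: zero_prod_def)
    show ?thesis
      unfolding defect_def[abs_def] by (intro real_analytic_intros 1 2)
  qed
  define xy where "xy t = XY' (t, 0)" for t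
  define ab where "ab s = AB' (0, s)" for s
  have xy_an: "real_analytic_at xy 0" and ab_an: "real_analytic_at ab 0"
    unfolding xy_def[abs_def] ab_def[abs_def]
    by (rule real_analytic_at_compose[OF real_analytic_at_Pair[OF
            real_analytic_at_ident real_analytic_at_const]], simp add: XY flip: zero_prod_def,
        rule real_analytic_at_compose[OF real_analytic_at_Pair[OF
            real_analytic_at_const real_analytic_at_ident]], simp add: AB flip: zero_prod_def)
  have lim1: "((\<lambda>t::real. (t, 0::real)) \<longlongrightarrow> 0) (nhds 0)" and lim2: "((\<lambda>t::real. (0::real, t)) \<longlongrightarrow> 0) (nhds 0)"
    unfolding zero_prod_def by (intro tendsto_intros filterlim_ident)+
  have XYxy: "\<forall>\<^sub>F t in nhds 0. XY (xy t) = (t, 0)" and ABab: "\<forall>\<^sub>F s in nhds 0. AB (ab s) = (0, s)"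
    using eventually_compose_filterlim[OF XY(6) lim1] eventually_compose_filterlim[OF AB(6) lim2]
    by (simp_all add: xy_def ab_def)
  have xy0: "xy 0 = fst p" and ab0: "ab 0 = snd p"
    using XY(2) AB(2) by (simp_all add: xy_def ab_def zero_prod_def)
  define F where "F = (\<lambda>(s, t). (xy t, ab s))"
  have F0: "F (0, 0) = p"
    by (simp add: F_def xy0 ab0)
  have para: "para_holomorphic_curve_at F (0, 0)"
    unfolding para_holomorphic_curve_at_def F_def using xy_an ab_an by auto
  \<comment> \<open>A stationary curve would remain stationary after \<open>XY\<close>, but in
    coordinates this one sends t to (t, 0).\<close>
  have "\<not> (xy has_derivative (\<lambda>_. 0)) (at 0)"
  proof
    assume "(xy has_derivative (\<lambda>_. 0)) (at 0)"
    then have "((\<lambda>t. XY (xy t)) has_derivative (\<lambda>_. 0)) (at 0)"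
      by (rule stationary_compose) (simp add: xy0 XY)
    from has_derivative_fst[OF has_derivative_transform_nhds[OF this XYxy]]
    have "((\<lambda>t. t) has_derivative (\<lambda>_. 0)) (at (0::real))"
      by simp
    then have "(\<lambda>t::real. t) = (\<lambda>_. 0)"
      using has_derivative_unique[OF _ has_derivative_ident] by fastforce
    then show False by (metis zero_neq_one)
  qed
  moreover have "\<not> (ab has_derivative (\<lambda>_. 0)) (at 0)"
  proof
    assume "(ab has_derivative (\<lambda>_. 0)) (at 0)"
    then have "((\<lambda>t. AB (ab t)) has_derivative (\<lambda>_. 0)) (at 0)"
      by (rule stationary_compose) (simp add: ab0 AB)
    from has_derivative_snd[OF has_derivative_transform_nhds[OF this ABab]]
    have "((\<lambda>t. t) has_derivative (\<lambda>_. 0)) (at (0::real))"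
      by simp
    then have "(\<lambda>t::real. t) = (\<lambda>_. 0)"
      using has_derivative_unique[OF _ has_derivative_ident] by fastforce
    then show False by (metis zero_neq_one)
  qed
  ultimately have reg: "regular_curve_at F (0, 0)"
    unfolding regular_curve_at_def F_def prod.case fst_conv snd_conv
    using regular_iff_derivative_nonzero[OF real_analytic_imp_differentiable[OF xy_an]]
      regular_iff_derivative_nonzero[OF real_analytic_imp_differentiable[OF ab_an]] by simp
  have "local_defining_function M p ?\<rho>"
    unfolding local_defining_function_def
  proof (intro conjI)
    show "\<exists>W. open W \<and> p \<in> W \<and> (\<forall>z\<in>W. (z \<in> M) = (?\<rho> z = 0))"
      using Md by (simp add: eventually_nhds)
    obtain D where D: "(?\<rho> has_derivative D) (at p)"
      using real_analytic_imp_differentiable[OF \<rho>an] by (auto simp: differentiable_def)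
    \<comment> \<open>Along the y-axis the defect equals y, because \<phi>(0, 0, 0) = 0; hence its
      derivative at p is not zero.\<close>
    define c where "c y = (XY' (0, y), snd p)" for y
    have c0: "c 0 = p" using XY(2) by (simp add: c_def zero_prod_def)
    have "real_analytic_at c 0"
      unfolding c_def[abs_def]
      by (rule real_analytic_at_Pair[OF real_analytic_at_compose[OF real_analytic_at_Pair[OF
            real_analytic_at_const real_analytic_at_ident]] real_analytic_at_const])
         (simp add: XY flip: zero_prod_def)
    then obtain c' where c': "(c has_derivative c') (at 0)"
      using real_analytic_imp_differentiable by (auto simp: differentiable_def)
    have "((\<lambda>y. ?\<rho> (c y)) has_derivative (\<lambda>h. D (c' h))) (at 0)"
      by (rule has_derivative_compose[OF c']) (simp add: c0 D)
    moreover have "\<forall>\<^sub>F y in nhds 0. ?\<rho> (c y) = y"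
      using eventually_compose_filterlim[OF XY(6) lim2]
      by eventually_elim (use \<phi>0 in \<open>simp add: c_def defect_def AB(1) zero_prod_def\<close>)
    ultimately have "((\<lambda>y. y) has_derivative (\<lambda>h. D (c' h))) (at 0)"
      by (rule has_derivative_transform_nhds)
    then have "(\<lambda>h. D (c' h)) = (\<lambda>h. h)"
      using has_derivative_unique[OF _ has_derivative_ident] by blast
    then have "D \<noteq> (\<lambda>h. 0)" by (metis zero_neq_one)
    then show "\<exists>D. (?\<rho> has_derivative D) (at p) \<and> D \<noteq> (\<lambda>h. 0)"
      using D by blast
  qed (rule \<rho>an)
  then have "has_contact_order F (0, 0) M (vanishing_order (?\<rho> \<circ> F) (0, 0))"
    unfolding has_contact_order_def F0 by blast
  then have mem: "vanishing_order (?\<rho> \<circ> F) (0, 0) \<in> regular_contact_orders M p"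
    unfolding regular_contact_orders_def using para reg F0 by blast
  have F_an: "real_analytic_at F (0, 0)"
  proof -
    have "F = (\<lambda>w. (xy (snd w), ab (fst w)))"
      by (auto simp: F_def)
    moreover have "real_analytic_at (\<lambda>w. (xy (snd w), ab (fst w))) (0, 0)"
      by (rule real_analytic_at_Pair[OF real_analytic_at_comp_snd real_analytic_at_comp_fst])
         (simp_all add: xy_an ab_an)
    ultimately show ?thesis by simp
  qed
  have "real_analytic_at (?\<rho> \<circ> F) (0, 0)"
    unfolding o_def by (rule real_analytic_at_compose[OF F_an]) (simp add: F0 \<rho>an)
  moreover have "\<forall>\<^sub>F w in nhds (0, 0). (?\<rho> \<circ> F) w = - \<phi> (0, w)"
  proof -
    have "((fst :: real \<times> real \<Rightarrow> real) \<longlongrightarrow> 0) (nhds (0, 0))" "((snd :: real \<times> real \<Rightarrow> real) \<longlongrightarrow> 0) (nhds (0, 0))"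
      by (auto intro!: tendsto_eq_intros filterlim_ident)
    from eventually_compose_filterlim[OF ABab this(1)] eventually_compose_filterlim[OF XYxy this(2)]
    show ?thesis
      by eventually_elim (simp add: defect_def F_def case_prod_beta)
  qed
  ultimately show ?thesis using mem that by blast
qed

section \<open>Normal forms and orders of contact\<close>

lemma taylor2_eventually:
  fixes g :: "real \<times> real \<Rightarrow> real"
  assumes "real_analytic_at g q"
  obtains a :: "nat \<Rightarrow> nat \<Rightarrow> real" where
    "\<And>i j. mixed_partial i j g q = fact i * fact j * a i j"
    "\<And>k. \<exists>C\<ge>0. \<forall>\<^sub>F w in nhds (0, 0).
       \<bar>g (q + w) - (\<Sum>m\<le>k. \<Sum>i\<le>m. a i (m - i) * fst w ^ i * snd w ^ (m - i))\<bar> \<le> C * (\<bar>fst w\<bar> + \<bar>snd w\<bar>) ^ Suc k"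
proof -
  obtain s0 t0 where q: "q = (s0, t0)" by (cases q)
  obtain a :: "nat \<Rightarrow> nat \<Rightarrow> real" where
    a: "\<And>i j. mixed_partial i j g (s0, t0) = fact i * fact j * a i j"
    and T: "\<And>k. \<exists>r>0. \<exists>C. \<forall>u v. \<bar>u\<bar> \<le> r \<longrightarrow> \<bar>v\<bar> \<le> r \<longrightarrow>
       \<bar>g (s0 + u, t0 + v) - (\<Sum>m\<le>k. \<Sum>i\<le>m. a i (m - i) * u ^ i * v ^ (m - i))\<bar> \<le> C * (\<bar>u\<bar> + \<bar>v\<bar>) ^ Suc k"
    using assms unfolding q by (rule real_analytic_taylor2) (rule that)
  show ?thesis
  proof (rule that)
    show "mixed_partial i j g q = fact i * fact j * a i j" for i j
      using a by (simp add: q)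
    fix k
    obtain r C where r: "r > 0" and C: "\<And>u v. \<bar>u\<bar> \<le> r \<Longrightarrow> \<bar>v\<bar> \<le> r \<Longrightarrow>
       \<bar>g (s0 + u, t0 + v) - (\<Sum>m\<le>k. \<Sum>i\<le>m. a i (m - i) * u ^ i * v ^ (m - i))\<bar> \<le> C * (\<bar>u\<bar> + \<bar>v\<bar>) ^ Suc k"
      using T[of k] by blast
    have "\<forall>\<^sub>F w in nhds (0, 0). w \<in> {-r<..<r} \<times> {-r<..<r}"
      using r by (intro eventually_nhds_in_open open_Times) auto
    then have "\<forall>\<^sub>F w in nhds (0, 0).
       \<bar>g (q + w) - (\<Sum>m\<le>k. \<Sum>i\<le>m. a i (m - i) * fst w ^ i * snd w ^ (m - i))\<bar> \<le> \<bar>C\<bar> * (\<bar>fst w\<bar> + \<bar>snd w\<bar>) ^ Suc k"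
    proof eventually_elim
      case (elim w)
      obtain u v where w: "w = (u, v)" by (cases w)
      have "\<bar>u\<bar> \<le> r" "\<bar>v\<bar> \<le> r" using elim w by auto
      note C[OF this]
      also have "C * (\<bar>u\<bar> + \<bar>v\<bar>) ^ Suc k \<le> \<bar>C\<bar> * (\<bar>u\<bar> + \<bar>v\<bar>) ^ Suc k"
        by (intro mult_right_mono) auto
      finally show ?case by (simp add: w q)
    qed
    then show "\<exists>C\<ge>0. \<forall>\<^sub>F w in nhds (0, 0).
       \<bar>g (q + w) - (\<Sum>m\<le>k. \<Sum>i\<le>m. a i (m - i) * fst w ^ i * snd w ^ (m - i))\<bar> \<le> C * (\<bar>fst w\<bar> + \<bar>snd w\<bar>) ^ Suc k"
      by (intro exI[of _ "\<bar>C\<bar>"]) simp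
  qed
qed

lemma taylor2_along_ray:
  fixes g :: "real \<times> real \<Rightarrow> real" and a :: "nat \<Rightarrow> nat \<Rightarrow> real"
  assumes "\<exists>C\<ge>0. \<forall>\<^sub>F w in nhds (0, 0).
       \<bar>g ((0, 0) + w) - (\<Sum>m\<le>k. \<Sum>i\<le>m. a i (m - i) * fst w ^ i * snd w ^ (m - i))\<bar> \<le> C * (\<bar>fst w\<bar> + \<bar>snd w\<bar>) ^ Suc k"
  shows "((\<lambda>r. (g (r * \<sigma>, r * \<tau>) - (\<Sum>m\<le>k. (\<Sum>i\<le>m. a i (m - i) * \<sigma> ^ i * \<tau> ^ (m - i)) * r ^ m)) / r ^ k)
     \<longlongrightarrow> 0) (at_right 0)"
proof -
  obtain C where C: "\<forall>\<^sub>F w in nhds (0, 0).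
       \<bar>g ((0, 0) + w) - (\<Sum>m\<le>k. \<Sum>i\<le>m. a i (m - i) * fst w ^ i * snd w ^ (m - i))\<bar> \<le> C * (\<bar>fst w\<bar> + \<bar>snd w\<bar>) ^ Suc k"
    using assms by blast
  have "\<forall>\<^sub>F r in at_right 0. \<bar>g (r * \<sigma>, r * \<tau>) - (\<Sum>m\<le>k. (\<Sum>i\<le>m. a i (m - i) * \<sigma> ^ i * \<tau> ^ (m - i)) * r ^ m)\<bar>
     \<le> C * (\<bar>\<sigma>\<bar> + \<bar>\<tau>\<bar>) ^ Suc k * r ^ Suc k"
    using eventually_along_ray[OF C, of \<sigma> \<tau>] eventually_at_right_less[of "0::real"]
  proof eventually_elim
    case (elim r)
    have "\<bar>r * \<sigma>\<bar> + \<bar>r * \<tau>\<bar> = (\<bar>\<sigma>\<bar> + \<bar>\<tau>\<bar>) * r"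
      using elim by (simp add: abs_mult algebra_simps)
    moreover have "(\<Sum>i\<le>m. a i (m - i) * (r * \<sigma>) ^ i * (r * \<tau>) ^ (m - i))
        = (\<Sum>i\<le>m. a i (m - i) * \<sigma> ^ i * \<tau> ^ (m - i)) * r ^ m" for m
      by (rule binary_form_scale) simp
    ultimately show ?case
      using elim by (simp only: fst_conv snd_conv power_mult_distrib mult.assoc add_Pair add_0)
  qed
  then show ?thesis by (rule tendsto_div_pow_if_le)
qed

text \<open>The local inverse of \<open>Z\<close> is analytic too: were the curve stationary in
  coordinates, composing with that inverse would make the original curve stationary. The parameter
  is shifted to 0 in preparation for rescaling.\<close>

lemma coordinates_regular:
  assumes Z: "coordinates_centred_at (c t) Z" and c: "real_analytic_at c t"
    and reg: "deriv (\<lambda>t. fst (c t)) t \<noteq> 0 \<or> deriv (\<lambda>t. snd (c t)) t \<noteq> 0"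
  obtains D1 D2 where "((\<lambda>v. fst (Z (c (v + t)))) has_real_derivative D1) (at 0)"
    "((\<lambda>v. snd (Z (c (v + t)))) has_real_derivative D2) (at 0)" "D1 \<noteq> 0 \<or> D2 \<noteq> 0"
proof -
  obtain Z' where Z': "Z (c t) = 0" "real_analytic_at Z (c t)" "real_analytic_at Z' 0"
    "\<forall>\<^sub>F u in nhds (c t). Z' (Z u) = u"
    by (rule coordinates_centred_at_germ[OF Z])
  have Zc: "real_analytic_at (\<lambda>t. Z (c t)) t"
    by (rule real_analytic_at_compose[OF c Z'(2)])
  note diff = real_analytic_imp_differentiable[OF Zc]
  have "\<not> ((\<lambda>t. Z (c t)) has_derivative (\<lambda>_. 0)) (at t)"
  proof
    assume "((\<lambda>t. Z (c t)) has_derivative (\<lambda>_. 0)) (at t)"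
    then have "((\<lambda>t. Z' (Z (c t))) has_derivative (\<lambda>_. 0)) (at t)"
      by (rule stationary_compose) (simp add: Z')
    from has_derivative_transform_nhds[OF this eventually_compose_filterlim[OF Z'(4) real_analytic_tendsto[OF c]]]
    show False
      using reg regular_iff_derivative_nonzero[OF real_analytic_imp_differentiable[OF c]] by simp
  qed
  then have ne: "deriv (\<lambda>t. fst (Z (c t))) t \<noteq> 0 \<or> deriv (\<lambda>t. snd (Z (c t))) t \<noteq> 0"
    using regular_iff_derivative_nonzero[OF diff] by simp
  have "(\<lambda>t. fst (Z (c t))) differentiable (at t)" "(\<lambda>t. snd (Z (c t))) differentiable (at t)"
    by (intro real_analytic_imp_differentiable real_analytic_at_fst real_analytic_at_snd Zc)+
  then obtain D1 D2 where D: "((\<lambda>t. fst (Z (c t))) has_real_derivative D1) (at t)"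
    "((\<lambda>t. snd (Z (c t))) has_real_derivative D2) (at t)"
    by (auto simp: real_differentiable_def)
  show ?thesis
  proof (rule that)
    show "((\<lambda>v. fst (Z (c (v + t)))) has_real_derivative D1) (at 0)"
      using D(1) DERIV_shift[of "\<lambda>t. fst (Z (c t))" D1 0 t] by simp
    show "((\<lambda>v. snd (Z (c (v + t)))) has_real_derivative D2) (at 0)"
      using D(2) DERIV_shift[of "\<lambda>t. snd (Z (c t))" D2 0 t] by simp
    show "D1 \<noteq> 0 \<or> D2 \<noteq> 0"
      using ne D by (auto dest: DERIV_imp_deriv)
  qed
qed

lemma locally_given_by_origin:
  assumes "product_coordinates_centred_at p XY AB" "locally_given_by M p XY AB \<phi>" "p \<in> M"
  shows "\<phi> 0 = 0"
proof -
  have "\<forall>\<^sub>F z in nhds p. z \<in> M \<longleftrightarrow> defect XY AB \<phi> z = 0"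
    using assms(2) by (simp add: locally_given_by_iff_defect)
  then have "defect XY AB \<phi> p = 0"
    using assms(3) eventually_nhds_x_imp_x by blast
  then show ?thesis
    using assms(1)
    by (simp add: product_coordinates_centred_at_def coordinates_centred_at_def defect_def zero_prod_def)
qed

text \<open>Contact above k annihilates the Taylor coefficients of \<open>\<rho> \<circ> F\<close>
  up to degree k. The resulting O((|s| + |t|)^(k+1)) passes to the graph equation by comparability
  of defining functions, and rescaling then contradicts the non-zero
  \<open>\<gamma> i\<close>.\<close>

lemma normal_form_contact_order_le:
  fixes \<gamma> :: "nat \<Rightarrow> real"
  assumes coords: "product_coordinates_centred_at p XY AB"
    and M: "locally_given_by M p XY AB
      (\<lambda>(a, b, x). (\<Sum>i=1..k-1. \<gamma> i * b ^ i * x ^ (k - i)) + R (a, b, x))"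
    and R: "R \<in> o[at 0](\<lambda>(a, b, x). \<bar>a\<bar> + (\<bar>x\<bar> + \<bar>b\<bar>) ^ k)"
    and i: "i \<in> {1..k-1}" "\<gamma> i \<noteq> 0" and p: "p \<in> M"
    and n: "n \<in> regular_contact_orders M p"
  shows "n \<le> enat k"
proof (rule ccontr)
  assume "\<not> n \<le> enat k"
  let ?\<phi> = "\<lambda>(a, b, x). (\<Sum>i=1..k-1. \<gamma> i * b ^ i * x ^ (k - i)) + R (a, b, x)"
  have "(\<Sum>i=1..k-1. \<gamma> i * 0 ^ i * 0 ^ (k - i)) = 0"
    by (intro sum.neutral) (auto simp: power_0_left)
  \<comment> \<open>The Landau condition says nothing about the value at 0; that value comes from p
    lying on M.\<close>
  then have R0: "R 0 = 0"
    using locally_given_by_origin[OF coords M p] by (simp add: zero_prod_def)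
  obtain F s0 t0 \<rho> where para: "para_holomorphic_curve_at F (s0, t0)" and reg: "regular_curve_at F (s0, t0)"
    and Fp: "F (s0, t0) = p" and \<rho>: "local_defining_function M p \<rho>" "vanishing_order (\<rho> \<circ> F) (s0, t0) = n"
    using n unfolding regular_contact_orders_def has_contact_order_def by auto
  obtain xy ab where F: "F = (\<lambda>(s, t). (xy t, ab s))" and an: "real_analytic_at xy t0" "real_analytic_at ab s0"
    using para unfolding para_holomorphic_curve_at_def by auto
  have xyab: "xy t0 = fst p" "ab s0 = snd p"
    using Fp by (auto simp: F)
  have reg1: "deriv (\<lambda>t. fst (xy t)) t0 \<noteq> 0 \<or> deriv (\<lambda>t. snd (xy t)) t0 \<noteq> 0"
    and reg2: "deriv (\<lambda>s. fst (ab s)) s0 \<noteq> 0 \<or> deriv (\<lambda>s. snd (ab s)) s0 \<noteq> 0"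
    using reg unfolding regular_curve_at_def F by auto
  have cXY: "coordinates_centred_at (xy t0) XY" and cAB: "coordinates_centred_at (ab s0) AB"
    using coords by (auto simp: product_coordinates_centred_at_def xyab)
  obtain X1 Y1 where XY1: "((\<lambda>v. fst (XY (xy (v + t0)))) has_real_derivative X1) (at 0)"
    "((\<lambda>v. snd (XY (xy (v + t0)))) has_real_derivative Y1) (at 0)" "X1 \<noteq> 0 \<or> Y1 \<noteq> 0"
    by (rule coordinates_regular[OF cXY an(1) reg1])
  obtain A1 B1 where AB1: "((\<lambda>v. fst (AB (ab (v + s0)))) has_real_derivative A1) (at 0)"
    "((\<lambda>v. snd (AB (ab (v + s0)))) has_real_derivative B1) (at 0)" "A1 \<noteq> 0 \<or> B1 \<noteq> 0"
    by (rule coordinates_regular[OF cAB an(2) reg2])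
  have XY0: "XY (xy t0) = 0" and AB0: "AB (ab s0) = 0"
    using cXY cAB by (auto simp: coordinates_centred_at_def)
  have "F = (\<lambda>w. (xy (snd w), ab (fst w)))"
    by (auto simp: F)
  then have F_an: "real_analytic_at F (s0, t0)"
    using real_analytic_at_Pair[OF real_analytic_at_comp_snd real_analytic_at_comp_fst, of xy "(s0, t0)" ab] an
    by simp
  have \<rho>an: "real_analytic_at \<rho> p"
    using \<rho>(1) by (simp add: local_defining_function_def)
  have g_an: "real_analytic_at (\<rho> \<circ> F) (s0, t0)"
    unfolding o_def by (rule real_analytic_at_compose[OF F_an]) (simp add: Fp \<rho>an)
  obtain a :: "nat \<Rightarrow> nat \<Rightarrow> real" where a: "\<And>i j. mixed_partial i j (\<rho> \<circ> F) (s0, t0) = fact i * fact j * a i j"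
    and T: "\<And>k. \<exists>C\<ge>0. \<forall>\<^sub>F w in nhds (0, 0). \<bar>(\<rho> \<circ> F) ((s0, t0) + w)
       - (\<Sum>m\<le>k. \<Sum>i\<le>m. a i (m - i) * fst w ^ i * snd w ^ (m - i))\<bar> \<le> C * (\<bar>fst w\<bar> + \<bar>snd w\<bar>) ^ Suc k"
    by (rule taylor2_eventually[OF g_an], rule that)
  have a0: "a i j = 0" if "i + j \<le> k" for i j
  proof (rule ccontr)
    assume "a i j \<noteq> 0"
    then have "vanishing_order (\<rho> \<circ> F) (s0, t0) \<le> enat (i + j)"
      by (intro vanishing_order_le) (simp add: a)
    also have "\<dots> \<le> enat k" using that by simp
    finally show False using \<rho>(2) \<open>\<not> n \<le> enat k\<close> by simp
  qed
  obtain C where C: "\<forall>\<^sub>F w in nhds (0, 0). \<bar>\<rho> (F ((s0, t0) + w))\<bar> \<le> C * (\<bar>fst w\<bar> + \<bar>snd w\<bar>) ^ Suc k"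
  proof -
    have "(\<Sum>m\<le>k. \<Sum>i\<le>m. a i (m - i) * u ^ i * v ^ (m - i)) = 0" for u v
      by (intro sum.neutral ballI) (auto simp: a0)
    then show ?thesis
      using T[of k] that by auto
  qed
  obtain C' where C': "C' > 0" and le: "\<forall>\<^sub>F z in nhds p. \<bar>defect XY AB ?\<phi> z\<bar> \<le> C' * \<bar>\<rho> z\<bar>"
    using defect_le_defining_function[OF coords M p \<rho>(1)] by blast
  have "((\<lambda>w. F ((s0, t0) + w)) \<longlongrightarrow> p) (nhds (0, 0))"
  proof (rule filterlim_compose[where g = F])
    show "(F \<longlongrightarrow> p) (nhds (s0, t0))"
      using real_analytic_tendsto[OF F_an] Fp by simp
    have "((\<lambda>w. (s0, t0) + w) \<longlongrightarrow> (s0, t0) + (0, 0)) (nhds (0, 0))"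
      by (intro tendsto_intros filterlim_ident)
    then show "((\<lambda>w. (s0, t0) + w) \<longlongrightarrow> (s0, t0)) (nhds (0, 0))" by simp
  qed
  from eventually_compose_filterlim[OF le this] C
  have E: "\<forall>\<^sub>F w in nhds (0, 0). \<bar>snd (XY (xy (snd w + t0))) - fst (AB (ab (fst w + s0)))
       - ((\<Sum>i=1..k-1. \<gamma> i * snd (AB (ab (fst w + s0))) ^ i * fst (XY (xy (snd w + t0))) ^ (k - i))
          + R (fst (AB (ab (fst w + s0))), snd (AB (ab (fst w + s0))), fst (XY (xy (snd w + t0)))))\<bar>
       \<le> C' * C * (\<bar>fst w\<bar> + \<bar>snd w\<bar>) ^ Suc k"
  proof eventually_elim
    case (elim w)
    have "C' * \<bar>\<rho> (F ((s0, t0) + w))\<bar> \<le> C' * (C * (\<bar>fst w\<bar> + \<bar>snd w\<bar>) ^ Suc k)"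
      using elim(2) C' by (intro mult_left_mono) auto
    with elim(1) have "\<bar>defect XY AB ?\<phi> (F ((s0, t0) + w))\<bar> \<le> C' * C * (\<bar>fst w\<bar> + \<bar>snd w\<bar>) ^ Suc k"
      unfolding mult.assoc by (rule order_trans)
    moreover have "F ((s0, t0) + w) = (xy (snd w + t0), ab (fst w + s0))"
      by (cases w) (simp add: F add.commute)
    ultimately show ?case
      by (simp only: defect_def fst_conv snd_conv prod.case)
  qed
  have "\<gamma> i = 0"
    by (rule blow_up_leading_form_eq_0[OF R R0 XY1(1) _ XY1(2) _ AB1(1) _ AB1(2) _ XY1(3) AB1(3) E i(1)])
       (simp_all add: XY0 AB0)
  then show False using i(2) by simp
qed

text \<open>The axis curve has a = 0, so along every ray the defining function is minus the leading
  form up to o(r^k). Its Taylor coefficients are therefore zero below degree k and -\<gamma> i in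
  degree k.\<close>

lemma normal_form_contact_order_attained:
  fixes \<gamma> :: "nat \<Rightarrow> real"
  assumes coords: "product_coordinates_centred_at p XY AB"
    and M: "locally_given_by M p XY AB
      (\<lambda>(a, b, x). (\<Sum>i=1..k-1. \<gamma> i * b ^ i * x ^ (k - i)) + R (a, b, x))"
    and R: "R \<in> o[at 0](\<lambda>(a, b, x). \<bar>a\<bar> + (\<bar>x\<bar> + \<bar>b\<bar>) ^ k)"
    and i: "i \<in> {1..k-1}" "\<gamma> i \<noteq> 0" and p: "p \<in> M"
  shows "enat k \<in> regular_contact_orders M p"
proof -
  let ?\<phi> = "\<lambda>(a, b, x). (\<Sum>i=1..k-1. \<gamma> i * b ^ i * x ^ (k - i)) + R (a, b, x)"
  have "(\<Sum>i=1..k-1. \<gamma> i * 0 ^ i * 0 ^ (k - i)) = 0"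
    by (intro sum.neutral) (auto simp: power_0_left)
  then have R0: "R 0 = 0"
    using locally_given_by_origin[OF coords M p] by (simp add: zero_prod_def)
  obtain g where g: "real_analytic_at g (0, 0)" and g\<phi>: "\<forall>\<^sub>F w in nhds (0, 0). g w = - ?\<phi> (0, w)"
    and mem: "vanishing_order g (0, 0) \<in> regular_contact_orders M p"
    by (rule axis_curve_contact_order[OF coords M p])
  obtain a :: "nat \<Rightarrow> nat \<Rightarrow> real" where a: "\<And>i j. mixed_partial i j g (0, 0) = fact i * fact j * a i j"
    and T: "\<And>k. \<exists>C\<ge>0. \<forall>\<^sub>F w in nhds (0, 0). \<bar>g ((0, 0) + w)
       - (\<Sum>m\<le>k. \<Sum>i\<le>m. a i (m - i) * fst w ^ i * snd w ^ (m - i))\<bar> \<le> C * (\<bar>fst w\<bar> + \<bar>snd w\<bar>) ^ Suc k"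
    by (rule taylor2_eventually[OF g], rule that)
  define \<gamma>' where "\<gamma>' i = (if i \<in> {1..k-1} then \<gamma> i else 0)" for i
  \<comment> \<open>The Taylor coefficients of \<open>g\<close>, corrected in degree k by the
    leading form, are to vanish; the correction is added because g = -\<phi>(0, .) near the
    origin.\<close>
  define d where "d m i = a i (m - i) + (if m = k then \<gamma>' i else 0)" for m i
  have d0: "d m i = 0" if "i \<le> m" "m \<le> k" for m i
  proof (rule binary_form_eq_0_imp_coeffs_0[OF _ that(1)])
    fix \<sigma> \<tau>
    define P where "P = (\<Sum>i\<le>k. \<gamma>' i * \<sigma> ^ i * \<tau> ^ (k - i))"
    define h where "h m = (\<Sum>i\<le>m. a i (m - i) * \<sigma> ^ i * \<tau> ^ (m - i))" for m
    have Psum: "(\<Sum>i=1..k-1. \<gamma> i * (r * \<sigma>) ^ i * (r * \<tau>) ^ (k - i)) = P * r ^ k" for r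
    proof -
      have "(\<Sum>i=1..k-1. \<gamma> i * (r * \<sigma>) ^ i * (r * \<tau>) ^ (k - i)) = (\<Sum>i=1..k-1. \<gamma> i * \<sigma> ^ i * \<tau> ^ (k - i)) * r ^ k"
        by (rule binary_form_scale) auto
      also have "(\<Sum>i=1..k-1. \<gamma> i * \<sigma> ^ i * \<tau> ^ (k - i)) = P"
        unfolding P_def by (rule sum.mono_neutral_cong_left) (auto simp: \<gamma>'_def)
      finally show ?thesis .
    qed
    have id: "((\<lambda>r. r * c / r) \<longlongrightarrow> c) (at_right 0)" for c :: real
      using tendsto_scaled_at_right[of "\<lambda>x. x" 1 c] by (simp only: DERIV_ident mult_1_right)
    have Rlim: "((\<lambda>r. R (0, r * \<sigma>, r * \<tau>) / (\<bar>0\<bar> + r ^ k)) \<longlongrightarrow> 0) (at_right 0)"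
      by (rule smallo_weighted_along[OF R R0 tendsto_const id id])
    have "((\<lambda>r. - ((g (r * \<sigma>, r * \<tau>) - (\<Sum>m\<le>k. h m * r ^ m)) / r ^ k) - R (0, r * \<sigma>, r * \<tau>) / (\<bar>0\<bar> + r ^ k))
        \<longlongrightarrow> - 0 - 0) (at_right 0)"
      unfolding h_def by (intro tendsto_diff tendsto_minus taylor2_along_ray T Rlim)
    moreover have "\<forall>\<^sub>F r in at_right 0.
        - ((g (r * \<sigma>, r * \<tau>) - (\<Sum>m\<le>k. h m * r ^ m)) / r ^ k) - R (0, r * \<sigma>, r * \<tau>) / (\<bar>0\<bar> + r ^ k)
        = (\<Sum>m\<le>k. (h m + (if m = k then P else 0)) * r ^ m) / r ^ k"
      using eventually_along_ray[OF g\<phi>, of \<sigma> \<tau>] eventually_at_right_less[of "0::real"]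
    proof eventually_elim
      case (elim r)
      have "g (r * \<sigma>, r * \<tau>) = - (P * r ^ k + R (0, r * \<sigma>, r * \<tau>))"
        using elim(1) by (simp only: prod.case Psum)
      moreover have "(\<Sum>m\<le>k. (h m + (if m = k then P else 0)) * r ^ m) = (\<Sum>m\<le>k. h m * r ^ m) + P * r ^ k"
        by (simp add: distrib_right sum.distrib if_distrib[of "\<lambda>x. x * _"] cong: if_cong)
      ultimately show ?case
        by (simp add: diff_divide_distrib add_divide_distrib)
    qed
    ultimately have "((\<lambda>r. (\<Sum>m\<le>k. (h m + (if m = k then P else 0)) * r ^ m) / r ^ k) \<longlongrightarrow> 0) (at_right 0)"
      by (simp add: filterlim_cong)
    from poly_tendsto_0_imp_coeffs_0[OF this that(2)]
    show "(\<Sum>i\<le>m. d m i * \<sigma> ^ i * \<tau> ^ (m - i)) = 0"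
      by (cases "m = k") (simp_all add: d_def h_def P_def distrib_right sum.distrib)
  qed
  have "enat k \<le> vanishing_order g (0, 0)"
  proof (rule le_vanishing_orderI)
    fix i j assume "i + j < k"
    then show "mixed_partial i j g (0, 0) = 0"
      using d0[of i "i + j"] by (simp add: a d_def)
  qed
  moreover have ik: "i + (k - i) = k" using i(1) by auto
  moreover have "vanishing_order g (0, 0) \<le> enat (i + (k - i))"
    by (rule vanishing_order_le) (use d0[of i k] i ik in \<open>auto simp: a d_def \<gamma>'_def\<close>)
  ultimately show ?thesis
    using mem by (metis antisym)
qed

section \<open>Construction of normalising coordinates\<close>

lemma coordinates_compose_analytic:
  assumes Z: "coordinates_centred_at q Z"
    and an: "\<And>v. real_analytic_at f v" "\<And>v. real_analytic_at f' v"
    and inv: "\<And>v. f' (f v) = v" "\<And>v. f (f' v) = v" and f0: "f 0 = 0"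
  shows "coordinates_centred_at q (\<lambda>u. f (Z u))"
proof -
  from Z obtain U V Z' where 0: "Z q = 0" and U: "open U" "q \<in> U" and V: "open V"
    and h: "homeomorphism U V Z Z'" and Zan: "real_analytic_on Z U" "real_analytic_on Z' V"
    unfolding coordinates_centred_at_def by blast
  have cont: "continuous_on S f" "continuous_on S f'" for S
    by (intro continuous_at_imp_continuous_on ballI differentiable_imp_continuous_within
        real_analytic_imp_differentiable an)+
  \<comment> \<open>As \<open>f'\<close> is defined and continuous everywhere, the new coordinate
    range is a preimage of \<open>V\<close> and hence open, and no domain has to be shrunk.\<close>
  have im: "f ` V = f' -` V"
  proof (intro set_eqI iffI)
    fix v assume "v \<in> f' -` V"
    then have "f (f' v) \<in> f ` V" by auto
    then show "v \<in> f ` V" by (simp only: inv)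
  qed (auto simp: inv)
  have "open (f ` V)"
    unfolding im by (rule open_vimage[OF V cont(2)])
  moreover have "homeomorphism V (f ` V) f f'"
    by (auto simp: homeomorphism_def inv cont image_image)
  then have "homeomorphism U (f ` V) (f \<circ> Z) (Z' \<circ> f')"
    by (rule homeomorphism_compose[OF h])
  moreover have "real_analytic_on (\<lambda>u. f (Z u)) U"
    unfolding real_analytic_on_def
  proof
    fix u assume "u \<in> U"
    then have "real_analytic_at Z u"
      using Zan(1) by (simp only: real_analytic_on_def)
    then show "real_analytic_at (\<lambda>u. f (Z u)) u"
      by (rule real_analytic_at_compose) (rule an(1))
  qed
  moreover have "real_analytic_on (\<lambda>v. Z' (f' v)) (f ` V)"
    unfolding real_analytic_on_def
  proof
    fix v assume "v \<in> f ` V"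
    then have "f' v \<in> V" by (auto simp: inv)
    then have "real_analytic_at Z' (f' v)"
      using Zan(2) by (simp only: real_analytic_on_def)
    then show "real_analytic_at (\<lambda>v. Z' (f' v)) v"
      by (rule real_analytic_at_compose[OF an(2)])
  qed
  ultimately show ?thesis
    unfolding coordinates_centred_at_def using 0 f0 U by (auto simp: o_def)
qed

text \<open>The vanishing a-derivative puts the a-direction into the kernel of \<open>D\<close>.
  Strict differentiability at \<open>w\<close> and \<open>(0, snd w)\<close>, which differ only in
  a, then bounds the increment by |a| alone, uniformly in b and x.\<close>

lemma small_a_increment:
  fixes \<phi> :: "real \<times> real \<times> real \<Rightarrow> real"
  assumes \<phi>: "real_analytic_at \<phi> 0" and der: "deriv (\<lambda>a. \<phi> (a, 0, 0)) 0 = 0" and "\<epsilon> > 0"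
  shows "\<forall>\<^sub>F w in nhds 0. \<bar>\<phi> w - \<phi> (0, snd w)\<bar> \<le> \<epsilon> * \<bar>fst w\<bar>"
proof -
  from real_analytic_strict_derivative[OF \<phi>] obtain D where D: "bounded_linear D"
    and strict: "\<And>\<epsilon>. \<epsilon> > 0 \<Longrightarrow> \<exists>\<delta>>0. \<forall>z\<in>ball 0 \<delta>. \<forall>z'\<in>ball 0 \<delta>. \<bar>\<phi> z - \<phi> z' - D (z - z')\<bar> \<le> \<epsilon> * norm (z - z')"
    by blast
  have \<phi>D: "(\<phi> has_derivative D) (at (0, 0, 0))"
    using strict_imp_has_derivative[OF D strict] by (simp add: zero_prod_def)
  have lin: "D (h, 0, 0) = D (1, 0, 0) * h" for h
    using linear_scale[OF bounded_linear.linear[OF D], of h "(1, 0, 0)"] by simp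
  have "((\<lambda>a. (a, 0, 0)) has_derivative (\<lambda>h. (h, 0, 0))) (at (0::real))"
    by (intro has_derivative_Pair has_derivative_ident has_derivative_const)
  from has_derivative_compose[OF this \<phi>D]
  have "((\<lambda>a. \<phi> (a, 0, 0)) has_derivative (\<lambda>h. D (h, 0, 0))) (at 0)" .
  moreover have "(\<lambda>h. D (h, 0, 0)) = (*) (D (1, 0, 0))"
    by (rule ext, rule lin)
  ultimately have "((\<lambda>a. \<phi> (a, 0, 0)) has_real_derivative D (1, 0, 0)) (at 0)"
    unfolding has_field_derivative_def by (simp only:)
  then have "D (1, 0, 0) = 0"
    using der DERIV_imp_deriv by metis
  then have Da: "D (h, 0, 0) = 0" for h
    using lin[of h] by simp
  obtain \<delta> where \<delta>: "\<delta> > 0" "\<And>z z'. z \<in> ball 0 \<delta> \<Longrightarrow> z' \<in> ball 0 \<delta> \<Longrightarrow> \<bar>\<phi> z - \<phi> z' - D (z - z')\<bar> \<le> \<epsilon> * norm (z - z')"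
    using strict[OF \<open>\<epsilon> > 0\<close>] by blast
  have "\<forall>\<^sub>F w in nhds 0. w \<in> ball (0 :: real \<times> real \<times> real) \<delta>"
    using \<delta>(1) by (intro eventually_nhds_in_open) auto
  then show ?thesis
  proof eventually_elim
    case (elim w)
    obtain a bx where w: "w = (a, bx)" by (cases w)
    have "norm bx \<le> norm w"
      using norm_snd_le[of bx a] by (simp add: w)
    moreover have "norm (0 :: real, bx) = norm bx"
      by (simp add: norm_Pair)
    ultimately have "(0 :: real, bx) \<in> ball 0 \<delta>"
      using elim by (simp only: mem_ball dist_0_norm)
    from \<delta>(2)[OF elim this] show ?case
      using Da[of a] by (simp add: w zero_prod_def norm_Pair)
  qed
qed

text \<open>The shears \<open>y - d x^N\<close> and \<open>a + c b^N\<close> remove the leading pure terms of \<open>\<phi>\<close>. Iterating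
  monomial shears, whose inverses are explicit, replaces the analytic implicit function theorem.\<close>
lemma shear_pure_terms:
  assumes coords: "product_coordinates_centred_at p XY AB" and M: "locally_given_by M p XY AB \<phi>"
    and der: "deriv (\<lambda>a. \<phi> (a, 0, 0)) 0 = 0"
    and b: "((\<lambda>r. \<phi> (0, r, 0) / r ^ n) \<longlongrightarrow> 0) (at_right 0)"
    and x: "((\<lambda>r. \<phi> (0, 0, r) / r ^ n) \<longlongrightarrow> 0) (at_right 0)"
  obtains XY' AB' \<phi>' where "product_coordinates_centred_at p XY' AB'" "locally_given_by M p XY' AB' \<phi>'"
    "deriv (\<lambda>a. \<phi>' (a, 0, 0)) 0 = 0"
    "((\<lambda>r. \<phi>' (0, r, 0) / r ^ Suc n) \<longlongrightarrow> 0) (at_right 0)"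
    "((\<lambda>r. \<phi>' (0, 0, r) / r ^ Suc n) \<longlongrightarrow> 0) (at_right 0)"
proof -
  let ?N = "Suc n"
  have \<phi>: "real_analytic_at \<phi> 0" and Md: "\<forall>\<^sub>F z in nhds p. z \<in> M \<longleftrightarrow> defect XY AB \<phi> z = 0"
    using M by (auto simp: locally_given_by_iff_defect)
  have g: "real_analytic_at (\<lambda>w. \<phi> (0, w)) (0, 0)"
    by (rule real_analytic_at_compose[where g = "\<lambda>w. (0, w)"], intro real_analytic_intros)
       (simp add: \<phi> flip: zero_prod_def)
  obtain e :: "nat \<Rightarrow> nat \<Rightarrow> real" where
    T: "\<And>k. \<exists>C\<ge>0. \<forall>\<^sub>F w in nhds (0, 0). \<bar>\<phi> (0, (0, 0) + w)
       - (\<Sum>m\<le>k. \<Sum>i\<le>m. e i (m - i) * fst w ^ i * snd w ^ (m - i))\<bar> \<le> C * (\<bar>fst w\<bar> + \<bar>snd w\<bar>) ^ Suc k"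
    by (rule taylor2_eventually[OF g], rule that)
  have sum_b: "(\<Sum>i\<le>m. e i (m - i) * 1 ^ i * 0 ^ (m - i)) = e m 0" for m
    using sum.remove[of "{..m}" m "\<lambda>i. e i (m - i) * 1 ^ i * 0 ^ (m - i)"]
    by (simp add: sum.neutral power_0_left)
  have sum_x: "(\<Sum>i\<le>m. e i (m - i) * 0 ^ i * 1 ^ (m - i)) = e 0 m" for m
    using sum.remove[of "{..m}" 0 "\<lambda>i. e i (m - i) * 0 ^ i * 1 ^ (m - i)"]
    by (simp add: sum.neutral power_0_left)
  have ray_b: "((\<lambda>r. (\<phi> (0, r, 0) - (\<Sum>m\<le>k. e m 0 * r ^ m)) / r ^ k) \<longlongrightarrow> 0) (at_right 0)" for k
    using taylor2_along_ray[where g = "\<lambda>w. \<phi> (0, w)" and k = k and \<sigma> = 1 and \<tau> = 0, OF T] unfolding sum_b by simp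
  have ray_x: "((\<lambda>r. (\<phi> (0, 0, r) - (\<Sum>m\<le>k. e 0 m * r ^ m)) / r ^ k) \<longlongrightarrow> 0) (at_right 0)" for k
    using taylor2_along_ray[where g = "\<lambda>w. \<phi> (0, w)" and k = k and \<sigma> = 0 and \<tau> = 1, OF T] unfolding sum_x by simp
  \<comment> \<open>The two hypotheses on the axes annihilate the pure coefficients up to degree n,
    so n + 1 is the first degree in which any can remain.\<close>
  have eb: "e m 0 = 0" and ex: "e 0 m = 0" if "m \<le> n" for m
  proof -
    have "((\<lambda>r. (\<Sum>m\<le>n. e m 0 * r ^ m) / r ^ n) \<longlongrightarrow> 0) (at_right 0)"
      using tendsto_diff[OF b ray_b[of n]] by (simp add: diff_divide_distrib)
    then show "e m 0 = 0" using that by (rule poly_tendsto_0_imp_coeffs_0)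
    have "((\<lambda>r. (\<Sum>m\<le>n. e 0 m * r ^ m) / r ^ n) \<longlongrightarrow> 0) (at_right 0)"
      using tendsto_diff[OF x ray_x[of n]] by (simp add: diff_divide_distrib)
    then show "e 0 m = 0" using that by (rule poly_tendsto_0_imp_coeffs_0)
  qed
  define c where "c = e ?N 0"
  define d where "d = e 0 ?N"
  have lead_b: "((\<lambda>r. (\<phi> (0, r, 0) - c * r ^ ?N) / r ^ ?N) \<longlongrightarrow> 0) (at_right 0)"
    using ray_b[of ?N] by (simp add: eb c_def)
  have lead_x: "((\<lambda>r. (\<phi> (0, 0, r) - d * r ^ ?N) / r ^ ?N) \<longlongrightarrow> 0) (at_right 0)"
    using ray_x[of ?N] by (simp add: ex d_def)
  define f where "f v = (fst v, snd v - d * fst v ^ ?N)" for v :: plane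
  define h where "h v = (fst v + c * snd v ^ ?N, snd v)" for v :: plane
  \<comment> \<open>Obtained by substituting a - c b^N for the old a and y + d x^N for the old y.
    The graph equation itself does not change, hence the equality of the two defects below.\<close>
  define \<phi>' where "\<phi>' = (\<lambda>(a, b, x). \<phi> (a - c * b ^ ?N, b, x) - c * b ^ ?N - d * x ^ ?N)"
  have cXY: "coordinates_centred_at (fst p) (\<lambda>u. f (XY u))"
  proof (rule coordinates_compose_analytic[where f = f and Z = XY and f' = "\<lambda>v. (fst v, snd v + d * fst v ^ ?N)"])
    show "coordinates_centred_at (fst p) XY"
      using coords by (simp add: product_coordinates_centred_at_def)
    show "real_analytic_at f v" "real_analytic_at (\<lambda>v. (fst v, snd v + d * fst v ^ ?N)) v" for v
      unfolding f_def[abs_def] by (intro real_analytic_intros)+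
  qed (simp_all add: f_def zero_prod_def)
  have cAB: "coordinates_centred_at (snd p) (\<lambda>u. h (AB u))"
  proof (rule coordinates_compose_analytic[where f = h and Z = AB and f' = "\<lambda>v. (fst v - c * snd v ^ ?N, snd v)"])
    show "coordinates_centred_at (snd p) AB"
      using coords by (simp add: product_coordinates_centred_at_def)
    show "real_analytic_at h v" "real_analytic_at (\<lambda>v. (fst v - c * snd v ^ ?N, snd v)) v" for v
      unfolding h_def[abs_def] by (intro real_analytic_intros)+
  qed (simp_all add: h_def zero_prod_def)
  have \<phi>'_eq: "\<phi>' = (\<lambda>w. \<phi> (fst w - c * fst (snd w) ^ ?N, fst (snd w), snd (snd w))
      - c * fst (snd w) ^ ?N - d * snd (snd w) ^ ?N)"
    by (auto simp: \<phi>'_def)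
  have "real_analytic_at (\<lambda>w. \<phi> (fst w - c * fst (snd w) ^ ?N, fst (snd w), snd (snd w))) 0"
    by (rule real_analytic_at_compose[where f = \<phi>], intro real_analytic_intros)
       (simp add: \<phi> flip: zero_prod_def)
  then have \<phi>'an: "real_analytic_at \<phi>' 0"
    unfolding \<phi>'_eq by (intro real_analytic_intros)
  have "defect (\<lambda>u. f (XY u)) (\<lambda>u. h (AB u)) \<phi>' z = defect XY AB \<phi> z" for z
    by (simp add: defect_def f_def h_def \<phi>'_def)
  then have M': "locally_given_by M p (\<lambda>u. f (XY u)) (\<lambda>u. h (AB u)) \<phi>'"
    using Md \<phi>'an by (simp add: locally_given_by_iff_defect)
  show ?thesis
  proof (rule that[OF _ M'])
    show "product_coordinates_centred_at p (\<lambda>u. f (XY u)) (\<lambda>u. h (AB u))"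
      using cXY cAB by (simp add: product_coordinates_centred_at_def)
    show "deriv (\<lambda>a. \<phi>' (a, 0, 0)) 0 = 0"
      using der by (simp add: \<phi>'_def)
    show "((\<lambda>r. \<phi>' (0, 0, r) / r ^ ?N) \<longlongrightarrow> 0) (at_right 0)"
      using lead_x by (simp add: \<phi>'_def)
    \<comment> \<open>The shear in a also shifts the first argument of \<phi>. Because the
      a-derivative vanishes at 0, this costs only o(b^N) and does not bring the removed term
      back.\<close>
    have "((\<lambda>r. (\<phi> (- (c * r ^ ?N), r, 0) - \<phi> (0, r, 0)) / r ^ ?N) \<longlongrightarrow> 0) (at_right 0)"
    proof (rule tendstoI)
      fix \<epsilon> :: real assume "\<epsilon> > 0"
      define \<epsilon>' where "\<epsilon>' = \<epsilon> / (\<bar>c\<bar> + 1)"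
      have "\<epsilon>' > 0" using \<open>\<epsilon> > 0\<close> by (simp add: \<epsilon>'_def)
      have "((\<lambda>r. (- (c * r ^ ?N), r, 0 :: real)) \<longlongrightarrow> (- (c * 0 ^ ?N), 0, 0)) (at_right (0 :: real))"
        by (intro tendsto_intros)
      then have "((\<lambda>r. (- (c * r ^ ?N), r, 0 :: real)) \<longlongrightarrow> 0) (at_right (0 :: real))"
        by (simp add: zero_prod_def)
      from eventually_compose_filterlim[OF small_a_increment[OF \<phi> der \<open>\<epsilon>' > 0\<close>] this]
        eventually_at_right_less[of "0::real"]
      show "\<forall>\<^sub>F r in at_right 0. dist ((\<phi> (- (c * r ^ ?N), r, 0) - \<phi> (0, r, 0)) / r ^ ?N) 0 < \<epsilon>"
      proof eventually_elim
        case (elim r)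
        have rN: "r ^ ?N > 0" using elim(2) by (rule zero_less_power)
        have "\<bar>\<phi> (- (c * r ^ ?N), r, 0) - \<phi> (0, r, 0)\<bar> \<le> \<epsilon>' * (\<bar>c\<bar> * r ^ ?N)"
          using elim rN by (simp add: abs_mult del: power_Suc)
        also have "\<dots> < \<epsilon>' * ((\<bar>c\<bar> + 1) * r ^ ?N)"
          using rN \<open>\<epsilon>' > 0\<close> by (intro mult_strict_left_mono mult_strict_right_mono) auto
        also have "\<dots> = \<epsilon> * r ^ ?N"
          by (simp add: \<epsilon>'_def add_nonneg_pos less_imp_neq[symmetric])
        finally show ?case
          using rN by (simp add: divide_less_eq del: power_Suc)
      qed
    qed
    from tendsto_add[OF this lead_b]
    show "((\<lambda>r. \<phi>' (0, r, 0) / r ^ ?N) \<longlongrightarrow> 0) (at_right 0)"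
      by (simp add: \<phi>'_def add_divide_distrib diff_divide_distrib)
  qed
qed

text \<open>A shear improves both pure parts from o(r^n) to o(r^(n+1)) and preserves the condition
  on the a-derivative, so it can be repeated. For n = 0 the limits only express continuity and
  \<phi>(0) = 0.\<close>

lemma pure_terms_removable:
  assumes CR: "real_analytic_para_CR_manifold M" and p: "p \<in> M"
  shows "\<exists>XY AB \<phi>. product_coordinates_centred_at p XY AB \<and> locally_given_by M p XY AB \<phi> \<and>
    deriv (\<lambda>a. \<phi> (a, 0, 0)) 0 = 0 \<and>
    ((\<lambda>r. \<phi> (0, r, 0) / r ^ n) \<longlongrightarrow> 0) (at_right 0) \<and> ((\<lambda>r. \<phi> (0, 0, r) / r ^ n) \<longlongrightarrow> 0) (at_right 0)"
proof (induction n)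
  case 0
  obtain XY AB \<phi> where coords: "product_coordinates_centred_at p XY AB" and M: "locally_given_by M p XY AB \<phi>"
    and der: "deriv (\<lambda>a. \<phi> (a, 0, 0)) 0 = 0"
    using CR p unfolding real_analytic_para_CR_manifold_def by blast
  have "(\<phi> \<longlongrightarrow> 0) (nhds 0)"
    using real_analytic_tendsto[of \<phi> 0] M locally_given_by_origin[OF coords M p]
    by (simp add: locally_given_by_def)
  moreover have "((\<lambda>r. (0, r, 0)) \<longlongrightarrow> (0 :: real \<times> real \<times> real)) (at_right 0)"
    "((\<lambda>r. (0, 0, r)) \<longlongrightarrow> (0 :: real \<times> real \<times> real)) (at_right 0)"
    unfolding zero_prod_def by (intro tendsto_intros)+
  ultimately have "((\<lambda>r. \<phi> (0, r, 0)) \<longlongrightarrow> 0) (at_right 0)" "((\<lambda>r. \<phi> (0, 0, r)) \<longlongrightarrow> 0) (at_right 0)"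
    using filterlim_compose by blast+
  then show ?case
    using coords M der by (intro exI[of _ XY] exI[of _ AB] exI[of _ \<phi>]) simp
next
  case (Suc n)
  then obtain XY AB \<phi> where "product_coordinates_centred_at p XY AB" "locally_given_by M p XY AB \<phi>"
    "deriv (\<lambda>a. \<phi> (a, 0, 0)) 0 = 0"
    "((\<lambda>r. \<phi> (0, r, 0) / r ^ n) \<longlongrightarrow> 0) (at_right 0)" "((\<lambda>r. \<phi> (0, 0, r) / r ^ n) \<longlongrightarrow> 0) (at_right 0)"
    by (elim exE conjE)
  then obtain XY' AB' \<phi>' where "product_coordinates_centred_at p XY' AB'" "locally_given_by M p XY' AB' \<phi>'"
    "deriv (\<lambda>a. \<phi>' (a, 0, 0)) 0 = 0"
    "((\<lambda>r. \<phi>' (0, r, 0) / r ^ Suc n) \<longlongrightarrow> 0) (at_right 0)"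
    "((\<lambda>r. \<phi>' (0, 0, r) / r ^ Suc n) \<longlongrightarrow> 0) (at_right 0)"
    by (rule shear_pure_terms)
  then show ?case
    by (intro exI conjI)
qed

lemma normal_form_imp_finite_type:
  fixes \<gamma> :: "nat \<Rightarrow> real"
  assumes "product_coordinates_centred_at p XY AB"
    and "locally_given_by M p XY AB
      (\<lambda>(a, b, x). (\<Sum>i=1..k-1. \<gamma> i * b ^ i * x ^ (k - i)) + R (a, b, x))"
    and "R \<in> o[at 0](\<lambda>(a, b, x). \<bar>a\<bar> + (\<bar>x\<bar> + \<bar>b\<bar>) ^ k)"
    and "\<exists>i\<in>{1..k-1}. \<gamma> i \<noteq> 0" and "p \<in> M"
  shows "finite_type M p k"
proof -
  obtain i where i: "i \<in> {1..k-1}" "\<gamma> i \<noteq> 0" using assms(4) by blast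
  show ?thesis
    unfolding finite_type_def
    using normal_form_contact_order_attained[OF assms(1-3) i assms(5)]
      normal_form_contact_order_le[OF assms(1-3) i assms(5)] by blast
qed

lemma finite_type_imp_normal_form:
  assumes CR: "real_analytic_para_CR_manifold M" and p: "p \<in> M" and fin: "finite_type M p k"
  shows "\<exists>XY AB (\<gamma> :: nat \<Rightarrow> real) R.
       product_coordinates_centred_at p XY AB \<and>
       locally_given_by M p XY AB
         (\<lambda>(a, b, x). (\<Sum>i=1..k-1. \<gamma> i * b ^ i * x ^ (k - i)) + R (a, b, x)) \<and>
       R \<in> o[at 0](\<lambda>(a, b, x). \<bar>a\<bar> + (\<bar>x\<bar> + \<bar>b\<bar>) ^ k) \<and>
       (\<exists>i\<in>{1..k-1}. \<gamma> i \<noteq> 0)"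
proof -
  obtain XY AB \<phi> where coords: "product_coordinates_centred_at p XY AB" and M: "locally_given_by M p XY AB \<phi>"
    and der: "deriv (\<lambda>a. \<phi> (a, 0, 0)) 0 = 0"
    and b: "((\<lambda>r. \<phi> (0, r, 0) / r ^ k) \<longlongrightarrow> 0) (at_right 0)"
    and x: "((\<lambda>r. \<phi> (0, 0, r) / r ^ k) \<longlongrightarrow> 0) (at_right 0)"
    using pure_terms_removable[OF CR p, of k] by blast
  have \<phi>: "real_analytic_at \<phi> 0"
    using M by (simp add: locally_given_by_def)
  obtain g where g: "real_analytic_at g (0, 0)" and g\<phi>: "\<forall>\<^sub>F w in nhds (0, 0). g w = - \<phi> (0, w)"
    and mem: "vanishing_order g (0, 0) \<in> regular_contact_orders M p"
    by (rule axis_curve_contact_order[OF coords M p])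
  obtain e :: "nat \<Rightarrow> nat \<Rightarrow> real" where e: "\<And>i j. mixed_partial i j g (0, 0) = fact i * fact j * e i j"
    and T: "\<And>k. \<exists>C\<ge>0. \<forall>\<^sub>F w in nhds (0, 0). \<bar>g ((0, 0) + w)
       - (\<Sum>m\<le>k. \<Sum>i\<le>m. e i (m - i) * fst w ^ i * snd w ^ (m - i))\<bar> \<le> C * (\<bar>fst w\<bar> + \<bar>snd w\<bar>) ^ Suc k"
    by (rule taylor2_eventually[OF g], rule that)
  have pure: "(\<Sum>i\<le>m. e i (m - i) * \<sigma> ^ i * \<tau> ^ (m - i)) = 0"
    if "((\<lambda>r. \<phi> (0, r * \<sigma>, r * \<tau>) / r ^ k) \<longlongrightarrow> 0) (at_right 0)" "m \<le> k" for \<sigma> \<tau> m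
  proof -
    let ?s = "\<lambda>r. \<Sum>m\<le>k. (\<Sum>i\<le>m. e i (m - i) * \<sigma> ^ i * \<tau> ^ (m - i)) * r ^ m"
    have "((\<lambda>r. - (\<phi> (0, r * \<sigma>, r * \<tau>) / r ^ k) - (g (r * \<sigma>, r * \<tau>) - ?s r) / r ^ k) \<longlongrightarrow> - 0 - 0) (at_right 0)"
      by (intro tendsto_diff tendsto_minus that taylor2_along_ray T)
    moreover have "\<forall>\<^sub>F r in at_right 0. - (\<phi> (0, r * \<sigma>, r * \<tau>) / r ^ k) - (g (r * \<sigma>, r * \<tau>) - ?s r) / r ^ k
        = ?s r / r ^ k"
      using eventually_along_ray[OF g\<phi>, of \<sigma> \<tau>]
      by eventually_elim (simp add: diff_divide_distrib)
    ultimately have "((\<lambda>r. ?s r / r ^ k) \<longlongrightarrow> 0) (at_right 0)"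
      by (simp add: filterlim_cong)
    from poly_tendsto_0_imp_coeffs_0[OF this that(2)] show ?thesis .
  qed
  have eb: "e m 0 = 0" and ex: "e 0 m = 0" if "m \<le> k" for m
  proof -
    have "(\<Sum>i\<le>m. e i (m - i) * 1 ^ i * 0 ^ (m - i)) = e m 0"
      using sum.remove[of "{..m}" m "\<lambda>i. e i (m - i) * 1 ^ i * 0 ^ (m - i)"]
      by (simp add: sum.neutral power_0_left)
    then show "e m 0 = 0" using pure[of 1 0 m] b that by simp
    have "(\<Sum>i\<le>m. e i (m - i) * 0 ^ i * 1 ^ (m - i)) = e 0 m"
      using sum.remove[of "{..m}" 0 "\<lambda>i. e i (m - i) * 0 ^ i * 1 ^ (m - i)"]
      by (simp add: sum.neutral power_0_left)
    then show "e 0 m = 0" using pure[of 0 1 m] x that by simp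
  qed
  \<comment> \<open>Otherwise the axis curve would have contact above k with M, against finite type
    k.\<close>
  have "\<exists>m. m \<le> k \<and> (\<exists>i j. i + j = m \<and> e i j \<noteq> 0)"
  proof (rule ccontr)
    assume "\<not> ?thesis"
    then have "enat (Suc k) \<le> vanishing_order g (0, 0)"
      by (intro le_vanishing_orderI) (auto simp: e less_Suc_eq_le)
    moreover have "vanishing_order g (0, 0) \<le> enat k"
      using fin mem by (simp add: finite_type_def)
    ultimately have "enat (Suc k) \<le> enat k" by (rule order_trans)
    then show False by simp
  qed
  then obtain m where m: "m \<le> k" "\<exists>i j. i + j = m \<and> e i j \<noteq> 0"
    and least: "\<And>i j. i + j < m \<Longrightarrow> e i j = 0"
    using exists_least_iff[of "\<lambda>m. m \<le> k \<and> (\<exists>i j. i + j = m \<and> e i j \<noteq> 0)"]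
    by (metis less_imp_le order_trans)
  then obtain i0 j0 where ij: "i0 + j0 = m" "e i0 j0 \<noteq> 0" by blast
  \<comment> \<open>As m \<le> k, the pure coefficients of degree m have already been removed, so
    the lowest form is made of mixed monomials.\<close>
  have "i0 \<noteq> 0" "j0 \<noteq> 0"
    using ij m(1) eb[of m] ex[of m] by (metis add_0 add_0_right)+
  then have i0: "i0 \<in> {1..m-1}" "j0 = m - i0"
    using ij(1) by auto
  define \<gamma> where "\<gamma> i = - e i (m - i)" for i
  define P where "P b x = (\<Sum>i=1..m-1. \<gamma> i * b ^ i * x ^ (m - i))" for b x
  define R where "R = (\<lambda>(a, b, x). \<phi> (a, b, x) - P b x)"
  have \<phi>_eq: "(\<lambda>(a, b, x). (\<Sum>i=1..m-1. \<gamma> i * b ^ i * x ^ (m - i)) + R (a, b, x)) = \<phi>"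
    by (auto simp: R_def P_def)
  have low: "(\<Sum>m'\<le>m. \<Sum>i\<le>m'. e i (m' - i) * b ^ i * x ^ (m' - i)) = - P b x" for b x
  proof -
    have "(\<Sum>m'\<le>m. \<Sum>i\<le>m'. e i (m' - i) * b ^ i * x ^ (m' - i)) = (\<Sum>i\<le>m. e i (m - i) * b ^ i * x ^ (m - i))"
      using sum.remove[of "{..m}" m "\<lambda>m'. \<Sum>i\<le>m'. e i (m' - i) * b ^ i * x ^ (m' - i)"]
      by (auto intro!: sum.neutral simp: least)
    also have "\<dots> = (\<Sum>i=1..m-1. e i (m - i) * b ^ i * x ^ (m - i))"
    proof (rule sum.mono_neutral_right)
      show "\<forall>i\<in>{..m} - {1..m-1}. e i (m - i) * b ^ i * x ^ (m - i) = 0"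
      proof
        fix i assume "i \<in> {..m} - {1..m-1}"
        then have "i = 0 \<or> i = m" by auto
        then show "e i (m - i) * b ^ i * x ^ (m - i) = 0"
          using eb[OF m(1)] ex[OF m(1)] by auto
      qed
    qed auto
    finally show ?thesis
      by (simp add: P_def \<gamma>_def sum_negf)
  qed
  obtain C where C: "C \<ge> 0" and gC: "\<forall>\<^sub>F w in nhds (0, 0). \<bar>g w + P (fst w) (snd w)\<bar> \<le> C * (\<bar>fst w\<bar> + \<bar>snd w\<bar>) ^ Suc m"
    using T[of m] unfolding low by (auto simp flip: zero_prod_def)
  \<comment> \<open>\<open>R\<close> is the increment of \<phi> in a, at most c |a| by
    \<open>small_a_increment\<close>, plus the Taylor remainder of \<phi>(0, b, x), which is at most
    C N^(m+1) with N = |x| + |b| and hence at most c N^m once C N < c.\<close>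
  have "R \<in> o[at 0](\<lambda>(a, b, x). \<bar>a\<bar> + (\<bar>x\<bar> + \<bar>b\<bar>) ^ m)"
  proof (rule landau_o.smallI)
    fix c :: real assume "c > 0"
    have snd_lim: "((snd :: real \<times> real \<times> real \<Rightarrow> real \<times> real) \<longlongrightarrow> (0, 0)) (nhds 0)"
      by (auto intro!: tendsto_eq_intros filterlim_ident simp: zero_prod_def)
    have "((\<lambda>w :: real \<times> real \<times> real. C * (\<bar>fst (snd w)\<bar> + \<bar>snd (snd w)\<bar>)) \<longlongrightarrow> C * (\<bar>0\<bar> + \<bar>0\<bar>)) (nhds 0)"
      by (intro tendsto_intros) (auto intro!: tendsto_eq_intros filterlim_ident)
    then have "\<forall>\<^sub>F w in nhds (0 :: real \<times> real \<times> real). C * (\<bar>fst (snd w)\<bar> + \<bar>snd (snd w)\<bar>) < c"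
      using \<open>c > 0\<close> by (intro order_tendstoD(2)) auto
    then have "\<forall>\<^sub>F w in nhds 0. norm (R w) \<le> c * norm (case w of (a, b, x) \<Rightarrow> \<bar>a\<bar> + (\<bar>x\<bar> + \<bar>b\<bar>) ^ m)"
      using small_a_increment[OF \<phi> der \<open>c > 0\<close>] eventually_compose_filterlim[OF gC snd_lim]
        eventually_compose_filterlim[OF g\<phi> snd_lim]
    proof eventually_elim
      case (elim w)
      obtain a b x where w: "w = (a, b, x)" by (cases w)
      let ?N = "\<bar>x\<bar> + \<bar>b\<bar>"
      have "\<bar>\<phi> (0, b, x) - P b x\<bar> \<le> C * ?N ^ Suc m"
        using elim(3,4) by (simp add: w add.commute abs_minus_commute)
      also have "\<dots> = C * ?N * ?N ^ m" by simp
      also have "\<dots> \<le> c * ?N ^ m"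
        using elim(1) by (intro mult_right_mono) (auto simp: w add.commute)
      finally have "\<bar>\<phi> (a, b, x) - P b x\<bar> \<le> c * \<bar>a\<bar> + c * ?N ^ m"
        using elim(2) by (simp add: w)
      then show ?case
        by (simp add: w R_def distrib_left abs_of_nonneg)
    qed
    then show "\<forall>\<^sub>F w in at 0. norm (R w) \<le> c * norm (case w of (a, b, x) \<Rightarrow> \<bar>a\<bar> + (\<bar>x\<bar> + \<bar>b\<bar>) ^ m)"
      by (simp add: eventually_nhds_conv_at)
  qed
  moreover have "\<exists>i\<in>{1..m-1}. \<gamma> i \<noteq> 0"
    using i0 ij(2) by (auto simp: \<gamma>_def)
  moreover have "locally_given_by M p XY AB
      (\<lambda>(a, b, x). (\<Sum>i=1..m-1. \<gamma> i * b ^ i * x ^ (m - i)) + R (a, b, x))"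
    using M by (simp only: \<phi>_eq)
  \<comment> \<open>The converse implication, applied to the normal form of degree m, gives type m;
    the type at p is unique.\<close>
  moreover from calculation have "finite_type M p m"
    by (intro normal_form_imp_finite_type[OF coords _ _ _ p])
  then have "m = k"
    using fin unfolding finite_type_def by (metis antisym enat_ord_simps(1))
  ultimately show ?thesis
    using coords by (intro exI[of _ XY] exI[of _ AB] exI[of _ \<gamma>] exI[of _ R]) simp
qed

theorem proposition5:
  fixes M :: "ambient set" and p :: ambient and k :: nat
  assumes "real_analytic_para_CR_manifold M" and "p \<in> M"
  shows "finite_type M p k \<longleftrightarrow>
    (\<exists>XY AB (\<gamma> :: nat \<Rightarrow> real) R.
       product_coordinates_centred_at p XY AB \<and>
       locally_given_by M p XY AB
         (\<lambda>(a, b, x). (\<Sum>i=1..k-1. \<gamma> i * b ^ i * x ^ (k - i)) + R (a, b, x)) \<and>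
       R \<in> o[at 0](\<lambda>(a, b, x). \<bar>a\<bar> + (\<bar>x\<bar> + \<bar>b\<bar>) ^ k) \<and>
       (\<exists>i\<in>{1..k-1}. \<gamma> i \<noteq> 0))"
  using finite_type_imp_normal_form[OF assms] normal_form_imp_finite_type[OF _ _ _ _ assms(2)]
  by blast

end
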